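(* Let $G$ be a finite group with identity $e$ and let $S\subseteq G\setminus\{e\}$ be a symmetric generating set of $G$. There exists a weight $w\in\mathcal{L}_S$ such that the operator $\mathtt{L}_w$ on $\mathcal{C}(G,S)$ is real $G$-simple if and only if the following three conditions hold simultaneously: (i) $a_{W_1,W_2}\not\equiv 0$ on $\mathbb{R}^{S'}$ for all $W_1,W_2\in\operatorname{Irr}(G,\mathbb{C})$ such that $W_2$ is isomorphic neither to $W_1$ nor to $W_1^*$; (ii) $b_W\not\equiv 0$ on $\mathbb{R}^{S'}$ for all $W\in\operatorname{Irr}(G,\mathbb{C})$ of real type or of complex type; (iii) $c_W\not\equiv 0$ on $\mathbb{R}^{S'}$ for all $W\in\operatorname{Irr}(G,\mathbb{C})$ of quaternionic type. Here $a_{W_1,W_2}$, $b_W$, $c_W$ are built from the operators $\mathtt{D}_W(\alpha)=\sum_{s\in S}\alpha_s(\rho(s)-\rho(e))^2$. Moreover, if such a weight exists, then the set of all $w\in\mathcal{L}_S$ for which $\mathtt{L}_w$ is real $G$-simple is a residual set in $\mathcal{L}_S$.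
   Context: $S$ symmetric means $s^{-1}\in S$ for all $s\in S$. The Cayley graph $\mathcal{C}(G,S)$ has vertex set $G$ and edges $\{x,xs\}$, $x\in G$, $s\in S$. Put $S'=\{\{s,s^{-1}\}: s\in S\}$; for $\alpha\in\mathbb{R}^{S'}$ and $s\in S$ write $\alpha_s:=\alpha_{\{s,s^{-1}\}}$ (so $\alpha_s=\alpha_{s^{-1}}$). The space of left-invariant weights is $\mathcal{L}_S=\{w\in\mathbb{R}^{S'}: w_{s'}>0 \text{ for all } s'\in S'\}$, with the topology induced from $\mathbb{R}^{S'}$; a subset is residual if its complement in $\mathcal{L}_S$ is meager. For $f:G\to\mathbb{C}$ (or $\mathbb{R}$), $\mathtt{L}_w f(x)=\sum_{s\in S}w_s\big(f(xs^2)-2f(xs)+f(x)\big)$. Let $\mathcal{A}_{\mathbb{R}}$ be the real vector space of functions $f:G\to\mathbb{R}$ with the left regular representation $(L(y)f)(x)=f(y^{-1}x)$. $\mathtt{L}_w$ is called real $G$-simple if every eigenspace of $\mathtt{L}_w:\mathcal{A}_{\mathbb{R}}\to\mathcal{A}_{\mathbb{R}}$ is an irreducible real subrepresentation of $(\mathcal{A}_{\mathbb{R}},L)$. $\operatorname{Irr}(G,\mathbb{C})$ is the set of isomorphism classes of irreducible complex representations $(W,\rho)$ of $G$; $W^*$ is the dual representation. $W$ is of real type (resp. quaternionic type) if it admits a conjugate-linear $G$-equivariant map $J:W\to W$ with $J^2=\mathrm{id}$ (resp. $J^2=-\mathrm{id}$); otherwise it is of complex type. For $(W,\rho)\in\operatorname{Irr}(G,\mathbb{C})$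 and $\alpha\in\mathbb{R}^{S'}$, let $\mathtt{D}_W(\alpha)=\sum_{s\in S}\alpha_s(\rho(s^2)-2\rho(s)+\rho(e))=\sum_{s\in S}\alpha_s(\rho(s)-\rho(e))^2:W\to W$, and let $P_W(\alpha)\in\mathbb{C}[x]$ be the characteristic polynomial of $\mathtt{D}_W(\alpha)$, with first and second derivatives (in $x$) $P_W'(\alpha)$ and $P_W''(\alpha)$. Let $\operatorname{res}$ denote the resultant of two complex polynomials, a polynomial expression in their coefficients with $\operatorname{res}(p,q)\neq 0$ if and only if $p$ and $q$ have no common zero. Define functions $\mathbb{R}^{S'}\to\mathbb{C}$ by $a_{W_1,W_2}(\alpha)=\operatorname{res}(P_{W_1}(\alpha),P_{W_2}(\alpha))$, $b_W(\alpha)=\operatorname{res}(P_W(\alpha),P_W'(\alpha))$, $c_W(\alpha)=\operatorname{res}(P_W(\alpha),P_W''(\alpha))$. *)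

theory Defs
  imports
    "HOL-Analysis.Analysis"
    "HOL-Algebra.Generated_Groups"
    "Jordan_Normal_Form.VS_Connect"
    "Jordan_Normal_Form.Char_Poly"
    "Subresultants.Resultant_Prelim"
begin

section \<open>Meager and residual sets\<close>

definition nowhere_dense_in :: "'a topology \<Rightarrow> 'a set \<Rightarrow> bool" where
  "nowhere_dense_in X A \<longleftrightarrow> A \<subseteq> topspace X \<and> X interior_of (X closure_of A) = {}"

definition meager_in :: "'a topology \<Rightarrow> 'a set \<Rightarrow> bool" where
  "meager_in X A \<longleftrightarrow> (\<exists>\<N>. countable \<N> \<and> (\<forall>N\<in>\<N>. nowhere_dense_in X N) \<and> A = \<Union>\<N>)"

definition residual_in :: "'a topology \<Rightarrow> 'a set \<Rightarrow> bool" where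
  "residual_in X A \<longleftrightarrow> A \<subseteq> topspace X \<and> meager_in X (topspace X - A)"

section \<open>Left-invariant weights\<close>

definition inverse_pairs :: "('g, 'm) monoid_scheme \<Rightarrow> 'g set \<Rightarrow> 'g set set" where
  "inverse_pairs G S = (\<lambda>s. {s, inv\<^bsub>G\<^esub> s}) ` S"

text \<open>The space $\mathbb{R}^{S'}$ with its product topology. Its points are the extensional
  functions on the set of inverse pairs.\<close>

definition param_space :: "('g, 'm) monoid_scheme \<Rightarrow> 'g set \<Rightarrow> ('g set \<Rightarrow> real) topology" where
  "param_space G S = powertop_real (inverse_pairs G S)"

definition weights :: "('g, 'm) monoid_scheme \<Rightarrow> 'g set \<Rightarrow> ('g set \<Rightarrow> real) set" where
  "weights G S = {w \<in> topspace (param_space G S). \<forall>p\<in>inverse_pairs G S. w p > 0}"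

definition weight_space :: "('g, 'm) monoid_scheme \<Rightarrow> 'g set \<Rightarrow> ('g set \<Rightarrow> real) topology" where
  "weight_space G S = subtopology (param_space G S) (weights G S)"

definition coeff_at :: "('g, 'm) monoid_scheme \<Rightarrow> ('g set \<Rightarrow> real) \<Rightarrow> 'g \<Rightarrow> real" where
  "coeff_at G \<alpha> s = \<alpha> {s, inv\<^bsub>G\<^esub> s}"

section \<open>Irreducible subrepresentations\<close>

text \<open>Here \<open>\<sigma>\<close> is an action of the group \<open>G\<close> by linear maps on the vector space \<open>M\<close> over the
  field \<open>K\<close>.\<close>

definition subrep ::
  "('k, 'l) ring_scheme \<Rightarrow> ('k, 'v, 'n) module_scheme \<Rightarrow> ('g, 'm) monoid_scheme
    \<Rightarrow> ('g \<Rightarrow> 'v \<Rightarrow> 'v) \<Rightarrow> 'v set \<Rightarrow> bool" where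
  "subrep K M G \<sigma> U \<longleftrightarrow>
     VectorSpace.subspace K U M \<and> (\<forall>g\<in>carrier G. \<forall>u\<in>U. \<sigma> g u \<in> U)"

definition irreducible_subrep ::
  "('k, 'l) ring_scheme \<Rightarrow> ('k, 'v, 'n) module_scheme \<Rightarrow> ('g, 'm) monoid_scheme
    \<Rightarrow> ('g \<Rightarrow> 'v \<Rightarrow> 'v) \<Rightarrow> 'v set \<Rightarrow> bool" where
  "irreducible_subrep K M G \<sigma> V \<longleftrightarrow>
     subrep K M G \<sigma> V \<and> V \<noteq> {\<zero>\<^bsub>M\<^esub>} \<and>
     (\<forall>U. subrep K M G \<sigma> U \<and> U \<subseteq> V \<longrightarrow> U = {\<zero>\<^bsub>M\<^esub>} \<or> U = V)"

section \<open>The operator on real functions\<close>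

definition real_functions :: "('g, 'm) monoid_scheme \<Rightarrow> (real, 'g \<Rightarrow> real) module" where
  "real_functions G = \<lparr>
     carrier = carrier G \<rightarrow>\<^sub>E UNIV,
     mult = undefined,
     one = undefined,
     zero = (\<lambda>x\<in>carrier G. 0),
     add = (\<lambda>f h. \<lambda>x\<in>carrier G. f x + h x),
     smult = (\<lambda>c f. \<lambda>x\<in>carrier G. c * f x)\<rparr>"

text \<open>The notion of subspace requires the ambient structure to be a vector space, so this must
  hold for the definitions below to be meaningful.\<close>

lemma vectorspace_real_functions: "vectorspace class_ring (real_functions G)"
proof -
  note simps = real_functions_def restrict_def fun_eq_iff PiE_iff extensional_def algebra_simps
  have "abelian_group (real_functions G)"
  proof (rule abelian_groupI)
    fix f assume "f \<in> carrier (real_functions G)"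
    then show "\<exists>h\<in>carrier (real_functions G).
        h \<oplus>\<^bsub>real_functions G\<^esub> f = \<zero>\<^bsub>real_functions G\<^esub>"
      by (intro bexI[of _ "\<lambda>x\<in>carrier G. - f x"]) (auto simp: simps)
  qed (auto simp: simps)
  then have "Module.module class_ring (real_functions G)"
    by (intro Module.module.intro module_axioms.intro class_cring.is_cring) (auto simp: simps)
  then show ?thesis
    by (simp add: vectorspace_def class_field.field_axioms)
qed

definition left_regular ::
  "('g, 'm) monoid_scheme \<Rightarrow> 'g \<Rightarrow> ('g \<Rightarrow> real) \<Rightarrow> ('g \<Rightarrow> real)" where
  "left_regular G y f = (\<lambda>x\<in>carrier G. f (inv\<^bsub>G\<^esub> y \<otimes>\<^bsub>G\<^esub> x))"

definition L_op ::
  "('g, 'm) monoid_scheme \<Rightarrow> 'g set \<Rightarrow> ('g set \<Rightarrow> real) \<Rightarrow> ('g \<Rightarrow> real) \<Rightarrow> ('g \<Rightarrow> real)" where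
  "L_op G S w f = (\<lambda>x\<in>carrier G.
     \<Sum>s\<in>S. coeff_at G w s * (f (x \<otimes>\<^bsub>G\<^esub> (s \<otimes>\<^bsub>G\<^esub> s)) - 2 * f (x \<otimes>\<^bsub>G\<^esub> s) + f x))"

definition L_eigenspace ::
  "('g, 'm) monoid_scheme \<Rightarrow> 'g set \<Rightarrow> ('g set \<Rightarrow> real) \<Rightarrow> real \<Rightarrow> ('g \<Rightarrow> real) set" where
  "L_eigenspace G S w \<mu> =
     {f \<in> carrier (real_functions G). L_op G S w f = \<mu> \<odot>\<^bsub>real_functions G\<^esub> f}"

text \<open>A real number is an eigenvalue precisely when its eigenspace is nonzero.\<close>

definition real_G_simple ::
  "('g, 'm) monoid_scheme \<Rightarrow> 'g set \<Rightarrow> ('g set \<Rightarrow> real) \<Rightarrow> bool" where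
  "real_G_simple G S w \<longleftrightarrow>
     (\<forall>\<mu>. L_eigenspace G S w \<mu> \<noteq> {\<zero>\<^bsub>real_functions G\<^esub>} \<longrightarrow>
        irreducible_subrep class_ring (real_functions G) G (left_regular G)
          (L_eigenspace G S w \<mu>))"

section \<open>Irreducible complex representations\<close>

text \<open>Irreducible complex representations of a finite group are finite-dimensional; after the
  choice of a basis they are homomorphisms into $\mathrm{GL}_n(\mathbb{C})$, acting on column
  vectors.\<close>

definition GL :: "nat \<Rightarrow> complex mat monoid" where
  "GL n = units_of (ring_mat TYPE(complex) n ())"

definition complex_irrep ::
  "('g, 'm) monoid_scheme \<Rightarrow> nat \<Rightarrow> ('g \<Rightarrow> complex mat) \<Rightarrow> bool" where
  "complex_irrep G n \<rho> \<longleftrightarrow>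
     \<rho> \<in> hom G (GL n) \<and>
     irreducible_subrep class_ring (module_vec TYPE(complex) n) G (\<lambda>g v. \<rho> g *\<^sub>v v)
       (carrier_vec n)"

definition rep_iso ::
  "('g, 'm) monoid_scheme \<Rightarrow> nat \<Rightarrow> ('g \<Rightarrow> complex mat) \<Rightarrow> nat \<Rightarrow> ('g \<Rightarrow> complex mat) \<Rightarrow> bool" where
  "rep_iso G n\<^sub>1 \<rho>\<^sub>1 n\<^sub>2 \<rho>\<^sub>2 \<longleftrightarrow>
     n\<^sub>1 = n\<^sub>2 \<and> (\<exists>T\<in>carrier (GL n\<^sub>1). \<forall>g\<in>carrier G. T * \<rho>\<^sub>1 g = \<rho>\<^sub>2 g * T)"

text \<open>The dual representation, in the dual basis.\<close>

definition dual_rep ::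
  "('g, 'm) monoid_scheme \<Rightarrow> ('g \<Rightarrow> complex mat) \<Rightarrow> 'g \<Rightarrow> complex mat" where
  "dual_rep G \<rho> g = (\<rho> (inv\<^bsub>G\<^esub> g))\<^sup>T"

definition conj_linear_equivariant ::
  "('g, 'm) monoid_scheme \<Rightarrow> nat \<Rightarrow> ('g \<Rightarrow> complex mat) \<Rightarrow> (complex vec \<Rightarrow> complex vec) \<Rightarrow> bool" where
  "conj_linear_equivariant G n \<rho> J \<longleftrightarrow>
     J \<in> carrier_vec n \<rightarrow> carrier_vec n \<and>
     (\<forall>u\<in>carrier_vec n. \<forall>v\<in>carrier_vec n. J (u + v) = J u + J v) \<and>
     (\<forall>c. \<forall>v\<in>carrier_vec n. J (c \<cdot>\<^sub>v v) = cnj c \<cdot>\<^sub>v J v) \<and>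
     (\<forall>g\<in>carrier G. \<forall>v\<in>carrier_vec n. J (\<rho> g *\<^sub>v v) = \<rho> g *\<^sub>v J v)"

definition real_type ::
  "('g, 'm) monoid_scheme \<Rightarrow> nat \<Rightarrow> ('g \<Rightarrow> complex mat) \<Rightarrow> bool" where
  "real_type G n \<rho> \<longleftrightarrow>
     (\<exists>J. conj_linear_equivariant G n \<rho> J \<and> (\<forall>v\<in>carrier_vec n. J (J v) = v))"

definition quaternionic_type ::
  "('g, 'm) monoid_scheme \<Rightarrow> nat \<Rightarrow> ('g \<Rightarrow> complex mat) \<Rightarrow> bool" where
  "quaternionic_type G n \<rho> \<longleftrightarrow>
     (\<exists>J. conj_linear_equivariant G n \<rho> J \<and> (\<forall>v\<in>carrier_vec n. J (J v) = - v))"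

definition complex_type ::
  "('g, 'm) monoid_scheme \<Rightarrow> nat \<Rightarrow> ('g \<Rightarrow> complex mat) \<Rightarrow> bool" where
  "complex_type G n \<rho> \<longleftrightarrow> \<not> real_type G n \<rho> \<and> \<not> quaternionic_type G n \<rho>"

section \<open>The operators on irreducible representations and their resultants\<close>

definition D_op ::
  "('g, 'm) monoid_scheme \<Rightarrow> 'g set \<Rightarrow> nat \<Rightarrow> ('g \<Rightarrow> complex mat) \<Rightarrow> ('g set \<Rightarrow> real)
    \<Rightarrow> complex mat" where
  "D_op G S n \<rho> \<alpha> =
     (\<Oplus>\<^bsub>module_mat TYPE(complex) n n\<^esub>s\<in>S.
        complex_of_real (coeff_at G \<alpha> s) \<cdot>\<^sub>m ((\<rho> s - \<rho> \<one>\<^bsub>G\<^esub>) ^\<^sub>m 2))"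

definition P_poly ::
  "('g, 'm) monoid_scheme \<Rightarrow> 'g set \<Rightarrow> nat \<Rightarrow> ('g \<Rightarrow> complex mat) \<Rightarrow> ('g set \<Rightarrow> real)
    \<Rightarrow> complex poly" where
  "P_poly G S n \<rho> \<alpha> = char_poly (D_op G S n \<rho> \<alpha>)"

definition a_fun ::
  "('g, 'm) monoid_scheme \<Rightarrow> 'g set \<Rightarrow> nat \<Rightarrow> ('g \<Rightarrow> complex mat) \<Rightarrow> nat \<Rightarrow> ('g \<Rightarrow> complex mat)
    \<Rightarrow> ('g set \<Rightarrow> real) \<Rightarrow> complex" where
  "a_fun G S n\<^sub>1 \<rho>\<^sub>1 n\<^sub>2 \<rho>\<^sub>2 \<alpha> = resultant (P_poly G S n\<^sub>1 \<rho>\<^sub>1 \<alpha>) (P_poly G S n\<^sub>2 \<rho>\<^sub>2 \<alpha>)"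

definition b_fun ::
  "('g, 'm) monoid_scheme \<Rightarrow> 'g set \<Rightarrow> nat \<Rightarrow> ('g \<Rightarrow> complex mat) \<Rightarrow> ('g set \<Rightarrow> real)
    \<Rightarrow> complex" where
  "b_fun G S n \<rho> \<alpha> = resultant (P_poly G S n \<rho> \<alpha>) (pderiv (P_poly G S n \<rho> \<alpha>))"

definition c_fun ::
  "('g, 'm) monoid_scheme \<Rightarrow> 'g set \<Rightarrow> nat \<Rightarrow> ('g \<Rightarrow> complex mat) \<Rightarrow> ('g set \<Rightarrow> real)
    \<Rightarrow> complex" where
  "c_fun G S n \<rho> \<alpha> = resultant (P_poly G S n \<rho> \<alpha>) (pderiv (pderiv (P_poly G S n \<rho> \<alpha>)))"

end

theory Submission
  imports Defs
    "HOL-Computational_Algebra.Field_as_Ring"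
    "Jordan_Normal_Form.Jordan_Normal_Form_Uniqueness"
    "Jordan_Normal_Form.Jordan_Normal_Form_Existence"
    "Jordan_Normal_Form.Spectral_Radius"
begin

text \<open>The operator acts on matrix coefficients through representations: if
  \<open>f(x) = a \<bullet> \<rho>(x) v\<close>, then \<open>L f\<close> is the coefficient of \<open>D v\<close> with the same \<open>a\<close>, where \<open>D\<close> is
  the operator on the space of \<open>\<rho>\<close> (\<open>complex_L_mcoeff\<close>). So an eigenvector \<open>v\<close> of \<open>D\<close> with
  eigenvalue \<open>\<mu>\<close> embeds the dual of \<open>\<rho>\<close> into the complexified eigenspace of \<open>L\<close> for \<open>\<mu>\<close>. As \<open>S\<close>
  is symmetric, \<open>L\<close> is self-adjoint. Hence every \<open>D\<close> is diagonalizable with real eigenvalues, and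
  the multiplicity of a root of its characteristic polynomial is the dimension of the eigenspace.

  Let the real eigenspace \<open>E\<close> for \<open>\<mu>\<close> be irreducible, and let \<open>D v = \<mu> v\<close> in an irreducible \<open>\<rho>\<close>. The
  real parts of the functions \<open>a \<bullet> \<rho>(x) v\<close> form a nonzero subrepresentation of \<open>E\<close>, hence all of
  \<open>E\<close>. So the complexification of \<open>E\<close> consists of the functions \<open>a \<bullet> \<rho>(x) v + cnj (b \<bullet> \<rho>(x) v)\<close>
  (\<open>irreducible_eigenspace_functions\<close>). By Schur orthogonality an irreducible representation that
  also has the eigenvalue \<open>\<mu>\<close> is isomorphic to \<open>\<rho>\<close> or to its conjugate, which is isomorphic to the
  dual. By the same relations every further eigenvector of \<open>D\<close> for \<open>\<mu>\<close> is a multiple of \<open>v\<close> if \<open>\<rho>\<close>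
  is of complex type, and lies in the span of \<open>v\<close> and \<open>J v\<close> if \<open>\<rho>\<close> has a structure map \<open>J\<close>. In the
  real type one can choose \<open>v\<close> with \<open>J v = v\<close>; in the quaternionic type \<open>v\<close> and \<open>J v\<close> are
  independent. So the roots are simple in the real and complex types and double in the quaternionic
  type. In terms of resultants, this says that all the functions \<open>a_fun\<close>, \<open>b_fun\<close> and \<open>c_fun\<close> in
  question are nonzero at the given weight (\<open>real_G_simple_imp_generic\<close>).

  Conversely, let \<open>U\<close> be a proper nonzero subrepresentation of \<open>E\<close>. Its complexification and the
  orthogonal complement of that in the complexification of \<open>E\<close> both contain the coefficients of
  irreducible representations (\<open>invariant_fspace_contains_irrep\<close>). If the resultants of pairs do not
  vanish, these two representations agree up to conjugation, and they may be taken equal because the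
  complexification of \<open>U\<close> is closed under conjugation. This gives two independent eigenvectors of one
  \<open>D\<close>, and three of them in the quaternionic type, so that a resultant vanishes
  (\<open>generic_imp_real_G_simple\<close>).

  Thus a weight is simple if and only if certain functions do not vanish at it. They are polynomial
  in the weight, and finite in number because there are finitely many irreducible representations up
  to isomorphism. A polynomial function that is not identically 0 is nonzero on a dense open subset
  of the open cone of weights, because it restricts to a polynomial in one variable on every line.
  This yields a simple weight as well as the residuality of the set of simple weights.\<close>

unbundle no vec_syntax
unbundle no inner_syntax


section \<open>Resultants and common roots\<close>

text \<open>The rows of the Sylvester matrix are the coefficient vectors of the polynomials
  \<open>x ^ i * p\<close> and \<open>x ^ j * q\<close> with \<open>i < degree q\<close> and
  \<open>j < degree p\<close>, highest degree first.\<close>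

lemma sylvester_row_coeff:
  fixes p q :: "complex poly"
  assumes "i < degree p + degree q" "j < degree p + degree q"
  shows "sylvester_mat p q $$ (i, j) =
    coeff (if i < degree q then monom 1 (degree q - 1 - i) * p
           else monom 1 (degree p + degree q - 1 - i) * q) (degree p + degree q - 1 - j)"
proof (cases "i < degree q")
  case True
  have *: "degree p + degree q - 1 - j - (degree q - 1 - i) = degree p + i - j"
    if "degree q - 1 - i \<le> degree p + degree q - 1 - j"
    using that assms True by linarith
  show ?thesis
    using assms True
    by (auto simp: sylvester_index_mat coeff_monom_mult * coeff_eq_0)
next
  case False
  have *: "degree p + degree q - 1 - j - (degree p + degree q - 1 - i) = i - j"
    if "degree p + degree q - 1 - i \<le> degree p + degree q - 1 - j"
    using that assms False by linarith
  have **: "degree q < i - j" if "\<not> i - degree q \<le> j" using that by linarith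
  show ?thesis
    using assms False
    by (auto simp: sylvester_index_mat coeff_monom_mult * coeff_eq_0 **)
qed

lemma resultant_eq_0_if_common_root:
  fixes p q :: "complex poly"
  assumes "p \<noteq> 0" and p: "poly p x = 0" and q: "poly q x = 0"
  shows "resultant p q = 0"
proof -
  let ?m = "degree p" and ?n = "degree q"
  have "degree p \<noteq> 0"
    using assms(1) p by (metis degree_eq_zeroE poly_const_conv pCons_0_0)
  \<comment> \<open>The powers of a common root form a kernel vector of the Sylvester matrix.\<close>
  define y where "y = Matrix.vec (?m + ?n) (\<lambda>j. x ^ (?m + ?n - 1 - j))"
  have "y $ (?m + ?n - 1) = 1" using \<open>degree p \<noteq> 0\<close> by (simp add: y_def)
  then have y0: "y \<noteq> 0\<^sub>v (?m + ?n)" using \<open>degree p \<noteq> 0\<close> by auto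
  have "(sylvester_mat p q *\<^sub>v y) $ i = 0" if i: "i < ?m + ?n" for i
  proof -
    define r where "r = (if i < ?n then monom 1 (?n - 1 - i) * p else monom 1 (?m + ?n - 1 - i) * q)"
    have dr: "degree r < ?m + ?n"
      using i degree_mult_le[of "monom 1 (?n - 1 - i)" p] degree_mult_le[of "monom 1 (?m + ?n - 1 - i)" q]
        degree_monom_le[of "1::complex" "?n - 1 - i"] degree_monom_le[of "1::complex" "?m + ?n - 1 - i"]
      unfolding r_def by (auto split: if_splits)
    have "(sylvester_mat p q *\<^sub>v y) $ i = (\<Sum>j<?m + ?n. sylvester_mat p q $$ (i, j) * x ^ (?m + ?n - 1 - j))"
      using i by (simp add: y_def scalar_prod_def lessThan_atLeast0)
    also have "\<dots> = (\<Sum>j<?m + ?n. coeff r (?m + ?n - 1 - j) * x ^ (?m + ?n - 1 - j))"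
      unfolding r_def by (intro sum.cong refl) (simp only: lessThan_iff sylvester_row_coeff[OF i])
    also have "\<dots> = (\<Sum>k<?m + ?n. coeff r k * x ^ k)"
      using sum.nat_diff_reindex[of "\<lambda>k. coeff r k * x ^ k" "?m + ?n"] by simp
    also have "\<dots> = (\<Sum>k\<le>degree r. coeff r k * x ^ k)"
      by (rule sum.mono_neutral_right) (use dr in \<open>auto simp: coeff_eq_0\<close>)
    also have "\<dots> = poly r x" by (simp add: poly_altdef)
    also have "\<dots> = 0" using p q by (auto simp: r_def)
    finally show ?thesis .
  qed
  then have "sylvester_mat p q *\<^sub>v y = 0\<^sub>v (?m + ?n)" by (intro eq_vecI) auto
  moreover have "y \<in> carrier_vec (?m + ?n)" by (simp add: y_def)
  ultimately show ?thesis
    unfolding resultant_def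
    using det_0_iff_vec_prod_zero_field[OF sylvester_carrier_mat[of p q]] y0 by blast
qed

lemma coprime_if_no_common_root:
  fixes p q :: "complex poly"
  assumes "p \<noteq> 0" "\<And>x. poly p x = 0 \<Longrightarrow> poly q x \<noteq> 0"
  shows "coprime p q"
proof (rule coprimeI)
  fix d assume "d dvd p" "d dvd q"
  show "is_unit d"
  proof (rule ccontr)
    assume "\<not> is_unit d"
    moreover have "d \<noteq> 0" using \<open>d dvd p\<close> assms(1) by auto
    ultimately have "degree d \<noteq> 0" by (simp add: is_unit_iff_degree)
    then obtain x where "poly d x = 0"
      using fundamental_theorem_of_algebra[of d] by (auto simp: constant_degree)
    then have "[:- x, 1:] dvd d" by (simp add: poly_eq_0_iff_dvd)
    then show False
      using assms(2)[of x] dvd_trans[OF _ \<open>d dvd p\<close>] dvd_trans[OF _ \<open>d dvd q\<close>]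
      by (simp add: poly_eq_0_iff_dvd)
  qed
qed

text \<open>Without a common root \<open>p\<close> and \<open>q\<close> are coprime, and a
  relation \<open>u * p + w * q = 0\<close> makes \<open>p\<close> divide \<open>w\<close>, which
  has smaller degree.\<close>

lemma common_root_if_resultant_eq_0:
  fixes p q :: "complex poly"
  assumes p0: "p \<noteq> 0" and q0: "q \<noteq> 0" and res: "resultant p q = 0"
  shows "\<exists>x. poly p x = 0 \<and> poly q x = 0"
proof (rule ccontr)
  let ?m = "degree p" and ?n = "degree q"
  let ?N = "?m + ?n"
  assume "\<nexists>x. poly p x = 0 \<and> poly q x = 0"
  then have cop: "coprime p q" using p0 by (intro coprime_if_no_common_root) auto
  have "Determinant.det (transpose_mat (sylvester_mat p q)) = 0"
    using res det_transpose[OF sylvester_carrier_mat[of p q]] by (simp add: resultant_def)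
  then obtain v where v: "v \<in> carrier_vec ?N" "v \<noteq> 0\<^sub>v ?N"
    and Sv: "transpose_mat (sylvester_mat p q) *\<^sub>v v = 0\<^sub>v ?N"
    using det_0_iff_vec_prod_zero_field[of "transpose_mat (sylvester_mat p q)" ?N]
      sylvester_carrier_mat[of p q] by auto
  \<comment> \<open>A vanishing combination of the rows of the Sylvester matrix is a relation between \<open>p\<close> and \<open>q\<close>
    with cofactors of degree below \<open>degree q\<close> and \<open>degree p\<close>.\<close>
  define u where "u = (\<Sum>i<?n. monom (v $ i) (?n - 1 - i))"
  define w where "w = (\<Sum>i\<in>{?n..<?N}. monom (v $ i) (?N - 1 - i))"
  have "coeff (u * p + w * q) k = 0" for k
  proof (cases "k < ?N")
    case True
    define j where "j = ?N - 1 - k"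
    have j: "j < ?N" "?N - 1 - j = k" using True by (auto simp: j_def)
    have row: "sylvester_mat p q $$ (i, j) =
      coeff (if i < ?n then monom 1 (?n - 1 - i) * p else monom 1 (?N - 1 - i) * q) k" if "i < ?N" for i
      using sylvester_row_coeff[OF that j(1)] unfolding j(2) .
    have "coeff (u * p + w * q) k =
      (\<Sum>i<?n. v $ i * coeff (monom 1 (?n - 1 - i) * p) k) + (\<Sum>i\<in>{?n..<?N}. v $ i * coeff (monom 1 (?N - 1 - i) * q) k)"
      unfolding u_def w_def sum_distrib_right coeff_add coeff_sum
      by (simp add: coeff_monom_mult if_distrib cong: if_cong)
    also have "\<dots> = (\<Sum>i<?n. v $ i * sylvester_mat p q $$ (i,j)) + (\<Sum>i\<in>{?n..<?N}. v $ i * sylvester_mat p q $$ (i,j))"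
      by (intro arg_cong2[where f="(+)"] sum.cong refl) (simp_all add: row del: One_nat_def)
    also have "\<dots> = (\<Sum>i<?N. v $ i * sylvester_mat p q $$ (i,j))"
      by (simp add: lessThan_atLeast0 sum.atLeastLessThan_concat)
    also have "\<dots> = (transpose_mat (sylvester_mat p q) *\<^sub>v v) $ j"
      using j v by (simp add: scalar_prod_def lessThan_atLeast0 mult.commute)
    also have "\<dots> = 0" using Sv j by simp
    finally show ?thesis .
  next
    case False
    have d1: "degree (monom (v $ i) (?n - 1 - i) * p) < ?N" if "i < ?n" for i
      using that degree_mult_le[of "monom (v $ i) (?n - 1 - i)" p] degree_monom_le[of "v $ i" "?n - 1 - i"] by simp
    have d2: "degree (monom (v $ i) (?N - 1 - i) * q) < ?N" if "i \<in> {?n..<?N}" for i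
      using that degree_mult_le[of "monom (v $ i) (?N - 1 - i)" q] degree_monom_le[of "v $ i" "?N - 1 - i"] by auto
    have "coeff (monom (v $ i) (?n - 1 - i) * p) k = 0" if "i < ?n" for i
      using d1[OF that] False by (intro coeff_eq_0) linarith
    moreover have "coeff (monom (v $ i) (?N - 1 - i) * q) k = 0" if "i \<in> {?n..<?N}" for i
      using d2[OF that] False by (intro coeff_eq_0) linarith
    ultimately show ?thesis
      unfolding u_def w_def sum_distrib_right coeff_add coeff_sum
      by (simp del: One_nat_def)
  qed
  then have eq: "u * p + w * q = 0" by (intro poly_eqI) simp
  have cu: "coeff u (?n - 1 - i) = v $ i" if "i < ?n" for i
  proof -
    have "coeff u (?n - 1 - i) = (\<Sum>k<?n. if k = i then v $ k else 0)"
      unfolding u_def coeff_sum using that by (intro sum.cong) auto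
    then show ?thesis using that by simp
  qed
  have cw: "coeff w (?N - 1 - i) = v $ i" if "?n \<le> i" "i < ?N" for i
  proof -
    have "coeff w (?N - 1 - i) = (\<Sum>k\<in>{?n..<?N}. if k = i then v $ k else 0)"
      unfolding w_def coeff_sum using that by (intro sum.cong) auto
    then show ?thesis using that by simp
  qed
  have "w = 0"
  proof (rule ccontr)
    assume "w \<noteq> 0"
    then have "\<not> ?m = 0" by (auto simp: w_def)
    have "degree w \<le> ?m - 1"
      unfolding w_def by (intro degree_sum_le) (auto intro!: order.trans[OF degree_monom_le])
    moreover have "w * q = p * (- u)"
      using eq by (simp add: eq_neg_iff_add_eq_0 add.commute mult.commute)
    then have "p dvd w * q" by (rule dvdI)
    then have "p dvd w" using coprime_dvd_mult_left_iff[OF cop, of w] by simp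
    then have "?m \<le> degree w" using \<open>w \<noteq> 0\<close> by (rule dvd_imp_degree_le)
    ultimately show False using \<open>\<not> ?m = 0\<close> by linarith
  qed
  then have "u = 0" using eq p0 by simp
  have "v = 0\<^sub>v ?N"
  proof (rule eq_vecI)
    fix i assume "i < dim_vec (0\<^sub>v ?N :: complex Matrix.vec)"
    then have "i < ?N" by simp
    then show "v $ i = 0\<^sub>v ?N $ i"
      using cu[of i] cw[of i] \<open>u = 0\<close> \<open>w = 0\<close> by (cases "i < ?n") auto
  qed (use v in auto)
  then show False using v by simp
qed

lemma resultant_eq_0_iff_common_root:
  fixes p q :: "complex poly"
  assumes "p \<noteq> 0" "q \<noteq> 0"
  shows "resultant p q = 0 \<longleftrightarrow> (\<exists>x. poly p x = 0 \<and> poly q x = 0)"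
  using common_root_if_resultant_eq_0[OF assms] resultant_eq_0_if_common_root[OF assms(1)] by blast

lemma double_root_iff_order:
  fixes p :: "complex poly"
  assumes "degree p > 0"
  shows "poly p x = 0 \<and> poly (pderiv p) x = 0 \<longleftrightarrow> 2 \<le> Polynomial.order x p"
proof -
  have p: "p \<noteq> 0" and p': "pderiv p \<noteq> 0" using assms by (auto simp: pderiv_eq_0_iff)
  show ?thesis
  proof (cases "poly p x = 0")
    case True
    then have "Polynomial.order x p \<noteq> 0" using p by (simp add: order_root)
    then have "Polynomial.order x p = Suc (Polynomial.order x (pderiv p))" using p True by (intro order_pderiv)
    then show ?thesis using True p' by (auto simp: order_root)
  next
    case False
    then show ?thesis by (simp add: order_0I)
  qed
qed

lemma triple_root_iff_order:
  fixes p :: "complex poly"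
  assumes "2 \<le> Polynomial.order x p" "p \<noteq> 0"
  shows "poly (pderiv (pderiv p)) x = 0 \<longleftrightarrow> 3 \<le> Polynomial.order x p" "pderiv (pderiv p) \<noteq> 0"
proof -
  have deg: "2 \<le> degree p" using order_degree[OF assms(2), of x] assms(1) by linarith
  have p': "pderiv p \<noteq> 0" using deg by (auto simp: pderiv_eq_0_iff)
  show p'': "pderiv (pderiv p) \<noteq> 0" using deg by (auto simp: pderiv_eq_0_iff degree_pderiv)
  have 1: "Polynomial.order x p = Suc (Polynomial.order x (pderiv p))" using assms by (intro order_pderiv) (auto simp: order_root)
  then have "Polynomial.order x (pderiv p) \<noteq> 0" using assms(1) by simp
  then have "Polynomial.order x (pderiv p) = Suc (Polynomial.order x (pderiv (pderiv p)))" using p' by (intro order_pderiv) (auto simp: order_root)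
  then show "poly (pderiv (pderiv p)) x = 0 \<longleftrightarrow> 3 \<le> Polynomial.order x p"
    using 1 p'' by (auto simp: order_root)
qed

section \<open>Polynomial functions and their zero sets\<close>

text \<open>Polynomial functions of the coordinates in \<open>I\<close>. Only two of their
  properties matter below: continuity, and that they restrict to polynomials in one variable on
  every line.\<close>

inductive polyfun :: "'i set \<Rightarrow> (('i \<Rightarrow> real) \<Rightarrow> complex) \<Rightarrow> bool" for I where
  const: "polyfun I (\<lambda>_. c)"
| coord: "i \<in> I \<Longrightarrow> polyfun I (\<lambda>\<alpha>. complex_of_real (\<alpha> i))"
| add: "polyfun I f \<Longrightarrow> polyfun I g \<Longrightarrow> polyfun I (\<lambda>\<alpha>. f \<alpha> + g \<alpha>)"
| mult: "polyfun I f \<Longrightarrow> polyfun I g \<Longrightarrow> polyfun I (\<lambda>\<alpha>. f \<alpha> * g \<alpha>)"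

lemma polyfun_sum: "(\<And>a. a \<in> A \<Longrightarrow> polyfun I (f a)) \<Longrightarrow> polyfun I (\<lambda>\<alpha>. \<Sum>a\<in>A. f a \<alpha>)"
  by (induction A rule: infinite_finite_induct) (auto intro: polyfun.intros)

lemma polyfun_prod: "(\<And>a. a \<in> A \<Longrightarrow> polyfun I (f a)) \<Longrightarrow> polyfun I (\<lambda>\<alpha>. \<Prod>a\<in>A. f a \<alpha>)"
  by (induction A rule: infinite_finite_induct) (auto intro: polyfun.intros)

lemma polyfun_uminus: "polyfun I f \<Longrightarrow> polyfun I (\<lambda>\<alpha>. - f \<alpha>)"
  using polyfun.mult[OF polyfun.const[of I "-1"]] by simp

lemma polyfun_if: "polyfun I f \<Longrightarrow> polyfun I g \<Longrightarrow> polyfun I (\<lambda>\<alpha>. if c then f \<alpha> else g \<alpha>)"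
  by (cases c) simp_all

lemma polyfun_det:
  assumes "\<And>\<alpha>. M \<alpha> \<in> carrier_mat n n"
    and "\<And>i j. i < n \<Longrightarrow> j < n \<Longrightarrow> polyfun I (\<lambda>\<alpha>. M \<alpha> $$ (i, j))"
  shows "polyfun I (\<lambda>\<alpha>. Determinant.det (M \<alpha>))"
proof -
  have formula: "(\<lambda>\<alpha>. Determinant.det (M \<alpha>)) =
      (\<lambda>\<alpha>. \<Sum>p | p permutes {0..<n}. of_int (sign p) * (\<Prod>i = 0..<n. M \<alpha> $$ (i, p i)))"
  proof
    fix \<alpha>
    show "Determinant.det (M \<alpha>) = (\<Sum>p | p permutes {0..<n}. of_int (sign p) * (\<Prod>i = 0..<n. M \<alpha> $$ (i, p i)))"
      using assms(1)[of \<alpha>] by (simp add: Determinant.det_def)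
  qed
  show ?thesis
    unfolding formula
  proof (intro polyfun_sum polyfun.mult polyfun.const polyfun_prod)
    fix p i assume "p \<in> {p. p permutes {0..<n}}" "i \<in> {0..<n}"
    then show "polyfun I (\<lambda>\<alpha>. M \<alpha> $$ (i, p i))"
      using permutes_in_image[of p "{0..<n}" i] by (intro assms(2)) auto
  qed
qed

text \<open>Families of polynomials whose coefficients are polynomial functions of the
  parameter.\<close>

definition polyfun_coeffs :: "'i set \<Rightarrow> (('i \<Rightarrow> real) \<Rightarrow> complex poly) \<Rightarrow> bool" where
  "polyfun_coeffs I P \<longleftrightarrow> (\<forall>k. polyfun I (\<lambda>\<alpha>. coeff (P \<alpha>) k))"

lemma polyfun_coeffs_const: "polyfun_coeffs I (\<lambda>_. p)"
  by (simp add: polyfun_coeffs_def polyfun.const)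

lemma polyfun_coeffs_pCons_0: "polyfun I f \<Longrightarrow> polyfun_coeffs I (\<lambda>\<alpha>. [:f \<alpha>:])"
  unfolding polyfun_coeffs_def
proof
  fix k assume "polyfun I f"
  then show "polyfun I (\<lambda>\<alpha>. coeff [:f \<alpha>:] k)" by (cases k) (simp_all add: polyfun.const)
qed

lemma polyfun_coeffs_add:
  "polyfun_coeffs I P \<Longrightarrow> polyfun_coeffs I Q \<Longrightarrow> polyfun_coeffs I (\<lambda>\<alpha>. P \<alpha> + Q \<alpha>)"
  by (simp add: polyfun_coeffs_def polyfun.add)

lemma polyfun_coeffs_mult:
  "polyfun_coeffs I P \<Longrightarrow> polyfun_coeffs I Q \<Longrightarrow> polyfun_coeffs I (\<lambda>\<alpha>. P \<alpha> * Q \<alpha>)"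
  by (simp add: polyfun_coeffs_def coeff_mult polyfun_sum polyfun.mult)

lemma polyfun_coeffs_sum:
  "(\<And>a. a \<in> A \<Longrightarrow> polyfun_coeffs I (P a)) \<Longrightarrow> polyfun_coeffs I (\<lambda>\<alpha>. \<Sum>a\<in>A. P a \<alpha>)"
  by (induction A rule: infinite_finite_induct) (auto intro: polyfun_coeffs_const polyfun_coeffs_add)

lemma polyfun_coeffs_prod:
  "(\<And>a. a \<in> A \<Longrightarrow> polyfun_coeffs I (P a)) \<Longrightarrow> polyfun_coeffs I (\<lambda>\<alpha>. \<Prod>a\<in>A. P a \<alpha>)"
  by (induction A rule: infinite_finite_induct) (auto intro: polyfun_coeffs_const polyfun_coeffs_mult)

lemma polyfun_coeffs_pderiv: "polyfun_coeffs I P \<Longrightarrow> polyfun_coeffs I (\<lambda>\<alpha>. pderiv (P \<alpha>))"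
  by (auto simp: polyfun_coeffs_def coeff_pderiv intro!: polyfun.mult polyfun.add polyfun.const)

lemma polyfun_coeffs_char_poly:
  assumes M: "\<And>\<alpha>. M \<alpha> \<in> carrier_mat n n"
    and "\<And>i j. i < n \<Longrightarrow> j < n \<Longrightarrow> polyfun I (\<lambda>\<alpha>. M \<alpha> $$ (i, j))"
  shows "polyfun_coeffs I (\<lambda>\<alpha>. char_poly (M \<alpha>))"
proof -
  have "char_poly (M \<alpha>) = (\<Sum>p | p permutes {0..<n}. [:of_int (sign p):] *
      (\<Prod>i = 0..<n. (if i = p i then [:0, 1:] else 0) + [:- M \<alpha> $$ (i, p i):]))" for \<alpha>
  proof -
    have "char_poly (M \<alpha>) = (\<Sum>p | p permutes {0..<n}. of_int (sign p) *
      (\<Prod>i = 0..<n. char_poly_matrix (M \<alpha>) $$ (i, p i)))"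
      using M[of \<alpha>] by (simp add: char_poly_def Determinant.det_def char_poly_matrix_def)
    also have "\<dots> = (\<Sum>p | p permutes {0..<n}. [:of_int (sign p):] *
      (\<Prod>i = 0..<n. (if i = p i then [:0, 1:] else 0) + [:- M \<alpha> $$ (i, p i):]))"
    proof (intro sum.cong refl arg_cong2[where f = "(*)"] prod.cong)
      fix p i assume "p \<in> {p. p permutes {0..<n}}" "i \<in> {0..<n}"
      then have "p i < n" "i < n" using permutes_in_image[of p "{0..<n}" i] by auto
      then show "char_poly_matrix (M \<alpha>) $$ (i, p i) =
          (if i = p i then [:0, 1:] else 0) + [:- M \<alpha> $$ (i, p i):]"
        using M[of \<alpha>] by (simp add: char_poly_matrix_def)
    qed (simp add: of_int_poly)
    finally show ?thesis .
  qed
  then have formula: "(\<lambda>\<alpha>. char_poly (M \<alpha>)) = (\<lambda>\<alpha>. \<Sum>p | p permutes {0..<n}. [:of_int (sign p):] *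
      (\<Prod>i = 0..<n. (if i = p i then [:0, 1:] else 0) + [:- M \<alpha> $$ (i, p i):]))"
    by (rule ext)
  show ?thesis
    unfolding formula
  proof (intro polyfun_coeffs_sum polyfun_coeffs_mult polyfun_coeffs_const
      polyfun_coeffs_prod polyfun_coeffs_add polyfun_coeffs_pCons_0 polyfun_uminus)
    fix p i assume "p \<in> {p. p permutes {0..<n}}" "i \<in> {0..<n}"
    then show "polyfun I (\<lambda>\<alpha>. M \<alpha> $$ (i, p i))"
      using permutes_in_image[of p "{0..<n}" i] by (intro assms(2)) auto
  qed
qed

text \<open>The size of the Sylvester matrix depends on the degrees, so these have to be
  constant.\<close>

lemma polyfun_resultant:
  assumes P: "polyfun_coeffs I P" and Q: "polyfun_coeffs I Q"
    and deg: "\<And>\<alpha>. degree (P \<alpha>) = m" "\<And>\<alpha>. degree (Q \<alpha>) = n"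
  shows "polyfun I (\<lambda>\<alpha>. resultant (P \<alpha>) (Q \<alpha>))"
  unfolding resultant_def
proof (rule polyfun_det)
  show "sylvester_mat (P \<alpha>) (Q \<alpha>) \<in> carrier_mat (m + n) (m + n)" for \<alpha>
    using sylvester_carrier_mat[of "P \<alpha>" "Q \<alpha>"] by (simp add: deg)
  fix i j assume "i < m + n" "j < m + n"
  then have entry: "(\<lambda>\<alpha>. sylvester_mat (P \<alpha>) (Q \<alpha>) $$ (i, j)) = (\<lambda>\<alpha>.
      if i < n then if i \<le> j \<and> j - i \<le> m then coeff (P \<alpha>) (m + i - j) else 0
      else if i - n \<le> j \<and> j \<le> i then coeff (Q \<alpha>) (i - j) else 0)"
    by (intro ext) (simp add: sylvester_index_mat deg)
  show "polyfun I (\<lambda>\<alpha>. sylvester_mat (P \<alpha>) (Q \<alpha>) $$ (i, j))"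
    unfolding entry using P Q by (intro polyfun_if polyfun.const) (auto simp: polyfun_coeffs_def)
qed

lemma polyfun_on_line:
  assumes "polyfun I f"
  shows "\<exists>p. \<forall>t. f (\<lambda>i\<in>I. (1 - t) * \<alpha> i + t * \<beta> i) = poly p (complex_of_real t)"
  using assms
proof induction
  case (const c)
  then show ?case by (intro exI[of _ "[:c:]"]) simp
next
  case (coord i)
  then show ?case
    by (intro exI[of _ "[:complex_of_real (\<alpha> i), complex_of_real (\<beta> i - \<alpha> i):]"]) (simp add: algebra_simps)
next
  case (add f g)
  then obtain p q where
    "\<forall>t. f (\<lambda>i\<in>I. (1 - t) * \<alpha> i + t * \<beta> i) = poly p (complex_of_real t)"
    "\<forall>t. g (\<lambda>i\<in>I. (1 - t) * \<alpha> i + t * \<beta> i) = poly q (complex_of_real t)" by blast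
  then show ?case by (intro exI[of _ "p + q"]) (simp only: poly_add simp_thms)
next
  case (mult f g)
  then obtain p q where
    "\<forall>t. f (\<lambda>i\<in>I. (1 - t) * \<alpha> i + t * \<beta> i) = poly p (complex_of_real t)"
    "\<forall>t. g (\<lambda>i\<in>I. (1 - t) * \<alpha> i + t * \<beta> i) = poly q (complex_of_real t)" by blast
  then show ?case by (intro exI[of _ "p * q"]) (simp only: poly_mult simp_thms)
qed

lemma continuous_map_complex_mult:
  fixes f g :: "'a \<Rightarrow> complex"
  assumes "continuous_map X euclidean f" "continuous_map X euclidean g"
  shows "continuous_map X euclidean (\<lambda>x. f x * g x)"
proof -
  have "continuous_map X (prod_topology euclidean euclidean) (\<lambda>x. (f x, g x))"
    using assms by (intro continuous_map_paired[THEN iffD2] conjI)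
  then have "continuous_map X euclidean ((\<lambda>z. fst z * snd z) \<circ> (\<lambda>x. (f x, g x)))"
    by (rule continuous_map_compose)
      (simp add: euclidean_product_topology continuous_on_mult continuous_on_fst continuous_on_snd)
  then show ?thesis by (simp add: o_def)
qed

lemma continuous_map_polyfun:
  assumes "polyfun I f"
  shows "continuous_map (powertop_real I) euclidean f"
  using assms
proof induction
  case (coord i)
  then have "continuous_map (powertop_real I) euclideanreal (\<lambda>\<alpha>. \<alpha> i)"
    by (rule continuous_map_product_projection)
  then have "continuous_map (powertop_real I) euclidean (complex_of_real \<circ> (\<lambda>\<alpha>. \<alpha> i))"
    by (rule continuous_map_compose) (simp add: continuous_on_of_real_id)
  then show ?case by (simp add: o_def)
next
  case (add f g) then show ?case by (intro continuous_map_add)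
next
  case (mult f g) then show ?case by (intro continuous_map_complex_mult)
qed simp

text \<open>On a line through \<open>\<alpha>\<close> the function is a polynomial in one variable
  which is not 0, so it cannot vanish on a whole neighbourhood of another point of that
  line.\<close>

lemma polyfun_nonzero_in_open:
  assumes f: "polyfun I f" and \<alpha>: "\<alpha> \<in> extensional I" "f \<alpha> \<noteq> 0"
    and V: "openin (powertop_real I) V" "V \<noteq> {}"
  shows "\<exists>w\<in>V. f w \<noteq> 0"
proof (rule ccontr)
  assume zero: "\<not> ?thesis"
  obtain w where w: "w \<in> V" using V by blast
  then have wext: "w \<in> extensional I" using openin_subset[OF V(1)] by (auto simp: PiE_def)
  \<comment> \<open>The line from a point of \<open>V\<close> to a point at which \<open>f\<close> does not vanish.\<close>
  define g where "g = (\<lambda>t. \<lambda>i\<in>I. (1 - t) * w i + t * \<alpha> i)"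
  obtain p where p: "\<And>t. f (g t) = poly p (complex_of_real t)"
    using polyfun_on_line[OF f, of w \<alpha>] unfolding g_def by blast
  have "continuous_map euclideanreal (powertop_real I) g"
    unfolding g_def
    by (auto simp: continuous_map_componentwise intro!: continuous_intros)
  then have "open {t. g t \<in> V}"
    using openin_continuous_map_preimage[OF _ V(1)] by fastforce
  moreover have "g 0 = w" using wext by (auto simp: g_def extensional_def)
  ultimately obtain e where e: "e > 0" "\<And>t. \<bar>t\<bar> < e \<Longrightarrow> g t \<in> V"
    using w unfolding open_dist by (auto simp: dist_real_def)
  have "complex_of_real ` {0<..<e} \<subseteq> {z. poly p z = 0}"
    using zero e p by (auto simp flip: p)
  moreover have "infinite (complex_of_real ` {0<..<e})"
    using e(1) by (subst finite_image_iff) (auto simp: inj_on_def)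
  ultimately have "p = 0" using poly_roots_finite finite_subset by blast
  then have "f (g 1) = 0" by (simp add: p)
  moreover have "g 1 = \<alpha>" using \<alpha>(1) by (auto simp: g_def extensional_def)
  ultimately show False using \<alpha>(2) by simp
qed

lemma openin_polyfun_nonzero:
  assumes "polyfun I f" "openin (powertop_real I) V"
  shows "openin (powertop_real I) {w \<in> V. f w \<noteq> 0}"
proof -
  have "openin (powertop_real I) {w \<in> topspace (powertop_real I). f w \<in> - {0}}"
    by (rule openin_continuous_map_preimage[OF continuous_map_polyfun[OF assms(1)]])
      (simp add: open_Compl)
  then have "openin (powertop_real I) (V \<inter> {w \<in> topspace (powertop_real I). f w \<in> - {0}})"
    using assms(2) by (rule openin_Int[rotated])
  moreover have "V \<inter> {w \<in> topspace (powertop_real I). f w \<in> - {0}} = {w \<in> V. f w \<noteq> 0}"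
    using openin_subset[OF assms(2)] by auto
  ultimately show ?thesis by simp
qed

lemma polyfuns_nonzero_in_open:
  assumes "finite F" and "\<And>f. f \<in> F \<Longrightarrow> polyfun I f"
    and "\<And>f. f \<in> F \<Longrightarrow> \<exists>\<alpha>\<in>extensional I. f \<alpha> \<noteq> 0"
    and "openin (powertop_real I) V" "V \<noteq> {}"
  shows "\<exists>w\<in>V. \<forall>f\<in>F. f w \<noteq> 0"
  using assms
proof (induction arbitrary: V rule: finite_induct)
  case (insert f F)
  let ?V = "{w \<in> V. f w \<noteq> 0}"
  have f: "polyfun I f" using insert.prems(1) by simp
  obtain \<alpha> where \<alpha>: "\<alpha> \<in> extensional I" "f \<alpha> \<noteq> 0" using insert.prems(2)[of f] by blast
  have "openin (powertop_real I) ?V" using f insert.prems(3) by (rule openin_polyfun_nonzero)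
  moreover have "?V \<noteq> {}"
    using polyfun_nonzero_in_open[OF f \<alpha> insert.prems(3,4)] by blast
  ultimately have "\<exists>w\<in>?V. \<forall>g\<in>F. g w \<noteq> 0"
    using insert.prems(1,2) by (intro insert.IH) simp_all
  then show ?case by blast
qed auto

lemma nowhere_dense_polyfun_zeros:
  assumes f: "polyfun I f" and \<alpha>: "\<alpha> \<in> extensional I" "f \<alpha> \<noteq> 0"
    and U: "openin (powertop_real I) U"
  shows "nowhere_dense_in (subtopology (powertop_real I) U) {w \<in> U. f w = 0}"
proof -
  let ?Y = "subtopology (powertop_real I) U" and ?Z = "{w \<in> U. f w = 0}"
  have top: "topspace ?Y = U"
    unfolding topspace_subtopology using openin_subset[OF U] by (rule Int_absorb1)
  have compl: "topspace ?Y - ?Z = {w \<in> U. f w \<noteq> 0}" unfolding top by blast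
  have "openin ?Y {w \<in> U. f w \<noteq> 0}"
    unfolding openin_open_subtopology[OF U] using openin_polyfun_nonzero[OF f U] by blast
  then have "closedin ?Y ?Z" unfolding closedin_def compl unfolding top by blast
  then have cl: "?Y closure_of ?Z = ?Z" by (rule closure_of_closedin)
  have "?Y interior_of ?Z = {}"
  proof (rule ccontr)
    assume ne: "?Y interior_of ?Z \<noteq> {}"
    have "openin (powertop_real I) (?Y interior_of ?Z)"
      using openin_interior_of[of ?Y ?Z] unfolding openin_open_subtopology[OF U] by (rule conjunct1)
    from polyfun_nonzero_in_open[OF f \<alpha> this ne]
    obtain w where w: "w \<in> ?Y interior_of ?Z" "f w \<noteq> 0" by (elim bexE)
    from subsetD[OF interior_of_subset w(1)] w(2) show False by simp
  qed
  then show ?thesis unfolding nowhere_dense_in_def cl top by blast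
qed

lemma openin_positive_orthant:
  assumes "finite I"
  shows "openin (powertop_real I) {w \<in> topspace (powertop_real I). \<forall>i\<in>I. w i > 0}"
proof -
  have "{w \<in> topspace (powertop_real I). \<forall>i\<in>I. w i > 0} = (\<Pi>\<^sub>E i\<in>I. {0<..})"
    by (auto simp: PiE_iff extensional_def)
  then show ?thesis using assms by (simp add: openin_PiE)
qed

section \<open>Complex matrices and subspaces\<close>

lemma mat_eqI_mult_vec:
  fixes A B :: "complex mat"
  assumes A: "A \<in> carrier_mat n k" and B: "B \<in> carrier_mat n k"
    and eq: "\<And>u. u \<in> carrier_vec k \<Longrightarrow> A *\<^sub>v u = B *\<^sub>v u"
  shows "A = B"
proof (rule eq_matI)
  fix i j assume "i < dim_row B" "j < dim_col B"
  then have ij: "i < n" "j < k" using B by auto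
  have "(A *\<^sub>v unit_vec k j) $ i = (B *\<^sub>v unit_vec k j) $ i" using eq[of "unit_vec k j"] by simp
  then show "A $$ (i, j) = B $$ (i, j)" using ij A B by simp
qed (use A B in auto)

lemma scalar_prod_left_cancel:
  fixes u v :: "complex Matrix.vec"
  assumes "u \<in> carrier_vec n" "v \<in> carrier_vec n" "\<And>a. a \<in> carrier_vec n \<Longrightarrow> a \<bullet> u = a \<bullet> v"
  shows "u = v"
proof (rule eq_vecI)
  fix i assume "i < dim_vec v"
  then have i: "i < n" using assms(2) by simp
  then show "u $ i = v $ i" using assms(3)[of "unit_vec n i"] assms(1,2) by simp
qed (use assms in auto)

lemma smult_mat_mult_vec:
  fixes A :: "complex mat"
  assumes "A \<in> carrier_mat n k" "v \<in> carrier_vec k"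
  shows "(c \<cdot>\<^sub>m A) *\<^sub>v v = c \<cdot>\<^sub>v (A *\<^sub>v v)"
  using assms by (intro eq_vecI) (auto simp: scalar_prod_def sum_distrib_left mult.assoc)

lemma scalar_prod_mult_mat_vec:
  fixes A :: "complex mat"
  assumes "A \<in> carrier_mat n k" "u \<in> carrier_vec k" "a \<in> carrier_vec n"
  shows "a \<bullet> (A *\<^sub>v u) = (transpose_mat A *\<^sub>v a) \<bullet> u"
  using transpose_vec_mult_scalar[OF assms] by simp

lemma conjugate_mult_mat_vec:
  fixes A :: "complex mat"
  assumes "A \<in> carrier_mat n k" "v \<in> carrier_vec k"
  shows "conjugate (A *\<^sub>v v) = map_mat cnj A *\<^sub>v conjugate v"
  using assms by (intro eq_vecI) (auto simp: scalar_prod_def)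

lemma conjugate_scalar_prod:
  fixes a b :: "complex Matrix.vec"
  assumes "a \<in> carrier_vec k" "b \<in> carrier_vec k"
  shows "conjugate a \<bullet> conjugate b = cnj (a \<bullet> b)"
  using assms by (auto simp: scalar_prod_def)

lemma conjugate_smult: "conjugate (c \<cdot>\<^sub>v v) = cnj c \<cdot>\<^sub>v conjugate v" for v :: "complex Matrix.vec"
  by (intro eq_vecI) auto

lemma map_cnj_mult:
  fixes A B :: "complex mat"
  assumes "A \<in> carrier_mat n k" "B \<in> carrier_mat k m"
  shows "map_mat cnj (A * B) = map_mat cnj A * map_mat cnj B"
  using assms by (intro eq_matI) (auto simp: scalar_prod_def)

lemma map_cnj_map_cnj [simp]: "map_mat cnj (map_mat cnj A) = A"
  by (intro eq_matI) auto

lemma map_cnj_one [simp]: "map_mat cnj (1\<^sub>m n) = 1\<^sub>m n"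
  by (intro eq_matI) auto

lemma Re_scalar_prod_conjugate:
  assumes "w \<in> carrier_vec n"
  shows "Re (w \<bullet> conjugate w) = (\<Sum>i<n. (cmod (w $ i))\<^sup>2)"
  using assms by (simp add: scalar_prod_def lessThan_atLeast0 complex_mult_cnj cmod_power2)

lemma Re_scalar_prod_conjugate_nonneg: "Re (w \<bullet> conjugate w) \<ge> 0"
  using Re_scalar_prod_conjugate[of w "dim_vec w"] by (simp add: sum_nonneg)

lemma scalar_prod_conjugate_eq_0:
  fixes v :: "complex Matrix.vec"
  assumes "v \<in> carrier_vec n" "conjugate v \<bullet> v = 0"
  shows "v = 0\<^sub>v n"
proof -
  have "v \<bullet> conjugate v = 0" using assms comm_scalar_prod[of v n "conjugate v"] by simp
  then show ?thesis using conjugate_square_eq_0_vec[OF assms(1)] by simp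
qed

lemma linear_functional_scalar_prod:
  fixes F :: "complex Matrix.vec \<Rightarrow> complex"
  assumes add: "\<And>u v. u \<in> carrier_vec n \<Longrightarrow> v \<in> carrier_vec n \<Longrightarrow> F (u + v) = F u + F v"
    and smult: "\<And>c v. v \<in> carrier_vec n \<Longrightarrow> F (c \<cdot>\<^sub>v v) = c * F v"
    and u: "u \<in> carrier_vec n"
  shows "F u = Matrix.vec n (\<lambda>i. F (unit_vec n i)) \<bullet> u"
proof -
  have "F (Matrix.vec n (\<lambda>i. if i < k then u $ i else 0)) = (\<Sum>i<k. F (unit_vec n i) * u $ i)" if "k \<le> n" for k
    using that
  proof (induction k)
    case 0
    have "Matrix.vec n (\<lambda>i. if i < 0 then u $ i else 0) = 0 \<cdot>\<^sub>v 0\<^sub>v n" by (rule eq_vecI) auto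
    then show ?case using smult[of "0\<^sub>v n" 0] by simp
  next
    case (Suc k)
    have "Matrix.vec n (\<lambda>i. if i < Suc k then u $ i else 0) =
        Matrix.vec n (\<lambda>i. if i < k then u $ i else 0) + u $ k \<cdot>\<^sub>v unit_vec n k"
      using Suc.prems by (intro eq_vecI) (auto simp: unit_vec_def less_Suc_eq)
    then show ?case using Suc add smult by (simp add: mult.commute)
  qed
  from this[of n] have "F (Matrix.vec n (\<lambda>i. if i < n then u $ i else 0)) = (\<Sum>i<n. F (unit_vec n i) * u $ i)"
    by simp
  moreover have "Matrix.vec n (\<lambda>i. if i < n then u $ i else 0) = u" using u by (intro eq_vecI) auto
  ultimately show ?thesis using u by (simp add: scalar_prod_def lessThan_atLeast0)
qed

definition adj :: "complex mat \<Rightarrow> complex mat" where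
  "adj A = transpose_mat (map_mat cnj A)"

lemma adj_carrier [simp]: "A \<in> carrier_mat n k \<Longrightarrow> adj A \<in> carrier_mat k n"
  by (simp add: adj_def)

lemma adj_scalar_prod:
  assumes A: "A \<in> carrier_mat n k" and u: "u \<in> carrier_vec k" and w: "w \<in> carrier_vec n"
  shows "w \<bullet> conjugate (A *\<^sub>v u) = (adj A *\<^sub>v w) \<bullet> conjugate u"
proof -
  have "w \<bullet> conjugate (A *\<^sub>v u) = w \<bullet> (map_mat cnj A *\<^sub>v conjugate u)"
    using A u by (simp add: conjugate_mult_mat_vec)
  also have "\<dots> = (adj A *\<^sub>v w) \<bullet> conjugate u"
    unfolding adj_def using A u w by (intro scalar_prod_mult_mat_vec) auto
  finally show ?thesis .
qed

lemma wide_matrix_kernel: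
  fixes A :: "complex mat"
  assumes A: "A \<in> carrier_mat n k" and "n < k"
  shows "\<exists>u\<in>carrier_vec k. u \<noteq> 0\<^sub>v k \<and> A *\<^sub>v u = 0\<^sub>v n"
proof -
  define c where "c = (\<lambda>i. if i < n then row A i else 0\<^sub>v k)"
  \<comment> \<open>Zero rows make the matrix square, and its determinant 0.\<close>
  define A' where "A' = mat\<^sub>r k k (\<lambda>i. if i = n then 0\<^sub>v k else c i)"
  have "c \<in> {0..<k} \<rightarrow> carrier_vec k" using A by (auto simp: c_def)
  then have "Determinant.det A' = 0" unfolding A'_def using \<open>n < k\<close> by (intro det_row_0)
  moreover have A': "A' \<in> carrier_mat k k" by (simp add: A'_def)
  ultimately obtain u where u: "u \<in> carrier_vec k" "u \<noteq> 0\<^sub>v k" "A' *\<^sub>v u = 0\<^sub>v k"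
    using det_0_iff_vec_prod_zero_field[OF A'] by blast
  have "A *\<^sub>v u = 0\<^sub>v n"
  proof (rule eq_vecI)
    fix i assume "i < dim_vec (0\<^sub>v n :: complex Matrix.vec)"
    then have i: "i < n" by simp
    have "row A' i = row A i" using i \<open>n < k\<close> A by (auto simp: A'_def c_def)
    moreover have "(A' *\<^sub>v u) $ i = 0" using u i \<open>n < k\<close> by simp
    ultimately show "(A *\<^sub>v u) $ i = 0\<^sub>v n $ i" using i A A' \<open>n < k\<close> by simp
  qed (use A in auto)
  then show ?thesis using u by blast
qed

lemma left_invertible_tall:
  fixes A C :: "complex mat"
  assumes A: "A \<in> carrier_mat n k" and C: "C \<in> carrier_mat k n" and CA: "C * A = 1\<^sub>m k"
  shows "k \<le> n"
proof (rule ccontr)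
  assume "\<not> k \<le> n"
  then obtain u where u: "u \<in> carrier_vec k" "u \<noteq> 0\<^sub>v k" "A *\<^sub>v u = 0\<^sub>v n"
    using wide_matrix_kernel[OF A] by auto
  have "u = (C * A) *\<^sub>v u" using u CA by simp
  also have "\<dots> = C *\<^sub>v (A *\<^sub>v u)" using A C u by simp
  also have "\<dots> = 0\<^sub>v k" using C u by (auto intro!: eq_vecI)
  finally show False using u by simp
qed

definition inj_mat :: "complex mat \<Rightarrow> bool" where
  "inj_mat A \<longleftrightarrow> (\<forall>u\<in>carrier_vec (dim_col A). A *\<^sub>v u = 0\<^sub>v (dim_row A) \<longrightarrow> u = 0\<^sub>v (dim_col A))"

text \<open>The left inverse \<open>C\<close> is chosen such that \<open>A * C\<close> is the
  orthogonal projection to the range of \<open>A\<close>; this is the content of the second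
  equation.\<close>

lemma inj_mat_left_inverse:
  assumes A: "A \<in> carrier_mat n k" and inj: "inj_mat A"
  shows "\<exists>C\<in>carrier_mat k n. C * A = 1\<^sub>m k \<and> adj A * (A * C) = adj A"
proof -
  let ?H = "adj A * A"
  have aA: "adj A \<in> carrier_mat k n" using A by simp
  have H: "?H \<in> carrier_mat k k" using A by (intro mult_carrier_mat[of _ k n] adj_carrier)
  \<comment> \<open>\<open>adj A * A\<close> is invertible since \<open>adj A * A * u = 0\<close> gives \<open>\<parallel>A * u\<parallel> = 0\<close>;
    the left inverse is \<open>inverse (adj A * A) * adj A\<close>.\<close>
  have "Determinant.det ?H \<noteq> 0"
  proof
    assume "Determinant.det ?H = 0"
    then obtain u where u: "u \<in> carrier_vec k" "u \<noteq> 0\<^sub>v k" "?H *\<^sub>v u = 0\<^sub>v k"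
      using det_0_iff_vec_prod_zero_field[OF H] by blast
    have Au: "A *\<^sub>v u \<in> carrier_vec n" using A u by simp
    have "(A *\<^sub>v u) \<bullet> conjugate (A *\<^sub>v u) = (adj A *\<^sub>v (A *\<^sub>v u)) \<bullet> conjugate u"
      by (rule adj_scalar_prod[OF A u(1) Au])
    also have "adj A *\<^sub>v (A *\<^sub>v u) = 0\<^sub>v k"
      using u(3) assoc_mult_mat_vec[OF aA A u(1)] by simp
    finally have "(A *\<^sub>v u) \<bullet> conjugate (A *\<^sub>v u) = 0" using u by simp
    then have "A *\<^sub>v u = 0\<^sub>v n" using conjugate_square_eq_0_vec[OF Au] by simp
    then show False using inj u A by (simp add: inj_mat_def)
  qed
  then obtain D where D: "D \<in> carrier_mat k k" "D * ?H = 1\<^sub>m k" "?H * D = 1\<^sub>m k"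
    using det_non_zero_imp_unit[OF H, of "()"] by (auto simp: Units_def ring_mat_def)
  have DaA: "D * adj A \<in> carrier_mat k n" using D(1) aA by simp
  have "(D * adj A) * A = 1\<^sub>m k" using assoc_mult_mat[OF D(1) aA A] D(2) by simp
  moreover have "adj A * (A * (D * adj A)) = (?H * D) * adj A"
    using assoc_mult_mat[OF aA A DaA] assoc_mult_mat[OF H D(1) aA] by (simp only:)
  then have "adj A * (A * (D * adj A)) = adj A" using D(3) aA by simp
  ultimately show ?thesis using DaA by blast
qed

lemma left_inverse_inj_mat:
  assumes "A \<in> carrier_mat n k" "C \<in> carrier_mat k n" "C * A = 1\<^sub>m k"
  shows "inj_mat A"
  unfolding inj_mat_def
proof (intro ballI impI)
  fix u assume u: "u \<in> carrier_vec (dim_col A)" "A *\<^sub>v u = 0\<^sub>v (dim_row A)"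
  have "u = (C * A) *\<^sub>v u" using u assms by simp
  also have "\<dots> = C *\<^sub>v (A *\<^sub>v u)" using assms u by (intro assoc_mult_mat_vec) auto
  also have "\<dots> = 0\<^sub>v k" using assms u by (auto intro!: eq_vecI)
  finally show "u = 0\<^sub>v (dim_col A)" using assms by simp
qed

lemma inj_mat_zero_cols: "inj_mat (0\<^sub>m n 0)"
  by (auto simp: inj_mat_def)

definition append_col :: "complex mat \<Rightarrow> complex Matrix.vec \<Rightarrow> complex mat" where
  "append_col A w = Matrix.mat (dim_row A) (Suc (dim_col A)) (\<lambda>(i, j). if j < dim_col A then A $$ (i, j) else w $ i)"

lemma append_col_carrier [simp]: "A \<in> carrier_mat n k \<Longrightarrow> append_col A w \<in> carrier_mat n (Suc k)"
  by (simp add: append_col_def)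

lemma append_col_mult_vec:
  assumes A: "A \<in> carrier_mat n k" and w: "w \<in> carrier_vec n" and u: "u \<in> carrier_vec (Suc k)"
  shows "append_col A w *\<^sub>v u = A *\<^sub>v Matrix.vec k (\<lambda>i. u $ i) + (u $ k) \<cdot>\<^sub>v w"
  using assms by (intro eq_vecI) (auto simp: append_col_def scalar_prod_def mult.commute)

lemma append_col_empty_mult_vec:
  assumes "v \<in> carrier_vec n" "u \<in> carrier_vec (Suc 0)"
  shows "append_col (0\<^sub>m n 0) v *\<^sub>v u = u $ 0 \<cdot>\<^sub>v v"
proof -
  have "append_col (0\<^sub>m n 0) v *\<^sub>v u = 0\<^sub>m n 0 *\<^sub>v Matrix.vec 0 (\<lambda>i. u $ i) + u $ 0 \<cdot>\<^sub>v v"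
    by (rule append_col_mult_vec[OF zero_carrier_mat assms])
  also have "0\<^sub>m n 0 *\<^sub>v Matrix.vec 0 (\<lambda>i. u $ i) = 0\<^sub>v n" by (rule eq_vecI) (auto simp: scalar_prod_def)
  finally show ?thesis using assms by simp
qed

lemma append_col_inj:
  assumes A: "A \<in> carrier_mat n k" and inj: "inj_mat A" and w: "w \<in> carrier_vec n"
    and notin: "\<And>u. u \<in> carrier_vec k \<Longrightarrow> A *\<^sub>v u \<noteq> w"
  shows "inj_mat (append_col A w)"
  unfolding inj_mat_def
proof (intro ballI impI)
  fix u assume "u \<in> carrier_vec (dim_col (append_col A w))"
    and 0: "append_col A w *\<^sub>v u = 0\<^sub>v (dim_row (append_col A w))"
  then have u: "u \<in> carrier_vec (Suc k)" using A by (simp add: append_col_def)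
  define u' where "u' = Matrix.vec k (\<lambda>i. u $ i)"
  have u': "u' \<in> carrier_vec k" by (simp add: u'_def)
  have sum0: "A *\<^sub>v u' + (u $ k) \<cdot>\<^sub>v w = 0\<^sub>v n"
    using 0 append_col_mult_vec[OF A w u] A by (simp add: u'_def append_col_def)
  have ent: "(A *\<^sub>v u') $ i + u $ k * w $ i = 0" if "i < n" for i
    using arg_cong[OF sum0, of "\<lambda>v. v $ i"] that A w by simp
  have uk: "u $ k = 0"
  proof (rule ccontr)
    assume nz: "u $ k \<noteq> 0"
    have "A *\<^sub>v (- inverse (u $ k) \<cdot>\<^sub>v u') = - inverse (u $ k) \<cdot>\<^sub>v (A *\<^sub>v u')"
      using A u' by (intro mult_mat_vec)
    also have "\<dots> = w"
    proof (rule eq_vecI)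
      fix i assume "i < dim_vec w"
      then have i: "i < n" using w by simp
      have "(A *\<^sub>v u') $ i = - (u $ k * w $ i)" using ent[OF i] by (simp add: eq_neg_iff_add_eq_0)
      then show "(- inverse (u $ k) \<cdot>\<^sub>v (A *\<^sub>v u')) $ i = w $ i"
        using i A nz by (simp del: index_mult_mat_vec)
    qed (use A w in auto)
    finally show False using notin[of "- inverse (u $ k) \<cdot>\<^sub>v u'"] u' by simp
  qed
  have "A *\<^sub>v u' = 0\<^sub>v n"
    using ent uk A by (intro eq_vecI) (auto simp del: index_mult_mat_vec)
  then have "u' = 0\<^sub>v k" using inj u' A by (simp add: inj_mat_def)
  then have "u $ i = 0" if "i < k" for i
    using that by (metis u'_def index_vec index_zero_vec(1))
  with uk have "u $ i = 0" if "i < Suc k" for i using that by (cases "i = k") auto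
  then show "u = 0\<^sub>v (dim_col (append_col A w))"
    using u A by (intro eq_vecI) (auto simp: append_col_def)
qed

text \<open>The columns of \<open>A\<close> are a basis of \<open>W\<close>.\<close>

lemma subspace_matrix_basis:
  fixes W :: "complex Matrix.vec set"
  assumes sub: "W \<subseteq> carrier_vec n" and zero: "0\<^sub>v n \<in> W"
    and add: "\<And>u v. u \<in> W \<Longrightarrow> v \<in> W \<Longrightarrow> u + v \<in> W"
    and smult: "\<And>c v. v \<in> W \<Longrightarrow> c \<cdot>\<^sub>v v \<in> W"
  obtains k A where "k \<le> n" "A \<in> carrier_mat n k" "inj_mat A" "W = (\<lambda>u. A *\<^sub>v u) ` carrier_vec k"
proof -
  define P where "P k \<longleftrightarrow> (\<exists>A\<in>carrier_mat n k. inj_mat A \<and> (\<forall>u\<in>carrier_vec k. A *\<^sub>v u \<in> W))" for k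
  have bound: "k \<le> n" if "P k" for k
    using that left_invertible_tall inj_mat_left_inverse unfolding P_def by metis
  have "P 0"
    unfolding P_def
  proof (intro bexI conjI ballI)
    show "inj_mat (0\<^sub>m n 0)" by (rule inj_mat_zero_cols)
    fix u :: "complex Matrix.vec" assume "u \<in> carrier_vec 0"
    then have "0\<^sub>m n 0 *\<^sub>v u = 0\<^sub>v n" by (intro eq_vecI) (auto simp: scalar_prod_def)
    then show "0\<^sub>m n 0 *\<^sub>v u \<in> W" using zero by simp
  qed simp
  \<comment> \<open>A largest injective matrix with range in \<open>W\<close> has range \<open>W\<close>: otherwise a vector of \<open>W\<close>
    outside the range could be appended as a further column.\<close>
  define k where "k = (GREATEST k. P k)"
  have Pk: "P k" unfolding k_def using GreatestI_nat[of P, OF \<open>P 0\<close>] bound by blast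
  have not: "\<not> P (Suc k)"
    using Greatest_le_nat[of P "Suc k" n] bound unfolding k_def by (metis Suc_n_not_le_n)
  obtain A where A: "A \<in> carrier_mat n k" "inj_mat A" "\<And>u. u \<in> carrier_vec k \<Longrightarrow> A *\<^sub>v u \<in> W"
    using Pk unfolding P_def by blast
  have "w \<in> (\<lambda>u. A *\<^sub>v u) ` carrier_vec k" if "w \<in> W" for w
  proof (rule ccontr)
    assume notin: "\<not> ?thesis"
    have w: "w \<in> carrier_vec n" using that sub by blast
    have "inj_mat (append_col A w)" using notin by (intro append_col_inj[OF A(1,2) w]) auto
    moreover have "append_col A w *\<^sub>v u \<in> W" if "u \<in> carrier_vec (Suc k)" for u
      unfolding append_col_mult_vec[OF A(1) w that]
      by (intro add smult A(3) \<open>w \<in> W\<close>) simp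
    ultimately have "P (Suc k)" unfolding P_def using A(1) by (metis append_col_carrier)
    then show False using not by simp
  qed
  then show thesis using A bound[OF Pk] that by blast
qed

lemma bijective_matrix_inverse:
  fixes T :: "complex mat"
  assumes T: "T \<in> carrier_mat m n" and inj: "inj_mat T"
    and surj: "\<And>v. v \<in> carrier_vec m \<Longrightarrow> \<exists>u\<in>carrier_vec n. v = T *\<^sub>v u"
  shows "m = n" "\<exists>T'\<in>carrier_mat n n. T' * T = 1\<^sub>m n \<and> T * T' = 1\<^sub>m n"
proof -
  obtain C where C: "C \<in> carrier_mat n m" "C * T = 1\<^sub>m n" using inj_mat_left_inverse[OF T inj] by blast
  have TC: "T * C = 1\<^sub>m m"
  proof (rule mat_eqI_mult_vec)
    fix v :: "complex Matrix.vec" assume v: "v \<in> carrier_vec m"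
    then obtain u where u: "u \<in> carrier_vec n" "v = T *\<^sub>v u" using surj by blast
    have "(T * C) *\<^sub>v v = T *\<^sub>v (C *\<^sub>v (T *\<^sub>v u))" using T C u by simp
    also have "C *\<^sub>v (T *\<^sub>v u) = (C * T) *\<^sub>v u" using T C(1) u by simp
    finally show "(T * C) *\<^sub>v v = 1\<^sub>m m *\<^sub>v v" using C(2) u v by simp
  qed (use T C in auto)
  show "m = n" using left_invertible_tall[OF T C] left_invertible_tall[OF C(1) T TC] by simp
  then show "\<exists>T'\<in>carrier_mat n n. T' * T = 1\<^sub>m n \<and> T * T' = 1\<^sub>m n" using C TC by auto
qed

section \<open>Eigenspaces and multiplicities of roots\<close>

text \<open>No generalized eigenvector has height 2: the kernels of \<open>A - \<mu>\<close> and
  of its square agree for all \<open>\<mu>\<close>.\<close>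

definition semisimple_mat :: "complex mat \<Rightarrow> bool" where
  "semisimple_mat A \<longleftrightarrow> (\<forall>\<mu>. \<forall>v\<in>carrier_vec (dim_row A).
     A *\<^sub>v (A *\<^sub>v v - \<mu> \<cdot>\<^sub>v v) = \<mu> \<cdot>\<^sub>v (A *\<^sub>v v - \<mu> \<cdot>\<^sub>v v) \<longrightarrow> A *\<^sub>v v - \<mu> \<cdot>\<^sub>v v = 0\<^sub>v (dim_row A))"

lemma char_matrix_mult_vec:
  fixes A :: "complex mat"
  assumes "A \<in> carrier_mat n n" "v \<in> carrier_vec n"
  shows "char_matrix A \<mu> *\<^sub>v v = A *\<^sub>v v - \<mu> \<cdot>\<^sub>v v"
proof -
  have "char_matrix A \<mu> *\<^sub>v v = A *\<^sub>v v + ((- \<mu>) \<cdot>\<^sub>m 1\<^sub>m n) *\<^sub>v v"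
    unfolding char_matrix_def using assms by (subst add_mult_distrib_mat_vec[of _ n n]) auto
  also have "((- \<mu>) \<cdot>\<^sub>m 1\<^sub>m n) *\<^sub>v v = (- \<mu>) \<cdot>\<^sub>v v"
    using assms(2) by (simp add: smult_mat_mult_vec[OF one_carrier_mat])
  finally show ?thesis using assms by (intro eq_vecI) (auto simp del: index_mult_mat_vec)
qed

text \<open>Squaring \<open>A - a\<close> does not enlarge its kernel, so no Jordan block for
  \<open>a\<close> has size 2 or more.\<close>

lemma semisimple_jordan_blocks:
  assumes A: "A \<in> carrier_mat n n" and ss: "semisimple_mat A" and jnf: "jordan_nf A n_as"
    and mem: "(m, a) \<in> set n_as"
  shows "m = 1"
proof -
  let ?M = "char_matrix A a"
  have M: "?M \<in> carrier_mat n n" using A by (simp add: char_matrix_def)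
  have M2: "?M * ?M \<in> carrier_mat n n" using M by simp
  \<comment> \<open>Each block of size \<open>k\<close> contributes \<open>min j k\<close> to the kernel dimension of the \<open>j\<close>-th power.\<close>
  have "mat_kernel (?M * ?M) = mat_kernel ?M"
  proof
    show "mat_kernel ?M \<subseteq> mat_kernel (?M * ?M)"
      by (rule mat_kernel_mult_subset[OF M M])
    show "mat_kernel (?M * ?M) \<subseteq> mat_kernel ?M"
    proof
      fix v assume "v \<in> mat_kernel (?M * ?M)"
      then have v: "v \<in> carrier_vec n" "(?M * ?M) *\<^sub>v v = 0\<^sub>v n" using mat_kernelD[OF M2] by auto
      define z where "z = A *\<^sub>v v - a \<cdot>\<^sub>v v"
      have z: "z \<in> carrier_vec n" using A v by (simp add: z_def)
      have Mv: "?M *\<^sub>v v = z" using A v by (simp add: char_matrix_mult_vec z_def)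
      have "?M *\<^sub>v z = 0\<^sub>v n" using v M Mv by (simp add: assoc_mult_mat_vec[OF M M])
      then have "A *\<^sub>v z - a \<cdot>\<^sub>v z = 0\<^sub>v n" using A z by (simp add: char_matrix_mult_vec)
      have "A *\<^sub>v z = a \<cdot>\<^sub>v z"
      proof (rule eq_vecI)
        fix i assume "i < dim_vec (a \<cdot>\<^sub>v z)"
        then have i: "i < n" using z by simp
        have "(A *\<^sub>v z - a \<cdot>\<^sub>v z) $ i = 0" using \<open>A *\<^sub>v z - a \<cdot>\<^sub>v z = 0\<^sub>v n\<close> i by simp
        then show "(A *\<^sub>v z) $ i = (a \<cdot>\<^sub>v z) $ i" using i z A by (simp del: index_mult_mat_vec)
      qed (use A z in auto)
      then have "z = 0\<^sub>v n" using ss v A unfolding semisimple_mat_def z_def by auto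
      then show "v \<in> mat_kernel ?M" using M v Mv by (intro mat_kernelI) auto
    qed
  qed
  then have "kernel_dim (?M * ?M) = kernel_dim ?M" using M by (simp add: kernel_dim_def)
  then have "dim_gen_eigenspace A a 2 = dim_gen_eigenspace A a 1"
    using M by (simp add: dim_gen_eigenspace_def numeral_2_eq_2)
  then have eq: "(\<Sum>k\<leftarrow>map fst [(k, e)\<leftarrow>n_as. e = a]. min 2 k) = (\<Sum>k\<leftarrow>map fst [(k, e)\<leftarrow>n_as. e = a]. min 1 k)"
    by (simp only: dim_gen_eigenspace[OF jnf])
  have gen: "\<forall>k\<in>set ks. min 2 k = min 1 k" if "(\<Sum>k\<leftarrow>ks. min 2 k) = (\<Sum>k\<leftarrow>ks. min 1 k)" for ks :: "nat list"
    using that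
  proof (induction ks)
    case (Cons k ks)
    have "(\<Sum>k\<leftarrow>ks. min 1 k) \<le> (\<Sum>k\<leftarrow>ks. min 2 k)" by (intro sum_list_mono) auto
    with Cons show ?case by auto
  qed simp
  have "m \<in> set (map fst [(k, e)\<leftarrow>n_as. e = a])" using mem by force
  with gen[OF eq] have "min 2 m = min 1 m" by blast
  moreover have "m \<noteq> 0" using jnf mem unfolding jordan_nf_def by force
  ultimately show ?thesis by auto
qed

lemma jordan_matrix_simple_blocks:
  assumes "\<And>m a. (m, a) \<in> set n_as \<Longrightarrow> m = 1"
  shows "sum_list (map fst n_as) = length n_as"
    and "jordan_matrix n_as = Matrix.mat (length n_as) (length n_as) (\<lambda>(i, j). if i = j then snd (n_as ! i) else (0::complex))"
proof -
  show len: "sum_list (map fst n_as) = length n_as"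
    using assms by (induction n_as) fastforce+
  show "jordan_matrix n_as = Matrix.mat (length n_as) (length n_as) (\<lambda>(i, j). if i = j then snd (n_as ! i) else (0::complex))"
    using assms
  proof (induction n_as)
    case Nil
    show ?case by (rule eq_matI) (auto simp: jordan_matrix_def)
  next
    case (Cons na n_as)
    obtain m a where na: "na = (m, a)" by force
    have m: "m = 1" using Cons.prems[of m a] na by simp
    have IH: "jordan_matrix n_as = Matrix.mat (length n_as) (length n_as) (\<lambda>(i, j). if i = j then snd (n_as ! i) else (0::complex))"
      using Cons.prems by (intro Cons.IH) auto
    have "sum_list (map fst n_as) = length n_as" using Cons.prems by (induction n_as) fastforce+
    then show ?case
      unfolding na jordan_matrix_Cons IH m by (intro eq_matI) (auto simp: nth_Cons')
  qed
qed

lemma semisimple_diagonalization: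
  assumes A: "A \<in> carrier_mat n n" and ss: "semisimple_mat A"
  obtains P Q d where "P \<in> carrier_mat n n" "Q \<in> carrier_mat n n" "P * Q = 1\<^sub>m n" "Q * P = 1\<^sub>m n"
    "A = P * mat_diag n d * Q" "\<And>\<mu>. Polynomial.order \<mu> (char_poly A) = length (filter (\<lambda>i. d i = \<mu>) [0..<n])"
proof -
  obtain n_as where jnf: "jordan_nf A n_as"
    using jordan_nf_exists[OF A] char_poly_factorized[OF A] by blast
  have simple: "m = 1" if "(m, a) \<in> set n_as" for m a
    using semisimple_jordan_blocks[OF A ss jnf that] .
  have J: "sum_list (map fst n_as) = length n_as"
    "jordan_matrix n_as = Matrix.mat (length n_as) (length n_as) (\<lambda>(i, j). if i = j then snd (n_as ! i) else (0::complex))"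
    using jordan_matrix_simple_blocks[of n_as] simple by blast+
  obtain P Q where w: "similar_mat_wit A (jordan_matrix n_as) P Q"
    using jnf unfolding jordan_nf_def similar_mat_def by blast
  then have PQ: "P \<in> carrier_mat n n" "Q \<in> carrier_mat n n" "P * Q = 1\<^sub>m n" "Q * P = 1\<^sub>m n"
    "A = P * jordan_matrix n_as * Q" "jordan_matrix n_as \<in> carrier_mat n n"
    using A unfolding similar_mat_wit_def by (auto simp: Let_def)
  then have len: "length n_as = n" using J by auto
  define d where "d i = snd (n_as ! i)" for i
  have "jordan_matrix n_as = mat_diag n d"
    unfolding J(2) len mat_diag_def d_def by (rule eq_matI) auto
  moreover have "Polynomial.order \<mu> (char_poly A) = length (filter (\<lambda>i. d i = \<mu>) [0..<n])" for \<mu>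
  proof -
    have "Polynomial.order \<mu> (char_poly A) = sum_list (map fst (filter (\<lambda>na. snd na = \<mu>) n_as))"
      by (rule jordan_nf_order[OF jnf])
    also have "\<dots> = sum_list (map (\<lambda>_. 1) (filter (\<lambda>na. snd na = \<mu>) n_as))"
      using simple by (intro arg_cong[where f = sum_list] map_cong) auto
    also have "\<dots> = length (filter (\<lambda>na. snd na = \<mu>) n_as)" by (simp add: sum_list_triv)
    also have "\<dots> = length (filter (\<lambda>i. d i = \<mu>) [0..<n])"
      by (simp add: length_filter_conv_card d_def len cong: conj_cong)
    finally show ?thesis .
  qed
  ultimately show thesis using PQ that by metis
qed

text \<open>The columns of \<open>F\<close> are the unit vectors with index in \<open>xs\<close>,
  so \<open>F\<close> embeds the coordinate subspace on which the rows outside \<open>xs\<close>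
  vanish.\<close>

lemma selection_matrix:
  fixes xs :: "nat list" and n :: nat
  assumes "distinct xs" "set xs \<subseteq> {..<n}"
  defines "F \<equiv> Matrix.mat n (length xs) (\<lambda>(i, r). if i = xs ! r then 1 else (0::complex))"
  shows "transpose_mat F * F = 1\<^sub>m (length xs)"
    "\<And>M k. M \<in> carrier_mat n k \<Longrightarrow> (\<And>i j. i < n \<Longrightarrow> i \<notin> set xs \<Longrightarrow> j < k \<Longrightarrow> M $$ (i, j) = 0) \<Longrightarrow> F * (transpose_mat F * M) = M"
proof -
  have xs: "xs ! r < n" if "r < length xs" for r using assms(2) that nth_mem by blast
  show "transpose_mat F * F = 1\<^sub>m (length xs)"
    by (rule eq_matI) (use assms(1) xs in \<open>auto simp: F_def scalar_prod_def if_distrib[where f = "\<lambda>z. z * c" for c] nth_eq_iff_index_eq cong: if_cong\<close>)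
  fix M :: "complex mat" and k
  assume M: "M \<in> carrier_mat n k" and zero: "\<And>i j. i < n \<Longrightarrow> i \<notin> set xs \<Longrightarrow> j < k \<Longrightarrow> M $$ (i, j) = 0"
  have F: "F \<in> carrier_mat n (length xs)" by (simp add: F_def)
  have FtM: "(transpose_mat F * M) $$ (r, j) = M $$ (xs ! r, j)" if "r < length xs" "j < k" for r j
    using that M xs by (simp add: F_def scalar_prod_def if_distrib[where f = "\<lambda>z. z * c" for c] cong: if_cong)
  show "F * (transpose_mat F * M) = M"
  proof (rule eq_matI)
    fix i j assume "i < dim_row M" "j < dim_col M"
    then have ij: "i < n" "j < k" using M by auto
    have "(F * (transpose_mat F * M)) $$ (i, j) = (\<Sum>r<length xs. F $$ (i, r) * (transpose_mat F * M) $$ (r, j))"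
      using ij M F by (simp add: scalar_prod_def lessThan_atLeast0 del: index_transpose_mat)
    also have "\<dots> = (\<Sum>r<length xs. (if i = xs ! r then 1 else 0) * M $$ (xs ! r, j))"
      using ij FtM by (intro sum.cong) (auto simp: F_def)
    also have "\<dots> = M $$ (i, j)"
    proof (cases "i \<in> set xs")
      case True
      then obtain r where r: "r < length xs" "xs ! r = i" by (auto simp: in_set_conv_nth)
      have "(\<Sum>r<length xs. (if i = xs ! r then 1 else 0) * M $$ (xs ! r, j)) = (\<Sum>s<length xs. if s = r then M $$ (i, j) else 0)"
        using r assms(1) by (intro sum.cong) (auto simp: nth_eq_iff_index_eq)
      then show ?thesis using r by simp
    next
      case False
      then show ?thesis using zero ij by (auto intro!: sum.neutral)
    qed
    finally show "(F * (transpose_mat F * M)) $$ (i, j) = M $$ (i, j)" .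
  qed (use M F in auto)
qed

text \<open>The multiplicity of a root is at least the dimension of its eigenspace.\<close>

lemma eigenspace_matrix_le_order:
  assumes A: "A \<in> carrier_mat n n" and ss: "semisimple_mat A"
    and E: "E \<in> carrier_mat n k" "inj_mat E"
    and eig: "\<And>u. u \<in> carrier_vec k \<Longrightarrow> A *\<^sub>v (E *\<^sub>v u) = \<mu> \<cdot>\<^sub>v (E *\<^sub>v u)"
  shows "k \<le> Polynomial.order \<mu> (char_poly A)"
proof -
  obtain P Q d where PQ: "P \<in> carrier_mat n n" "Q \<in> carrier_mat n n" "P * Q = 1\<^sub>m n" "Q * P = 1\<^sub>m n"
    "A = P * mat_diag n d * Q" and ord: "Polynomial.order \<mu> (char_poly A) = length (filter (\<lambda>i. d i = \<mu>) [0..<n])"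
    using semisimple_diagonalization[OF A ss] by metis
  define xs where "xs = filter (\<lambda>i. d i = \<mu>) [0..<n]"
  define F where "F = Matrix.mat n (length xs) (\<lambda>(i, r). if i = xs ! r then 1 else (0::complex))"
  have xs: "distinct xs" "set xs \<subseteq> {..<n}" by (auto simp: xs_def)
  have F: "F \<in> carrier_mat n (length xs)" by (simp add: F_def)
  obtain C where C: "C \<in> carrier_mat k n" "C * E = 1\<^sub>m k" using inj_mat_left_inverse[OF E] by blast
  have D: "mat_diag n d \<in> carrier_mat n n" by simp
  have AE: "A * E = \<mu> \<cdot>\<^sub>m E"
    using A E eig by (intro mat_eqI_mult_vec[of _ n k]) (auto simp: smult_mat_mult_vec)
  have QA: "Q * A = mat_diag n d * Q"
  proof -
    have "Q * (P * (mat_diag n d * Q)) = (Q * P) * (mat_diag n d * Q)"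
      using PQ(1,2) D by (intro assoc_mult_mat[symmetric, of _ n n _ n _ n] mult_carrier_mat[of _ n n _ n])
    moreover have "A = P * (mat_diag n d * Q)"
      unfolding PQ(5) using PQ(1,2) D by (intro assoc_mult_mat[of _ n n _ n _ n])
    ultimately show ?thesis using PQ(2,4) D by simp
  qed
  have "mat_diag n d * (Q * E) = \<mu> \<cdot>\<^sub>m (Q * E)"
  proof -
    have "mat_diag n d * (Q * E) = (Q * A) * E"
      unfolding QA using PQ(2) D E(1) by (intro assoc_mult_mat[symmetric, of _ n n _ n _ k])
    also have "\<dots> = Q * (A * E)" using PQ(2) A E(1) by (rule assoc_mult_mat)
    also have "\<dots> = \<mu> \<cdot>\<^sub>m (Q * E)" unfolding AE using PQ(2) E(1) by (rule mult_smult_distrib)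
    finally show ?thesis .
  qed
  then have rows: "(d i - \<mu>) * (Q * E) $$ (i, j) = 0" if "i < n" "j < k" for i j
  proof -
    have "(mat_diag n d * (Q * E)) $$ (i, j) = d i * (Q * E) $$ (i, j)"
      using that PQ(2) E(1) by (subst mat_diag_mult_left[of _ n k]) auto
    moreover have "(\<mu> \<cdot>\<^sub>m (Q * E)) $$ (i, j) = \<mu> * (Q * E) $$ (i, j)"
      using that PQ(2) E(1) by auto
    ultimately show ?thesis
      using \<open>mat_diag n d * (Q * E) = \<mu> \<cdot>\<^sub>m (Q * E)\<close> by (auto simp: left_diff_distrib)
  qed
  have QE: "Q * E \<in> carrier_mat n k" using PQ E by simp
  \<comment> \<open>The rows of \<open>Q * E\<close> outside \<open>xs\<close> vanish, so \<open>E\<close> factors through a space of dimension \<open>length xs\<close>.\<close>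
  have sel: "F * (transpose_mat F * (Q * E)) = Q * E"
    unfolding F_def
  proof (rule selection_matrix(2)[OF xs QE])
    fix i j assume "i < n" "i \<notin> set xs" "j < k"
    then show "(Q * E) $$ (i, j) = 0" using rows[of i j] by (auto simp: xs_def)
  qed
  define Y where "Y = transpose_mat F * (Q * E)"
  have Y: "Y \<in> carrier_mat (length xs) k" using F QE by (simp add: Y_def)
  have "(C * P * F) * Y = C * (P * (F * Y))"
    using C(1) PQ(1) F Y by (simp add: assoc_mult_mat[of _ k n _ n] assoc_mult_mat[of _ k n _ "length xs"] assoc_mult_mat[of _ n n _ "length xs"])
  also have "F * Y = Q * E" using sel by (simp add: Y_def)
  also have "P * (Q * E) = E" using assoc_mult_mat[OF PQ(1,2) E(1)] PQ(3) E(1) by simp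
  finally have "(C * P * F) * Y = 1\<^sub>m k" using C by simp
  moreover have "C * P * F \<in> carrier_mat k (length xs)" using C(1) PQ(1) F by simp
  ultimately have "k \<le> length xs" using left_invertible_tall[OF Y] by blast
  then show ?thesis by (simp add: ord xs_def)
qed

text \<open>Conversely, for a diagonalizable matrix the eigenspace is as large as the multiplicity
  of the root, so fewer vectors do not span it.\<close>

lemma order_le_eigenspace_matrix:
  assumes A: "A \<in> carrier_mat n n" and ss: "semisimple_mat A"
    and E: "E \<in> carrier_mat n k" and less: "k < Polynomial.order \<mu> (char_poly A)"
  shows "\<exists>v\<in>carrier_vec n. A *\<^sub>v v = \<mu> \<cdot>\<^sub>v v \<and> (\<forall>u\<in>carrier_vec k. v \<noteq> E *\<^sub>v u)"
proof (rule ccontr)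
  assume contra: "\<not> ?thesis"
  obtain P Q d where PQ: "P \<in> carrier_mat n n" "Q \<in> carrier_mat n n" "P * Q = 1\<^sub>m n" "Q * P = 1\<^sub>m n"
    "A = P * mat_diag n d * Q" and ord: "Polynomial.order \<mu> (char_poly A) = length (filter (\<lambda>i. d i = \<mu>) [0..<n])"
    using semisimple_diagonalization[OF A ss] by metis
  define xs where "xs = filter (\<lambda>i. d i = \<mu>) [0..<n]"
  let ?m = "length xs"
  define F where "F = Matrix.mat n (length xs) (\<lambda>(i, r). if i = xs ! r then 1 else (0::complex))"
  have xs: "distinct xs" "set xs \<subseteq> {..<n}" by (auto simp: xs_def)
  have F: "F \<in> carrier_mat n ?m" by (simp add: F_def)
  have D: "mat_diag n d \<in> carrier_mat n n" by simp
  have FtF: "transpose_mat F * F = 1\<^sub>m ?m" unfolding F_def by (rule selection_matrix(1)[OF xs])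
  have "xs ! r < n \<and> d (xs ! r) = \<mu>" if "r < ?m" for r
    using nth_mem[OF that] by (auto simp: xs_def)
  then have DF: "mat_diag n d * F = \<mu> \<cdot>\<^sub>m F"
    by (subst mat_diag_mult_left[OF F]) (auto simp: F_def intro!: eq_matI)
  have APF: "A * (P * F) = \<mu> \<cdot>\<^sub>m (P * F)"
  proof -
    have "A * P = P * mat_diag n d"
    proof -
      have "P * mat_diag n d \<in> carrier_mat n n" using PQ(1) D by simp
      from assoc_mult_mat[OF this PQ(2,1)] show ?thesis
        unfolding PQ(5) using PQ(1,4) D by simp
    qed
    then have "A * (P * F) = (P * mat_diag n d) * F"
      using assoc_mult_mat[OF A PQ(1) F] by simp
    also have "\<dots> = P * (\<mu> \<cdot>\<^sub>m F)" unfolding DF[symmetric] using PQ(1) D F by (rule assoc_mult_mat)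
    also have "\<dots> = \<mu> \<cdot>\<^sub>m (P * F)" using PQ(1) F by (rule mult_smult_distrib)
    finally show ?thesis .
  qed
  have PF: "P * F \<in> carrier_mat n ?m" using PQ F by simp
  have "\<exists>u\<in>carrier_vec k. (P * F) *\<^sub>v unit_vec ?m r = E *\<^sub>v u" for r
  proof -
    have "A *\<^sub>v ((P * F) *\<^sub>v unit_vec ?m r) = \<mu> \<cdot>\<^sub>v ((P * F) *\<^sub>v unit_vec ?m r)"
      using assoc_mult_mat_vec[OF A PF unit_vec_carrier] smult_mat_mult_vec[OF PF unit_vec_carrier]
      unfolding APF by simp
    moreover have "(P * F) *\<^sub>v unit_vec ?m r \<in> carrier_vec n" using PF by simp
    ultimately show ?thesis using contra by blast
  qed
  then obtain x where x: "\<And>r. x r \<in> carrier_vec k" "\<And>r. (P * F) *\<^sub>v unit_vec ?m r = E *\<^sub>v x r" by metis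
  define X where "X = Matrix.mat k ?m (\<lambda>(i, r). x r $ i)"
  have X: "X \<in> carrier_mat k ?m" by (simp add: X_def)
  \<comment> \<open>If all eigenvectors were in the range of \<open>E\<close>, the \<open>?m\<close> independent columns of \<open>P * F\<close>
    would factor through a space of dimension \<open>k\<close>.\<close>
  have "E * X = P * F"
  proof (rule eq_matI)
    fix i r assume "i < dim_row (P * F)" "r < dim_col (P * F)"
    then have ir: "i < n" "r < ?m" using PF by auto
    have "col X r = x r" using ir x(1)[of r] by (intro eq_vecI) (auto simp: X_def)
    then have "(E * X) $$ (i, r) = (E *\<^sub>v x r) $ i" using E X ir by simp
    also have "\<dots> = ((P * F) *\<^sub>v unit_vec ?m r) $ i" by (simp add: x)
    also have "\<dots> = (P * F) $$ (i, r)"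
      using ir PF carrier_matD[OF PF] by (simp only: index_mult_mat_vec scalar_prod_right_unit index_row(1))
    finally show "(E * X) $$ (i, r) = (P * F) $$ (i, r)" .
  qed (use E X PF in auto)
  have FQ: "transpose_mat F * Q \<in> carrier_mat ?m n" using F PQ(2) by simp
  have "((transpose_mat F * Q) * E) * X = (transpose_mat F * Q) * (P * F)"
    using assoc_mult_mat[OF FQ E X] \<open>E * X = P * F\<close> by simp
  also have "\<dots> = transpose_mat F * (Q * (P * F))"
    using F PQ(2) PF by (intro assoc_mult_mat[of _ ?m n _ n _ ?m]) auto
  also have "\<dots> = transpose_mat F * ((Q * P) * F)" using assoc_mult_mat[OF PQ(2,1) F] by simp
  also have "\<dots> = 1\<^sub>m ?m" using PQ(4) F FtF by simp
  finally have "?m \<le> k"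
    by (rule left_invertible_tall[OF X, rotated]) (use E F PQ(2) in auto)
  then show False using less ord by (simp add: xs_def)
qed

context
  fixes D :: "complex mat" and n :: nat
  assumes D: "D \<in> carrier_mat n n" and ss: "semisimple_mat D"
begin

text \<open>Two independent eigenvectors give a double root, and a third one gives a triple
  root.\<close>

lemma order_ge_2I:
  assumes v: "v\<^sub>1 \<in> carrier_vec n" "v\<^sub>2 \<in> carrier_vec n" "v\<^sub>1 \<noteq> 0\<^sub>v n" "\<And>\<alpha>. v\<^sub>2 \<noteq> \<alpha> \<cdot>\<^sub>v v\<^sub>1"
    and eig: "D *\<^sub>v v\<^sub>1 = \<mu> \<cdot>\<^sub>v v\<^sub>1" "D *\<^sub>v v\<^sub>2 = \<mu> \<cdot>\<^sub>v v\<^sub>2"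
  shows "2 \<le> Polynomial.order \<mu> (char_poly D)"
    and "\<And>v\<^sub>3. v\<^sub>3 \<in> carrier_vec n \<Longrightarrow> D *\<^sub>v v\<^sub>3 = \<mu> \<cdot>\<^sub>v v\<^sub>3 \<Longrightarrow> (\<And>\<alpha> \<beta>. v\<^sub>3 \<noteq> \<alpha> \<cdot>\<^sub>v v\<^sub>1 + \<beta> \<cdot>\<^sub>v v\<^sub>2)
      \<Longrightarrow> 3 \<le> Polynomial.order \<mu> (char_poly D)"
proof -
  let ?E0 = "0\<^sub>m n 0 :: complex mat"
  let ?E1 = "append_col ?E0 v\<^sub>1"
  let ?E2 = "append_col ?E1 v\<^sub>2"
  have E1: "?E1 \<in> carrier_mat n (Suc 0)" by (rule append_col_carrier[OF zero_carrier_mat])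
  have E2: "?E2 \<in> carrier_mat n (Suc (Suc 0))" by (rule append_col_carrier[OF E1])
  note m1 = append_col_empty_mult_vec[OF v(1)]
  have m2: "?E2 *\<^sub>v u = u $ 0 \<cdot>\<^sub>v v\<^sub>1 + u $ 1 \<cdot>\<^sub>v v\<^sub>2" if u: "u \<in> carrier_vec (Suc (Suc 0))" for u
    using append_col_mult_vec[OF E1 v(2) u] m1[of "Matrix.vec (Suc 0) (\<lambda>i. u $ i)"] by simp
  have "?E0 *\<^sub>v u \<noteq> v\<^sub>1" if "u \<in> carrier_vec 0" for u
  proof -
    have "?E0 *\<^sub>v u = 0\<^sub>v n" using that by (intro eq_vecI) (auto simp: scalar_prod_def)
    then show ?thesis using v(3) by simp
  qed
  then have i1: "inj_mat ?E1" by (rule append_col_inj[OF zero_carrier_mat inj_mat_zero_cols v(1)])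
  have i2: "inj_mat ?E2"
    by (rule append_col_inj[OF E1 i1 v(2)]) (use m1 v(4) in metis)
  have lin: "D *\<^sub>v (\<alpha> \<cdot>\<^sub>v v\<^sub>1 + \<beta> \<cdot>\<^sub>v v\<^sub>2) = \<mu> \<cdot>\<^sub>v (\<alpha> \<cdot>\<^sub>v v\<^sub>1 + \<beta> \<cdot>\<^sub>v v\<^sub>2)" for \<alpha> \<beta>
    using mult_add_distrib_mat_vec[OF D, of "\<alpha> \<cdot>\<^sub>v v\<^sub>1" "\<beta> \<cdot>\<^sub>v v\<^sub>2"] mult_mat_vec[OF D v(1), of \<alpha>] mult_mat_vec[OF D v(2), of \<beta>]
      smult_add_distrib_vec[of "\<alpha> \<cdot>\<^sub>v v\<^sub>1" n "\<beta> \<cdot>\<^sub>v v\<^sub>2" \<mu>] v eig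
    by (simp add: smult_smult_assoc mult.commute)
  have "Suc (Suc 0) \<le> Polynomial.order \<mu> (char_poly D)"
    by (rule eigenspace_matrix_le_order[OF D ss E2 i2]) (simp only: m2 lin)
  then show "2 \<le> Polynomial.order \<mu> (char_poly D)" by simp
  fix v\<^sub>3 assume v3: "v\<^sub>3 \<in> carrier_vec n" "D *\<^sub>v v\<^sub>3 = \<mu> \<cdot>\<^sub>v v\<^sub>3" "\<And>\<alpha> \<beta>. v\<^sub>3 \<noteq> \<alpha> \<cdot>\<^sub>v v\<^sub>1 + \<beta> \<cdot>\<^sub>v v\<^sub>2"
  let ?E3 = "append_col ?E2 v\<^sub>3"
  have E3: "?E3 \<in> carrier_mat n (Suc (Suc (Suc 0)))" by (rule append_col_carrier[OF E2])
  have i3: "inj_mat ?E3"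
    by (rule append_col_inj[OF E2 i2 v3(1)]) (use m2 v3(3) in metis)
  have "Suc (Suc (Suc 0)) \<le> Polynomial.order \<mu> (char_poly D)"
  proof (rule eigenspace_matrix_le_order[OF D ss E3 i3])
    fix u :: "complex Matrix.vec" assume u: "u \<in> carrier_vec (Suc (Suc (Suc 0)))"
    define z where "z = u $ 0 \<cdot>\<^sub>v v\<^sub>1 + u $ 1 \<cdot>\<^sub>v v\<^sub>2"
    have z: "z \<in> carrier_vec n" using v by (simp add: z_def)
    have Dz: "D *\<^sub>v z = \<mu> \<cdot>\<^sub>v z" unfolding z_def by (rule lin)
    have m3: "?E3 *\<^sub>v u = z + u $ Suc (Suc 0) \<cdot>\<^sub>v v\<^sub>3"
      using append_col_mult_vec[OF E2 v3(1) u] m2[of "Matrix.vec (Suc (Suc 0)) (\<lambda>i. u $ i)"] by (simp add: z_def)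
    show "D *\<^sub>v (?E3 *\<^sub>v u) = \<mu> \<cdot>\<^sub>v (?E3 *\<^sub>v u)"
      unfolding m3 using mult_add_distrib_mat_vec[OF D z, of "u $ Suc (Suc 0) \<cdot>\<^sub>v v\<^sub>3"]
        mult_mat_vec[OF D v3(1), of "u $ Suc (Suc 0)"] smult_add_distrib_vec[OF z, of "u $ Suc (Suc 0) \<cdot>\<^sub>v v\<^sub>3" \<mu>] v3 Dz
      by (simp add: smult_smult_assoc mult.commute)
  qed
  then show "3 \<le> Polynomial.order \<mu> (char_poly D)" by simp
qed

lemma order_ge_2D:
  assumes "2 \<le> Polynomial.order \<mu> (char_poly D)" and v: "v\<^sub>1 \<in> carrier_vec n"
  shows "\<exists>v\<in>carrier_vec n. D *\<^sub>v v = \<mu> \<cdot>\<^sub>v v \<and> (\<forall>\<alpha>. v \<noteq> \<alpha> \<cdot>\<^sub>v v\<^sub>1)"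
proof -
  let ?E1 = "append_col (0\<^sub>m n 0) v\<^sub>1"
  have E1: "?E1 \<in> carrier_mat n (Suc 0)" by (rule append_col_carrier[OF zero_carrier_mat])
  have "Suc 0 < Polynomial.order \<mu> (char_poly D)" using assms(1) by simp
  from order_le_eigenspace_matrix[OF D ss E1 this]
  obtain w where w: "w \<in> carrier_vec n" "D *\<^sub>v w = \<mu> \<cdot>\<^sub>v w" and ne: "\<And>u. u \<in> carrier_vec (Suc 0) \<Longrightarrow> w \<noteq> ?E1 *\<^sub>v u"
    by blast
  have "w \<noteq> \<alpha> \<cdot>\<^sub>v v\<^sub>1" for \<alpha>
    using ne[of "Matrix.vec (Suc 0) (\<lambda>_. \<alpha>)"] append_col_empty_mult_vec[OF v, of "Matrix.vec (Suc 0) (\<lambda>_. \<alpha>)"] by simp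
  then show ?thesis using w by blast
qed

lemma order_ge_3D:
  assumes "3 \<le> Polynomial.order \<mu> (char_poly D)" and v: "v\<^sub>1 \<in> carrier_vec n" "v\<^sub>2 \<in> carrier_vec n"
  shows "\<exists>v\<in>carrier_vec n. D *\<^sub>v v = \<mu> \<cdot>\<^sub>v v \<and> (\<forall>\<alpha> \<beta>. v \<noteq> \<alpha> \<cdot>\<^sub>v v\<^sub>1 + \<beta> \<cdot>\<^sub>v v\<^sub>2)"
proof -
  let ?E1 = "append_col (0\<^sub>m n 0) v\<^sub>1"
  let ?E2 = "append_col ?E1 v\<^sub>2"
  have E1: "?E1 \<in> carrier_mat n (Suc 0)" by (rule append_col_carrier[OF zero_carrier_mat])
  have E2: "?E2 \<in> carrier_mat n (Suc (Suc 0))" by (rule append_col_carrier[OF E1])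
  have "Suc (Suc 0) < Polynomial.order \<mu> (char_poly D)" using assms(1) by simp
  from order_le_eigenspace_matrix[OF D ss E2 this]
  obtain w where w: "w \<in> carrier_vec n" "D *\<^sub>v w = \<mu> \<cdot>\<^sub>v w" and ne: "\<And>u. u \<in> carrier_vec (Suc (Suc 0)) \<Longrightarrow> w \<noteq> ?E2 *\<^sub>v u"
    by blast
  have "w \<noteq> \<alpha> \<cdot>\<^sub>v v\<^sub>1 + \<beta> \<cdot>\<^sub>v v\<^sub>2" for \<alpha> \<beta>
  proof -
    let ?u = "Matrix.vec (Suc (Suc 0)) (\<lambda>i. if i = 0 then \<alpha> else \<beta>)"
    have "?E2 *\<^sub>v ?u = \<alpha> \<cdot>\<^sub>v v\<^sub>1 + \<beta> \<cdot>\<^sub>v v\<^sub>2"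
      using append_col_mult_vec[OF E1 v(2), of ?u] append_col_empty_mult_vec[OF v(1), of "Matrix.vec (Suc 0) (\<lambda>i. ?u $ i)"]
      by simp
    then show ?thesis using ne[of ?u] by simp
  qed
  then show ?thesis using w by blast
qed

end

section \<open>Matrix representations and Schur's lemma\<close>

text \<open>The same notion as a homomorphism to \<open>GL n\<close> (see
  \<open>hom_GL_iff\<close>), with the invertibility of the matrices left implicit.\<close>

definition matrix_rep :: "('g, 'm) monoid_scheme \<Rightarrow> nat \<Rightarrow> ('g \<Rightarrow> complex mat) \<Rightarrow> bool" where
  "matrix_rep G n \<rho> \<longleftrightarrow> (\<forall>g\<in>carrier G. \<rho> g \<in> carrier_mat n n) \<and>
     (\<forall>g\<in>carrier G. \<forall>h\<in>carrier G. \<rho> (g \<otimes>\<^bsub>G\<^esub> h) = \<rho> g * \<rho> h) \<and> \<rho> \<one>\<^bsub>G\<^esub> = 1\<^sub>m n"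

definition invariant_subspace ::
  "('g, 'm) monoid_scheme \<Rightarrow> nat \<Rightarrow> ('g \<Rightarrow> complex mat) \<Rightarrow> complex Matrix.vec set \<Rightarrow> bool" where
  "invariant_subspace G n \<rho> W \<longleftrightarrow> W \<subseteq> carrier_vec n \<and> 0\<^sub>v n \<in> W \<and>
     (\<forall>u\<in>W. \<forall>v\<in>W. u + v \<in> W) \<and> (\<forall>c. \<forall>v\<in>W. c \<cdot>\<^sub>v v \<in> W) \<and>
     (\<forall>g\<in>carrier G. \<forall>v\<in>W. \<rho> g *\<^sub>v v \<in> W)"

lemma subspace_iff:
  fixes M :: "('k::field, 'v, 'n) module_scheme"
  assumes "vectorspace class_ring M"
  shows "VectorSpace.subspace class_ring U M \<longleftrightarrow> U \<subseteq> carrier M \<and> \<zero>\<^bsub>M\<^esub> \<in> U \<and>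
    (\<forall>u\<in>U. \<forall>v\<in>U. u \<oplus>\<^bsub>M\<^esub> v \<in> U) \<and> (\<forall>c. \<forall>v\<in>U. c \<odot>\<^bsub>M\<^esub> v \<in> U)"
proof -
  have "Module.module class_ring M" using assms by (simp add: vectorspace_def)
  then show ?thesis
    using assms by (auto simp: VectorSpace.subspace_def submodule_def class_ring_simps)
qed

lemma carrier_GL_iff:
  "A \<in> carrier (GL n) \<longleftrightarrow> A \<in> carrier_mat n n \<and> (\<exists>B\<in>carrier_mat n n. B * A = 1\<^sub>m n \<and> A * B = 1\<^sub>m n)"
  by (auto simp: GL_def units_of_def Units_def ring_mat_def)

lemma square_inj_mat_GL:
  assumes A: "A \<in> carrier_mat n n" and inj: "inj_mat A"
  shows "A \<in> carrier (GL n)"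
proof -
  obtain C where "C \<in> carrier_mat n n" "C * A = 1\<^sub>m n" using inj_mat_left_inverse[OF A inj] by blast
  with mat_mult_left_right_inverse[OF this(1) A this(2)] show ?thesis using A unfolding carrier_GL_iff by blast
qed

locale finite_group = group G for G (structure) +
  assumes fin: "finite (carrier G)"

context finite_group
begin

text \<open>The image of \<open>\<one>\<close> under a homomorphism is an invertible idempotent
  matrix, hence the identity.\<close>

lemma hom_GL_iff: "\<rho> \<in> hom G (GL n) \<longleftrightarrow> matrix_rep G n \<rho>"
proof
  assume hom: "\<rho> \<in> hom G (GL n)"
  have car: "\<rho> g \<in> carrier (GL n)" if "g \<in> carrier G" for g using hom that by (auto simp: hom_def)
  have mult: "\<rho> (g \<otimes> h) = \<rho> g * \<rho> h" if "g \<in> carrier G" "h \<in> carrier G" for g h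
    using hom that by (auto simp: hom_def GL_def units_of_def ring_mat_def)
  obtain B where B: "B \<in> carrier_mat n n" "B * \<rho> \<one> = 1\<^sub>m n" "\<rho> \<one> \<in> carrier_mat n n"
    using car[OF one_closed] by (auto simp: carrier_GL_iff)
  have "\<rho> \<one> = (B * \<rho> \<one>) * \<rho> \<one>" using B by simp
  also have "\<dots> = B * (\<rho> \<one> * \<rho> \<one>)" using B by (intro assoc_mult_mat[of _ n n _ n _ n])
  also have "\<rho> \<one> * \<rho> \<one> = \<rho> \<one>" using mult[OF one_closed one_closed] by simp
  finally have "\<rho> \<one> = 1\<^sub>m n" using B by simp
  then show "matrix_rep G n \<rho>" using car mult by (auto simp: matrix_rep_def carrier_GL_iff)
next
  assume rep: "matrix_rep G n \<rho>"
  have "\<rho> g \<in> carrier (GL n)" if g: "g \<in> carrier G" for g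
  proof -
    have "\<rho> (inv g) * \<rho> g = 1\<^sub>m n" "\<rho> g * \<rho> (inv g) = 1\<^sub>m n"
      using rep g l_inv[OF g] r_inv[OF g] inv_closed[OF g] unfolding matrix_rep_def by metis+
    moreover have "\<rho> g \<in> carrier_mat n n" "\<rho> (inv g) \<in> carrier_mat n n"
      using rep g inv_closed[OF g] unfolding matrix_rep_def by blast+
    ultimately show ?thesis unfolding carrier_GL_iff by blast
  qed
  then show "\<rho> \<in> hom G (GL n)"
    using rep by (auto simp: hom_def matrix_rep_def GL_def units_of_def ring_mat_def)
qed

lemma complex_irrep_iff:
  "complex_irrep G n \<rho> \<longleftrightarrow> matrix_rep G n \<rho> \<and> 0 < n \<and>
     (\<forall>W. invariant_subspace G n \<rho> W \<longrightarrow> W = {0\<^sub>v n} \<or> W = carrier_vec n)"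
proof -
  have sub: "subrep class_ring (module_vec TYPE(complex) n) G (\<lambda>g v. \<rho> g *\<^sub>v v) W \<longleftrightarrow> invariant_subspace G n \<rho> W" for W
    unfolding subrep_def subspace_iff[OF vec_vs] invariant_subspace_def by (auto simp: module_vec_simps)
  have "carrier_vec n \<noteq> {0\<^sub>v n :: complex Matrix.vec} \<longleftrightarrow> 0 < n"
  proof (cases n)
    case (Suc m)
    then have "(unit_vec n 0 :: complex Matrix.vec) $ 0 \<noteq> 0\<^sub>v n $ 0" by simp
    then have "unit_vec n 0 \<noteq> (0\<^sub>v n :: complex Matrix.vec)" by auto
    then have "carrier_vec n \<noteq> {0\<^sub>v n :: complex Matrix.vec}" using unit_vec_carrier[of n 0] by blast
    with Suc show ?thesis by simp
  next
    case 0
    have "v = 0\<^sub>v n" if "v \<in> carrier_vec n" for v :: "complex Matrix.vec"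
      using that 0 by (intro eq_vecI) auto
    then have "carrier_vec n = {0\<^sub>v n :: complex Matrix.vec}" using zero_carrier_vec by blast
    then show ?thesis using 0 by simp
  qed
  moreover have "invariant_subspace G n \<rho> (carrier_vec n)" if "matrix_rep G n \<rho>"
    using that by (auto simp: invariant_subspace_def matrix_rep_def)
  moreover have "W \<subseteq> carrier_vec n" if "invariant_subspace G n \<rho> W" for W
    using that by (simp add: invariant_subspace_def)
  ultimately show ?thesis
    unfolding complex_irrep_def irreducible_subrep_def hom_GL_iff sub
    unfolding module_vec_simps by blast
qed

lemma rep_carrier: "matrix_rep G n \<rho> \<Longrightarrow> g \<in> carrier G \<Longrightarrow> \<rho> g \<in> carrier_mat n n"
  by (simp add: matrix_rep_def)

lemma rep_mult: "matrix_rep G n \<rho> \<Longrightarrow> g \<in> carrier G \<Longrightarrow> h \<in> carrier G \<Longrightarrow> \<rho> (g \<otimes> h) = \<rho> g * \<rho> h"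
  by (simp add: matrix_rep_def)

lemma rep_one: "matrix_rep G n \<rho> \<Longrightarrow> \<rho> \<one> = 1\<^sub>m n"
  by (simp add: matrix_rep_def)

lemma rep_vec: "matrix_rep G n \<rho> \<Longrightarrow> g \<in> carrier G \<Longrightarrow> v \<in> carrier_vec n \<Longrightarrow> \<rho> g *\<^sub>v v \<in> carrier_vec n"
  by (rule mult_mat_vec_carrier[OF rep_carrier])

lemma rep_mult_vec:
  assumes "matrix_rep G n \<rho>" "g \<in> carrier G" "h \<in> carrier G" "v \<in> carrier_vec n"
  shows "\<rho> (g \<otimes> h) *\<^sub>v v = \<rho> g *\<^sub>v (\<rho> h *\<^sub>v v)"
  using assms by (simp add: rep_mult assoc_mult_mat_vec[of _ n n _ n] rep_carrier)

lemma rep_inv: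
  assumes "matrix_rep G n \<rho>" "g \<in> carrier G"
  shows "\<rho> g * \<rho> (inv g) = 1\<^sub>m n" "\<rho> (inv g) * \<rho> g = 1\<^sub>m n"
  using assms rep_mult[of n \<rho> g "inv g"] rep_mult[of n \<rho> "inv g" g] by (simp_all add: rep_one)

definition intertwiner :: "nat \<Rightarrow> ('a \<Rightarrow> complex mat) \<Rightarrow> nat \<Rightarrow> ('a \<Rightarrow> complex mat) \<Rightarrow> complex mat \<Rightarrow> bool" where
  "intertwiner n \<rho> m \<sigma> T \<longleftrightarrow> T \<in> carrier_mat m n \<and> (\<forall>g\<in>carrier G. T * \<rho> g = \<sigma> g * T)"

lemma intertwiner_mult_vec:
  assumes T: "intertwiner n \<rho> m \<sigma> T" and rep: "matrix_rep G n \<rho>" "matrix_rep G m \<sigma>"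
    and g: "g \<in> carrier G" and v: "v \<in> carrier_vec n"
  shows "T *\<^sub>v (\<rho> g *\<^sub>v v) = \<sigma> g *\<^sub>v (T *\<^sub>v v)"
proof -
  have Tc: "T \<in> carrier_mat m n" using T by (simp add: intertwiner_def)
  have "T *\<^sub>v (\<rho> g *\<^sub>v v) = (T * \<rho> g) *\<^sub>v v" using Tc rep_carrier[OF rep(1) g] v by (rule assoc_mult_mat_vec[symmetric])
  also have "T * \<rho> g = \<sigma> g * T" using T g by (simp add: intertwiner_def)
  also have "\<dots> *\<^sub>v v = \<sigma> g *\<^sub>v (T *\<^sub>v v)" using rep_carrier[OF rep(2) g] Tc v by (rule assoc_mult_mat_vec)
  finally show ?thesis .
qed

lemma intertwiner_kernel_invariant:
  assumes T: "intertwiner n \<rho> m \<sigma> T" and rep: "matrix_rep G n \<rho>" "matrix_rep G m \<sigma>"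
  shows "invariant_subspace G n \<rho> {u \<in> carrier_vec n. T *\<^sub>v u = 0\<^sub>v m}"
proof -
  have Tc: "T \<in> carrier_mat m n" using T by (simp add: intertwiner_def)
  show ?thesis
    unfolding invariant_subspace_def
  proof (intro conjI ballI allI)
    show "0\<^sub>v n \<in> {u \<in> carrier_vec n. T *\<^sub>v u = 0\<^sub>v m}" using Tc by (auto intro!: eq_vecI)
    fix u w assume "u \<in> {u \<in> carrier_vec n. T *\<^sub>v u = 0\<^sub>v m}" "w \<in> {u \<in> carrier_vec n. T *\<^sub>v u = 0\<^sub>v m}"
    then show "u + w \<in> {u \<in> carrier_vec n. T *\<^sub>v u = 0\<^sub>v m}"
      using mult_add_distrib_mat_vec[OF Tc, of u w] by auto
  next
    fix d u assume "u \<in> {u \<in> carrier_vec n. T *\<^sub>v u = 0\<^sub>v m}"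
    then show "d \<cdot>\<^sub>v u \<in> {u \<in> carrier_vec n. T *\<^sub>v u = 0\<^sub>v m}"
      using mult_mat_vec[OF Tc, of u d] by auto
  next
    fix g u assume g: "g \<in> carrier G" and "u \<in> {u \<in> carrier_vec n. T *\<^sub>v u = 0\<^sub>v m}"
    then have u: "u \<in> carrier_vec n" "T *\<^sub>v u = 0\<^sub>v m" by auto
    have "T *\<^sub>v (\<rho> g *\<^sub>v u) = \<sigma> g *\<^sub>v 0\<^sub>v m" using intertwiner_mult_vec[OF T rep g u(1)] u(2) by simp
    also have "\<dots> = 0\<^sub>v m" using rep_carrier[OF rep(2) g] by (auto intro!: eq_vecI)
    finally show "\<rho> g *\<^sub>v u \<in> {u \<in> carrier_vec n. T *\<^sub>v u = 0\<^sub>v m}"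
      using rep_carrier[OF rep(1) g] u(1) by simp
  qed auto
qed

text \<open>Schur's lemma: kernel and range of an intertwiner are invariant subspaces.\<close>

lemma nonzero_intertwiner_iso:
  assumes irr: "complex_irrep G n \<rho>" "complex_irrep G m \<sigma>"
    and T: "intertwiner n \<rho> m \<sigma> T" and nz: "T \<noteq> 0\<^sub>m m n"
  shows "m = n" "T \<in> carrier (GL n)" "rep_iso G n \<rho> m \<sigma>"
proof -
  have rep: "matrix_rep G n \<rho>" "matrix_rep G m \<sigma>" using irr by (simp_all add: complex_irrep_iff)
  have Tc: "T \<in> carrier_mat m n" using T by (simp add: intertwiner_def)
  have nz': "\<exists>u\<in>carrier_vec n. T *\<^sub>v u \<noteq> 0\<^sub>v m"
  proof (rule ccontr)
    assume "\<not> ?thesis"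
    then have "T = 0\<^sub>m m n" using Tc by (intro mat_eqI_mult_vec[of _ m n]) auto
    then show False using nz by simp
  qed
  have "invariant_subspace G n \<rho> {u \<in> carrier_vec n. T *\<^sub>v u = 0\<^sub>v m}"
    by (rule intertwiner_kernel_invariant[OF T rep])
  then have "{u \<in> carrier_vec n. T *\<^sub>v u = 0\<^sub>v m} = {0\<^sub>v n}"
    using irr(1) nz' unfolding complex_irrep_iff by blast
  then have inj: "inj_mat T" using Tc by (auto simp: inj_mat_def)
  have "invariant_subspace G m \<sigma> ((\<lambda>u. T *\<^sub>v u) ` carrier_vec n)"
    unfolding invariant_subspace_def
  proof (intro conjI ballI allI)
    show "(\<lambda>u. T *\<^sub>v u) ` carrier_vec n \<subseteq> carrier_vec m" using Tc by auto
    show "0\<^sub>v m \<in> (\<lambda>u. T *\<^sub>v u) ` carrier_vec n"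
      using Tc by (intro image_eqI[of _ _ "0\<^sub>v n"]) (auto intro!: eq_vecI)
  next
    fix x y assume "x \<in> (\<lambda>u. T *\<^sub>v u) ` carrier_vec n" "y \<in> (\<lambda>u. T *\<^sub>v u) ` carrier_vec n"
    then obtain u v where "u \<in> carrier_vec n" "v \<in> carrier_vec n" "x = T *\<^sub>v u" "y = T *\<^sub>v v" by auto
    then show "x + y \<in> (\<lambda>u. T *\<^sub>v u) ` carrier_vec n"
      using mult_add_distrib_mat_vec[OF Tc, of u v] by (intro image_eqI[of _ _ "u + v"]) auto
  next
    fix c x assume "x \<in> (\<lambda>u. T *\<^sub>v u) ` carrier_vec n"
    then obtain u where "u \<in> carrier_vec n" "x = T *\<^sub>v u" by auto
    then show "c \<cdot>\<^sub>v x \<in> (\<lambda>u. T *\<^sub>v u) ` carrier_vec n"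
      using mult_mat_vec[OF Tc, of u c] by (intro image_eqI[of _ _ "c \<cdot>\<^sub>v u"]) auto
  next
    fix g x assume g: "g \<in> carrier G" and "x \<in> (\<lambda>u. T *\<^sub>v u) ` carrier_vec n"
    then obtain u where "u \<in> carrier_vec n" "x = T *\<^sub>v u" by auto
    then show "\<sigma> g *\<^sub>v x \<in> (\<lambda>u. T *\<^sub>v u) ` carrier_vec n"
      using intertwiner_mult_vec[OF T rep g, of u] rep_carrier[OF rep(1) g]
      by (intro image_eqI[of _ _ "\<rho> g *\<^sub>v u"]) auto
  qed
  moreover have "(\<lambda>u. T *\<^sub>v u) ` carrier_vec n \<noteq> {0\<^sub>v m}" using nz' by auto
  ultimately have "(\<lambda>u. T *\<^sub>v u) ` carrier_vec n = carrier_vec m"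
    using irr(2) unfolding complex_irrep_iff by blast
  then have surj: "\<exists>u\<in>carrier_vec n. v = T *\<^sub>v u" if "v \<in> carrier_vec m" for v using that by auto
  show mn: "m = n" by (rule bijective_matrix_inverse(1)[OF Tc inj surj])
  obtain T' where "T' \<in> carrier_mat n n" "T' * T = 1\<^sub>m n" "T * T' = 1\<^sub>m n"
    using bijective_matrix_inverse(2)[OF Tc inj surj] by blast
  then show "T \<in> carrier (GL n)" using Tc unfolding carrier_GL_iff mn by blast
  then show "rep_iso G n \<rho> m \<sigma>" using T unfolding rep_iso_def intertwiner_def mn by blast
qed

text \<open>Schur's lemma over the complex numbers, where every intertwiner has an
  eigenvalue.\<close>

lemma intertwiner_scalar:
  assumes irr: "complex_irrep G n \<rho>" and T: "intertwiner n \<rho> n \<rho> T"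
  shows "\<exists>c. T = c \<cdot>\<^sub>m 1\<^sub>m n"
proof -
  have rep: "matrix_rep G n \<rho>" and n: "n > 0" using irr by (simp_all add: complex_irrep_iff)
  have Tc: "T \<in> carrier_mat n n" using T by (simp add: intertwiner_def)
  obtain c where "eigenvalue T c" using spectrum_non_empty[OF Tc n] by (auto simp: spectrum_def)
  then obtain v where v: "v \<in> carrier_vec n" "v \<noteq> 0\<^sub>v n" "T *\<^sub>v v = c \<cdot>\<^sub>v v"
    using Tc by (auto simp: eigenvalue_def eigenvector_def)
  let ?W = "{u \<in> carrier_vec n. T *\<^sub>v u = c \<cdot>\<^sub>v u}"
  \<comment> \<open>An eigenspace of an intertwiner is invariant.\<close>
  have "invariant_subspace G n \<rho> ?W"
    unfolding invariant_subspace_def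
  proof (intro conjI ballI allI)
    show "0\<^sub>v n \<in> ?W" using Tc by (auto intro!: eq_vecI)
    fix u w assume "u \<in> ?W" "w \<in> ?W"
    then show "u + w \<in> ?W" using mult_add_distrib_mat_vec[OF Tc, of u w] smult_add_distrib_vec[of u n w c] by auto
  next
    fix d u assume "u \<in> ?W"
    then show "d \<cdot>\<^sub>v u \<in> ?W" using mult_mat_vec[OF Tc, of u d] by (auto simp: smult_smult_assoc mult.commute)
  next
    fix g u assume g: "g \<in> carrier G" and "u \<in> ?W"
    then have u: "u \<in> carrier_vec n" "T *\<^sub>v u = c \<cdot>\<^sub>v u" by auto
    have "T *\<^sub>v (\<rho> g *\<^sub>v u) = \<rho> g *\<^sub>v (c \<cdot>\<^sub>v u)" using intertwiner_mult_vec[OF T rep rep g u(1)] u(2) by simp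
    also have "\<dots> = c \<cdot>\<^sub>v (\<rho> g *\<^sub>v u)" using rep_carrier[OF rep g] u(1) by (rule mult_mat_vec)
    finally show "\<rho> g *\<^sub>v u \<in> ?W" using rep_carrier[OF rep g] u(1) by simp
  qed auto
  then have "?W = carrier_vec n" using irr v unfolding complex_irrep_iff by blast
  then have "T *\<^sub>v u = (c \<cdot>\<^sub>m 1\<^sub>m n) *\<^sub>v u" if "u \<in> carrier_vec n" for u
  proof -
    have "T *\<^sub>v u = c \<cdot>\<^sub>v u" using that \<open>?W = carrier_vec n\<close> by blast
    then show ?thesis using smult_mat_mult_vec[OF one_carrier_mat that, of c] that by simp
  qed
  then show ?thesis using Tc by (intro exI[of _ c] mat_eqI_mult_vec[of _ n n]) auto
qed

lemma rep_iso_sym: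
  assumes rep: "matrix_rep G n \<rho>" "matrix_rep G m \<sigma>" and iso: "rep_iso G n \<rho> m \<sigma>"
  shows "rep_iso G m \<sigma> n \<rho>"
proof -
  have nm: "n = m" using iso by (simp add: rep_iso_def)
  obtain T where T: "T \<in> carrier (GL n)" and eq: "\<And>g. g \<in> carrier G \<Longrightarrow> T * \<rho> g = \<sigma> g * T"
    using iso by (auto simp: rep_iso_def)
  obtain U where U: "U \<in> carrier_mat n n" "U * T = 1\<^sub>m n" "T * U = 1\<^sub>m n" and Tc: "T \<in> carrier_mat n n"
    using T by (auto simp: carrier_GL_iff)
  have "U * \<sigma> g = \<rho> g * U" if g: "g \<in> carrier G" for g
  proof -
    have r: "\<rho> g \<in> carrier_mat n n" and s: "\<sigma> g \<in> carrier_mat n n"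
      using rep_carrier[OF rep(1) g] rep_carrier[OF rep(2) g] nm by auto
    have "\<rho> g * U = (U * T) * (\<rho> g * U)" using U(1,2) r by simp
    also have "\<dots> = U * (T * (\<rho> g * U))" using U(1) Tc mult_carrier_mat[OF r U(1)] by (rule assoc_mult_mat)
    also have "T * (\<rho> g * U) = (T * \<rho> g) * U" using Tc r U(1) by (rule assoc_mult_mat[symmetric])
    also have "\<dots> = \<sigma> g * (T * U)" unfolding eq[OF g] using s Tc U(1) by (rule assoc_mult_mat)
    also have "\<dots> = \<sigma> g" using U(3) s by simp
    finally show ?thesis by simp
  qed
  moreover have "U \<in> carrier (GL n)" using U Tc unfolding carrier_GL_iff by blast
  ultimately show ?thesis unfolding rep_iso_def using nm by blast
qed

lemma rep_iso_trans:
  assumes rep: "matrix_rep G n \<rho>" "matrix_rep G m \<sigma>" "matrix_rep G k \<tau>"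
    and iso: "rep_iso G n \<rho> m \<sigma>" "rep_iso G m \<sigma> k \<tau>"
  shows "rep_iso G n \<rho> k \<tau>"
proof -
  have nm: "n = m" "m = k" using iso by (simp_all add: rep_iso_def)
  obtain T where T: "T \<in> carrier (GL n)" and eqT: "\<And>g. g \<in> carrier G \<Longrightarrow> T * \<rho> g = \<sigma> g * T"
    using iso(1) by (auto simp: rep_iso_def)
  obtain U where U: "U \<in> carrier (GL n)" and eqU: "\<And>g. g \<in> carrier G \<Longrightarrow> U * \<sigma> g = \<tau> g * U"
    using iso(2) nm by (auto simp: rep_iso_def)
  have c: "T \<in> carrier_mat n n" "U \<in> carrier_mat n n" using T U by (auto simp: carrier_GL_iff)
  have "(U * T) * \<rho> g = \<tau> g * (U * T)" if g: "g \<in> carrier G" for g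
  proof -
    have r: "\<rho> g \<in> carrier_mat n n" "\<sigma> g \<in> carrier_mat n n" "\<tau> g \<in> carrier_mat n n"
      using rep_carrier[OF rep(1) g] rep_carrier[OF rep(2) g] rep_carrier[OF rep(3) g] nm by auto
    have "(U * T) * \<rho> g = U * (\<sigma> g * T)"
      using assoc_mult_mat[OF c(2,1) r(1)] eqT[OF g] by simp
    also have "\<dots> = (U * \<sigma> g) * T" using c(2) r(2) c(1) by (rule assoc_mult_mat[symmetric])
    also have "\<dots> = \<tau> g * (U * T)" unfolding eqU[OF g] using r(3) c(2,1) by (rule assoc_mult_mat)
    finally show ?thesis .
  qed
  moreover have "U * T \<in> carrier (GL n)"
  proof -
    have "monoid (ring_mat TYPE(complex) n ())" using ring_mat by (metis ring.is_monoid)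
    then have "group (GL n)" unfolding GL_def by (rule monoid.units_group)
    then have "U \<otimes>\<^bsub>GL n\<^esub> T \<in> carrier (GL n)" using U T by (metis group.is_monoid monoid.m_closed)
    then show ?thesis by (simp add: GL_def units_of_def ring_mat_def)
  qed
  ultimately show ?thesis unfolding rep_iso_def using nm by blast
qed

end

section \<open>Matrix coefficients and orthogonality\<close>

definition mat_sum :: "nat \<Rightarrow> nat \<Rightarrow> ('g \<Rightarrow> complex mat) \<Rightarrow> 'g set \<Rightarrow> complex mat" where
  "mat_sum n m f A = Matrix.mat n m (\<lambda>(i, j). \<Sum>g\<in>A. f g $$ (i, j))"

lemma mat_sum_carrier [simp]: "mat_sum n m f A \<in> carrier_mat n m"
  by (simp add: mat_sum_def)

lemma mat_sum_cong: "(\<And>g. g \<in> A \<Longrightarrow> f g = h g) \<Longrightarrow> mat_sum n m f A = mat_sum n m h A"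
  by (simp add: mat_sum_def)

lemma mult_mat_sum:
  assumes "M \<in> carrier_mat k n" and f: "\<And>g. g \<in> A \<Longrightarrow> f g \<in> carrier_mat n m"
  shows "M * mat_sum n m f A = mat_sum k m (\<lambda>g. M * f g) A"
proof (rule eq_matI)
  fix i j assume "i < dim_row (mat_sum k m (\<lambda>g. M * f g) A)" "j < dim_col (mat_sum k m (\<lambda>g. M * f g) A)"
  then have ij: "i < k" "j < m" by (simp_all add: mat_sum_def)
  have "(M * mat_sum n m f A) $$ (i, j) = (\<Sum>l<n. M $$ (i, l) * (\<Sum>g\<in>A. f g $$ (l, j)))"
    using ij assms(1) by (simp add: mat_sum_def scalar_prod_def lessThan_atLeast0)
  also have "\<dots> = (\<Sum>g\<in>A. \<Sum>l<n. M $$ (i, l) * f g $$ (l, j))"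
    unfolding sum_distrib_left by (rule sum.swap)
  also have "\<dots> = (\<Sum>g\<in>A. (M * f g) $$ (i, j))"
  proof (rule sum.cong[OF refl])
    fix g assume "g \<in> A"
    then show "(\<Sum>l<n. M $$ (i, l) * f g $$ (l, j)) = (M * f g) $$ (i, j)"
      using ij assms(1) f[of g] by (simp add: scalar_prod_def lessThan_atLeast0)
  qed
  finally show "(M * mat_sum n m f A) $$ (i, j) = mat_sum k m (\<lambda>g. M * f g) A $$ (i, j)"
    using ij by (simp add: mat_sum_def)
qed (use assms in \<open>auto simp: mat_sum_def\<close>)

lemma mat_sum_mult:
  assumes "M \<in> carrier_mat m k" and f: "\<And>g. g \<in> A \<Longrightarrow> f g \<in> carrier_mat n m"
  shows "mat_sum n m f A * M = mat_sum n k (\<lambda>g. f g * M) A"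
proof (rule eq_matI)
  fix i j assume "i < dim_row (mat_sum n k (\<lambda>g. f g * M) A)" "j < dim_col (mat_sum n k (\<lambda>g. f g * M) A)"
  then have ij: "i < n" "j < k" by (simp_all add: mat_sum_def)
  have "(mat_sum n m f A * M) $$ (i, j) = (\<Sum>l<m. (\<Sum>g\<in>A. f g $$ (i, l)) * M $$ (l, j))"
    using ij assms(1) by (simp add: mat_sum_def scalar_prod_def lessThan_atLeast0)
  also have "\<dots> = (\<Sum>g\<in>A. \<Sum>l<m. f g $$ (i, l) * M $$ (l, j))"
    unfolding sum_distrib_right by (rule sum.swap)
  also have "\<dots> = (\<Sum>g\<in>A. (f g * M) $$ (i, j))"
  proof (rule sum.cong[OF refl])
    fix g assume "g \<in> A"
    then show "(\<Sum>l<m. f g $$ (i, l) * M $$ (l, j)) = (f g * M) $$ (i, j)"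
      using ij assms(1) f[of g] by (simp add: scalar_prod_def lessThan_atLeast0)
  qed
  finally show "(mat_sum n m f A * M) $$ (i, j) = mat_sum n k (\<lambda>g. f g * M) A $$ (i, j)"
    using ij by (simp add: mat_sum_def)
qed (use assms in \<open>auto simp: mat_sum_def\<close>)

lemma scalar_prod_mat_sum:
  assumes "a \<in> carrier_vec n" "v \<in> carrier_vec m" and f: "\<And>g. g \<in> A \<Longrightarrow> f g \<in> carrier_mat n m"
  shows "a \<bullet> (mat_sum n m f A *\<^sub>v v) = (\<Sum>g\<in>A. a \<bullet> (f g *\<^sub>v v))"
proof -
  have "a \<bullet> (mat_sum n m f A *\<^sub>v v) = (\<Sum>i<n. a $ i * (\<Sum>l<m. (\<Sum>g\<in>A. f g $$ (i, l)) * v $ l))"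
    using assms(1,2) by (simp add: mat_sum_def scalar_prod_def lessThan_atLeast0)
  also have "\<dots> = (\<Sum>i<n. \<Sum>g\<in>A. a $ i * (\<Sum>l<m. f g $$ (i, l) * v $ l))"
    unfolding sum_distrib_right sum_distrib_left by (rule sum.cong[OF refl], rule sum.swap)
  also have "\<dots> = (\<Sum>g\<in>A. \<Sum>i<n. a $ i * (\<Sum>l<m. f g $$ (i, l) * v $ l))"
    by (rule sum.swap)
  also have "\<dots> = (\<Sum>g\<in>A. a \<bullet> (f g *\<^sub>v v))"
  proof (rule sum.cong[OF refl])
    fix g assume "g \<in> A"
    then show "(\<Sum>i<n. a $ i * (\<Sum>l<m. f g $$ (i, l) * v $ l)) = a \<bullet> (f g *\<^sub>v v)"
      using assms(1,2) f[of g] by (simp add: scalar_prod_def lessThan_atLeast0)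
  qed
  finally show ?thesis .
qed

lemma mat_trace_mult_commute:
  fixes A B :: "complex mat"
  assumes "A \<in> carrier_mat n m" "B \<in> carrier_mat m n"
  shows "(\<Sum>i<n. (A * B) $$ (i, i)) = (\<Sum>i<m. (B * A) $$ (i, i))"
proof -
  have "(\<Sum>i<n. (A * B) $$ (i, i)) = (\<Sum>i<n. \<Sum>j<m. A $$ (i, j) * B $$ (j, i))"
    using assms by (simp add: scalar_prod_def lessThan_atLeast0)
  also have "\<dots> = (\<Sum>j<m. \<Sum>i<n. A $$ (i, j) * B $$ (j, i))" by (rule sum.swap)
  also have "\<dots> = (\<Sum>i<m. (B * A) $$ (i, i))"
    using assms by (simp add: scalar_prod_def lessThan_atLeast0 mult.commute)
  finally show ?thesis .
qed

text \<open>The matrix coefficient of \<open>\<rho>\<close> at \<open>v\<close> and the linear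
  functional given by \<open>a\<close>. As \<open>a\<close> varies, these functions form an image
  of the dual representation inside the functions on the group.\<close>

definition mcoeff :: "('g \<Rightarrow> complex mat) \<Rightarrow> complex Matrix.vec \<Rightarrow> complex Matrix.vec \<Rightarrow> 'g \<Rightarrow> complex" where
  "mcoeff \<rho> a v x = a \<bullet> (\<rho> x *\<^sub>v v)"

definition outer_prod :: "nat \<Rightarrow> nat \<Rightarrow> complex Matrix.vec \<Rightarrow> complex Matrix.vec \<Rightarrow> complex mat" where
  "outer_prod n m v c = Matrix.mat n m (\<lambda>(i, j). v $ i * c $ j)"

lemma outer_prod_carrier [simp]: "outer_prod n m v c \<in> carrier_mat n m"
  by (simp add: outer_prod_def)

lemma outer_prod_mult_vec:
  assumes "v \<in> carrier_vec n" "c \<in> carrier_vec m" "w \<in> carrier_vec m"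
  shows "outer_prod n m v c *\<^sub>v w = (c \<bullet> w) \<cdot>\<^sub>v v"
  using assms by (intro eq_vecI) (auto simp: outer_prod_def scalar_prod_def sum_distrib_left sum_distrib_right ac_simps)

context finite_group
begin

lemma mcoeff_one: "matrix_rep G n \<rho> \<Longrightarrow> v \<in> carrier_vec n \<Longrightarrow> mcoeff \<rho> a v \<one> = a \<bullet> v"
  by (simp add: mcoeff_def rep_one)

lemma mcoeff_translate:
  assumes rep: "matrix_rep G n \<rho>" and "a \<in> carrier_vec n" "v \<in> carrier_vec n" "y \<in> carrier G" "x \<in> carrier G"
  shows "mcoeff \<rho> a v (y \<otimes> x) = mcoeff \<rho> (transpose_mat (\<rho> y) *\<^sub>v a) v x"
  unfolding mcoeff_def rep_mult_vec[OF rep assms(4,5,3)]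
  by (rule scalar_prod_mult_mat_vec[OF rep_carrier[OF rep assms(4)] rep_vec[OF rep assms(5,3)] assms(2)])

lemma mcoeff_smult:
  assumes "matrix_rep G n \<rho>" "a \<in> carrier_vec n" "v \<in> carrier_vec n" "x \<in> carrier G"
  shows "mcoeff \<rho> a (c \<cdot>\<^sub>v v) x = c * mcoeff \<rho> a v x"
  unfolding mcoeff_def mult_mat_vec[OF rep_carrier[OF assms(1,4)] assms(3)]
  using assms(2) rep_vec[OF assms(1,4,3)] by (rule scalar_prod_smult_distrib)

lemma mcoeff_diff:
  assumes "matrix_rep G n \<rho>" "a \<in> carrier_vec n" "u \<in> carrier_vec n" "v \<in> carrier_vec n" "x \<in> carrier G"
  shows "mcoeff \<rho> a (u - v) x = mcoeff \<rho> a u x - mcoeff \<rho> a v x"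
  unfolding mcoeff_def mult_minus_distrib_mat_vec[OF rep_carrier[OF assms(1,5)] assms(3,4)]
  using assms(2) rep_vec[OF assms(1,5,3)] rep_vec[OF assms(1,5,4)] by (rule scalar_prod_minus_distrib)

lemma mcoeff_add_left:
  assumes "matrix_rep G n \<rho>" "a \<in> carrier_vec n" "b \<in> carrier_vec n" "v \<in> carrier_vec n" "x \<in> carrier G"
  shows "mcoeff \<rho> (a + b) v x = mcoeff \<rho> a v x + mcoeff \<rho> b v x"
  unfolding mcoeff_def using assms(2,3) rep_vec[OF assms(1,5,4)] by (rule add_scalar_prod_distrib)

lemma mcoeff_smult_left:
  assumes "matrix_rep G n \<rho>" "a \<in> carrier_vec n" "v \<in> carrier_vec n" "x \<in> carrier G"
  shows "mcoeff \<rho> (c \<cdot>\<^sub>v a) v x = c * mcoeff \<rho> a v x"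
  unfolding mcoeff_def using assms(2) rep_vec[OF assms(1,4,3)] by (rule smult_scalar_prod_distrib)

lemma Re_mcoeff_conjugate_one:
  assumes rep: "matrix_rep G n \<rho>" and v: "v \<in> carrier_vec n" "v \<noteq> 0\<^sub>v n"
  shows "Re (mcoeff \<rho> (conjugate v) v \<one>) \<noteq> 0"
proof
  assume "Re (mcoeff \<rho> (conjugate v) v \<one>) = 0"
  moreover have "mcoeff \<rho> (conjugate v) v \<one> = v \<bullet> conjugate v"
    using comm_scalar_prod[of "conjugate v" n v] v(1) by (simp add: mcoeff_one[OF rep v(1)])
  ultimately have "(\<Sum>i<n. (cmod (v $ i))\<^sup>2) = 0" by (simp add: Re_scalar_prod_conjugate[OF v(1)])
  then have "\<forall>i\<in>{..<n}. (cmod (v $ i))\<^sup>2 = 0" by (subst (asm) sum_nonneg_eq_0_iff) auto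
  then have "v = 0\<^sub>v n" using v(1) by (intro eq_vecI) auto
  then show False using v(2) by simp
qed

lemma mcoeff_iso:
  assumes rep: "matrix_rep G n \<rho>" "matrix_rep G m \<sigma>" and T: "intertwiner n \<rho> m \<sigma> T"
    and "a \<in> carrier_vec m" "v \<in> carrier_vec n" "x \<in> carrier G"
  shows "mcoeff \<sigma> a (T *\<^sub>v v) x = mcoeff \<rho> (transpose_mat T *\<^sub>v a) v x"
proof -
  have "T \<in> carrier_mat m n" using T by (simp add: intertwiner_def)
  then show ?thesis
    using scalar_prod_mult_mat_vec[OF _ rep_vec[OF rep(1) assms(6,5)] assms(4)]
    unfolding mcoeff_def intertwiner_mult_vec[OF T rep assms(6,5), symmetric] by blast
qed

lemma bij_left_mult: "h \<in> carrier G \<Longrightarrow> bij_betw (\<lambda>g. h \<otimes> g) (carrier G) (carrier G)"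
  by (rule bij_betw_byWitness[where f' = "\<lambda>g. inv h \<otimes> g"]) (auto simp: m_assoc[symmetric])

lemma bij_right_mult: "h \<in> carrier G \<Longrightarrow> bij_betw (\<lambda>g. g \<otimes> h) (carrier G) (carrier G)"
  by (rule bij_betw_byWitness[where f' = "\<lambda>g. g \<otimes> inv h"]) (auto simp: m_assoc)

definition averaged :: "nat \<Rightarrow> ('a \<Rightarrow> complex mat) \<Rightarrow> nat \<Rightarrow> ('a \<Rightarrow> complex mat) \<Rightarrow> complex mat \<Rightarrow> complex mat" where
  "averaged n \<rho> m \<sigma> X = mat_sum n m (\<lambda>g. \<rho> g * X * \<sigma> (inv g)) (carrier G)"

text \<open>Averaging over the group turns every matrix into an intertwiner.\<close>

lemma averaged_intertwiner:
  assumes rep: "matrix_rep G n \<rho>" "matrix_rep G m \<sigma>" and X: "X \<in> carrier_mat n m"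
  shows "intertwiner m \<sigma> n \<rho> (averaged n \<rho> m \<sigma> X)"
  unfolding intertwiner_def
proof (intro conjI ballI)
  show "averaged n \<rho> m \<sigma> X \<in> carrier_mat n m" by (simp add: averaged_def)
  fix h assume h: "h \<in> carrier G"
  have summand: "\<rho> g * X * \<sigma> (inv g) \<in> carrier_mat n m" if "g \<in> carrier G" for g
    using mult_carrier_mat[OF mult_carrier_mat[OF rep_carrier[OF rep(1) that] X] rep_carrier[OF rep(2) inv_closed[OF that]]] .
  have "averaged n \<rho> m \<sigma> X * \<sigma> h = mat_sum n m (\<lambda>g. \<rho> g * X * \<sigma> (inv g) * \<sigma> h) (carrier G)"
    unfolding averaged_def by (rule mat_sum_mult[OF rep_carrier[OF rep(2) h] summand])
  also have "\<dots> = mat_sum n m (\<lambda>g. \<rho> (h \<otimes> g) * X * \<sigma> (inv (h \<otimes> g)) * \<sigma> h) (carrier G)"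
    unfolding mat_sum_def
    by (subst sum.reindex_bij_betw[OF bij_left_mult[OF h], symmetric]) (rule refl)
  also have "\<dots> = mat_sum n m (\<lambda>g. \<rho> h * (\<rho> g * X * \<sigma> (inv g))) (carrier G)"
  proof (rule mat_sum_cong)
    fix g assume g: "g \<in> carrier G"
    have c: "\<rho> h \<in> carrier_mat n n" "\<rho> g \<in> carrier_mat n n" "\<sigma> (inv g) \<in> carrier_mat m m"
      "\<sigma> h \<in> carrier_mat m m" "\<sigma> (inv (h \<otimes> g)) \<in> carrier_mat m m" "\<rho> g * X \<in> carrier_mat n m"
      using g h rep_carrier[OF rep(1)] rep_carrier[OF rep(2)] mult_carrier_mat[OF rep_carrier[OF rep(1) g] X] by simp_all
    have "\<sigma> (inv (h \<otimes> g)) * \<sigma> h = \<sigma> (inv (h \<otimes> g) \<otimes> h)" using g h by (intro rep_mult[OF rep(2), symmetric]) auto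
    also have "inv (h \<otimes> g) \<otimes> h = inv g" using g h by (simp add: inv_mult_group m_assoc)
    finally have s: "\<sigma> (inv (h \<otimes> g)) * \<sigma> h = \<sigma> (inv g)" .
    have "\<rho> (h \<otimes> g) * X * \<sigma> (inv (h \<otimes> g)) * \<sigma> h = (\<rho> h * (\<rho> g * X)) * (\<sigma> (inv (h \<otimes> g)) * \<sigma> h)"
      unfolding rep_mult[OF rep(1) h g] assoc_mult_mat[OF c(1,2) X] using c
      by (intro assoc_mult_mat[of _ n m _ m _ m]) auto
    also have "\<dots> = \<rho> h * (\<rho> g * X * \<sigma> (inv g))"
      unfolding s using c(1,6,3) by (rule assoc_mult_mat)
    finally show "\<rho> (h \<otimes> g) * X * \<sigma> (inv (h \<otimes> g)) * \<sigma> h = \<rho> h * (\<rho> g * X * \<sigma> (inv g))" .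
  qed
  also have "\<dots> = \<rho> h * averaged n \<rho> m \<sigma> X"
    unfolding averaged_def by (rule mult_mat_sum[OF rep_carrier[OF rep(1) h] summand, symmetric])
  finally show "averaged n \<rho> m \<sigma> X * \<sigma> h = \<rho> h * averaged n \<rho> m \<sigma> X" .
qed

text \<open>This bilinear pairing, in place of the Hermitian inner product, makes the
  orthogonality relations hold for matrix representations that need not be unitary.\<close>

definition pairing :: "('a \<Rightarrow> complex) \<Rightarrow> ('a \<Rightarrow> complex) \<Rightarrow> complex" where
  "pairing f h = (\<Sum>g\<in>carrier G. f g * h (inv g))"

lemma pairing_add: "pairing (\<lambda>x. f x + h x) k = pairing f k + pairing h k"
  by (simp add: pairing_def distrib_right sum.distrib)

lemma pairing_mult: "pairing (\<lambda>x. c * f x) k = c * pairing f k"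
  by (simp add: pairing_def sum_distrib_left mult.assoc)

lemma pairing_cong: "(\<And>x. x \<in> carrier G \<Longrightarrow> f x = h x) \<Longrightarrow> pairing f k = pairing h k"
  unfolding pairing_def by (intro sum.cong refl) simp

lemma pairing_mcoeff:
  assumes rep: "matrix_rep G n \<rho>" "matrix_rep G m \<sigma>"
    and "c \<in> carrier_vec n" "v \<in> carrier_vec n" "c' \<in> carrier_vec m" "v' \<in> carrier_vec m"
  shows "pairing (mcoeff \<rho> c v) (mcoeff \<sigma> c' v') = c \<bullet> (averaged n \<rho> m \<sigma> (outer_prod n m v c') *\<^sub>v v')"
proof -
  let ?X = "outer_prod n m v c'"
  have "c \<bullet> (averaged n \<rho> m \<sigma> ?X *\<^sub>v v') = (\<Sum>g\<in>carrier G. c \<bullet> ((\<rho> g * ?X * \<sigma> (inv g)) *\<^sub>v v'))"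
    unfolding averaged_def using assms(3,6)
  proof (rule scalar_prod_mat_sum)
    fix g assume "g \<in> carrier G"
    then show "\<rho> g * ?X * \<sigma> (inv g) \<in> carrier_mat n m"
      using rep_carrier[OF rep(1), of g] rep_carrier[OF rep(2), of "inv g"]
      by (intro mult_carrier_mat[of _ n m _ m] mult_carrier_mat[of _ n n _ m]) auto
  qed
  also have "\<dots> = (\<Sum>g\<in>carrier G. mcoeff \<rho> c v g * mcoeff \<sigma> c' v' (inv g))"
  proof (rule sum.cong[OF refl])
    fix g assume g: "g \<in> carrier G"
    have cg: "\<rho> g \<in> carrier_mat n n" "\<sigma> (inv g) \<in> carrier_mat m m" "?X \<in> carrier_mat n m"
      using g rep rep_carrier by auto
    have w: "\<sigma> (inv g) *\<^sub>v v' \<in> carrier_vec m" using cg assms(6) by simp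
    have "(\<rho> g * ?X * \<sigma> (inv g)) *\<^sub>v v' = \<rho> g *\<^sub>v (?X *\<^sub>v (\<sigma> (inv g) *\<^sub>v v'))"
      using assoc_mult_mat_vec[OF mult_carrier_mat[OF cg(1,3)] cg(2) assms(6)] assoc_mult_mat_vec[OF cg(1,3) w]
      by simp
    also have "\<dots> = \<rho> g *\<^sub>v ((c' \<bullet> (\<sigma> (inv g) *\<^sub>v v')) \<cdot>\<^sub>v v)"
      by (simp only: outer_prod_mult_vec[OF assms(4,5) w])
    also have "\<dots> = (c' \<bullet> (\<sigma> (inv g) *\<^sub>v v')) \<cdot>\<^sub>v (\<rho> g *\<^sub>v v)" using cg(1) assms(4) by (rule mult_mat_vec)
    finally show "c \<bullet> ((\<rho> g * ?X * \<sigma> (inv g)) *\<^sub>v v') = mcoeff \<rho> c v g * mcoeff \<sigma> c' v' (inv g)"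
      using scalar_prod_smult_distrib[OF assms(3) rep_vec[OF rep(1) g assms(4)], of "c' \<bullet> (\<sigma> (inv g) *\<^sub>v v')"]
      by (simp only: mcoeff_def mult.commute)
  qed
  finally show ?thesis by (simp add: pairing_def)
qed

text \<open>Orthogonality of the matrix coefficients of different irreducible representations: the
  pairing is an entry of an averaged matrix, and that matrix is 0 by Schur's lemma.\<close>

lemma pairing_noniso:
  assumes irr: "complex_irrep G n \<rho>" "complex_irrep G m \<sigma>" and niso: "\<not> rep_iso G m \<sigma> n \<rho>"
    and vecs: "c \<in> carrier_vec n" "v \<in> carrier_vec n" "c' \<in> carrier_vec m" "v' \<in> carrier_vec m"
  shows "pairing (mcoeff \<rho> c v) (mcoeff \<sigma> c' v') = 0"
proof -
  have rep: "matrix_rep G n \<rho>" "matrix_rep G m \<sigma>" using irr by (simp_all add: complex_irrep_iff)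
  have "averaged n \<rho> m \<sigma> (outer_prod n m v c') = 0\<^sub>m n m"
    using nonzero_intertwiner_iso(3)[OF irr(2,1) averaged_intertwiner[OF rep outer_prod_carrier]] niso by blast
  moreover have "0\<^sub>m n m *\<^sub>v v' = 0\<^sub>v n" using vecs by (intro eq_vecI) auto
  ultimately show ?thesis using pairing_mcoeff[OF rep vecs] vecs by simp
qed

lemma card_carrier_neq_0: "complex_of_nat (card (carrier G)) \<noteq> 0"
  using fin one_closed by (auto simp: card_eq_0_iff)

text \<open>The orthogonality relation within one irreducible representation, from the trace of
  the scalar matrix \<open>averaged n \<rho> n \<rho> X\<close>.\<close>

lemma pairing_same:
  assumes irr: "complex_irrep G n \<rho>"
    and vecs: "c \<in> carrier_vec n" "v \<in> carrier_vec n" "c' \<in> carrier_vec n" "v' \<in> carrier_vec n"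
  shows "of_nat n * pairing (mcoeff \<rho> c v) (mcoeff \<rho> c' v') = of_nat (card (carrier G)) * (c' \<bullet> v) * (c \<bullet> v')"
proof -
  have rep: "matrix_rep G n \<rho>" using irr by (simp add: complex_irrep_iff)
  let ?X = "outer_prod n n v c'"
  let ?T = "averaged n \<rho> n \<rho> ?X"
  obtain l where l: "?T = l \<cdot>\<^sub>m 1\<^sub>m n"
    using intertwiner_scalar[OF irr averaged_intertwiner[OF rep rep outer_prod_carrier]] by blast
  \<comment> \<open>The scalar is found by taking traces.\<close>
  have "of_nat n * l = (\<Sum>i<n. ?T $$ (i, i))" by (simp add: l)
  also have "\<dots> = (\<Sum>i<n. \<Sum>g\<in>carrier G. (\<rho> g * ?X * \<rho> (inv g)) $$ (i, i))"
    by (simp add: averaged_def mat_sum_def)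
  also have "\<dots> = (\<Sum>g\<in>carrier G. \<Sum>i<n. (\<rho> g * ?X * \<rho> (inv g)) $$ (i, i))" by (rule sum.swap)
  also have "\<dots> = (\<Sum>g\<in>carrier G. \<Sum>i<n. ?X $$ (i, i))"
  proof (rule sum.cong[OF refl])
    fix g assume g: "g \<in> carrier G"
    have cg: "\<rho> g \<in> carrier_mat n n" "\<rho> (inv g) \<in> carrier_mat n n" "?X \<in> carrier_mat n n"
      using g rep rep_carrier by auto
    have "(\<Sum>i<n. (\<rho> g * ?X * \<rho> (inv g)) $$ (i, i)) = (\<Sum>i<n. (\<rho> (inv g) * (\<rho> g * ?X)) $$ (i, i))"
      using mult_carrier_mat[OF cg(1,3)] cg(2) by (rule mat_trace_mult_commute)
    also have "\<rho> (inv g) * (\<rho> g * ?X) = ?X"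
      using assoc_mult_mat[OF cg(2,1,3)] rep_inv(2)[OF rep g] cg(3) by simp
    finally show "(\<Sum>i<n. (\<rho> g * ?X * \<rho> (inv g)) $$ (i, i)) = (\<Sum>i<n. ?X $$ (i, i))" .
  qed
  also have "\<dots> = of_nat (card (carrier G)) * (c' \<bullet> v)"
    using vecs by (simp add: outer_prod_def scalar_prod_def lessThan_atLeast0 mult.commute)
  finally have nl: "of_nat n * l = of_nat (card (carrier G)) * (c' \<bullet> v)" .
  have "?T *\<^sub>v v' = l \<cdot>\<^sub>v v'" unfolding l using smult_mat_mult_vec[OF one_carrier_mat vecs(4), of l] vecs by simp
  then have "pairing (mcoeff \<rho> c v) (mcoeff \<rho> c' v') = l * (c \<bullet> v')"
    using pairing_mcoeff[OF rep rep vecs] vecs by simp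
  then show ?thesis using nl by (simp add: mult.assoc[symmetric])
qed

lemma noniso_irreps_bound:
  assumes irr: "\<And>i. i < k \<Longrightarrow> complex_irrep G (n i) (\<rho> i)"
    and niso: "\<And>i j. i < k \<Longrightarrow> j < k \<Longrightarrow> i \<noteq> j \<Longrightarrow> \<not> rep_iso G (n j) (\<rho> j) (n i) (\<rho> i)"
  shows "k \<le> card (carrier G)"
proof -
  obtain e where e: "bij_betw e {0..<card (carrier G)} (carrier G)" using ex_bij_betw_nat_finite[OF fin] by blast
  define N where "N = card (carrier G)"
  define f where "f i = mcoeff (\<rho> i) (unit_vec (n i) 0) (unit_vec (n i) 0)" for i
  have npos: "n i > 0" if "i < k" for i using irr[OF that] by (simp add: complex_irrep_iff)
  define c where "c i = complex_of_nat N / of_nat (n i)" for i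
  have pair: "pairing (f i) (f j) = (if i = j then c i else 0)" if i: "i < k" and j: "j < k" for i j
  proof (cases "i = j")
    case True
    have "complex_of_nat (n i) * pairing (f i) (f i) = complex_of_nat N"
      unfolding f_def N_def using pairing_same[OF irr[OF i]] npos[OF i] by simp
    then show ?thesis using True npos[OF i] by (simp add: c_def field_simps)
  next
    case False
    then show ?thesis unfolding f_def using pairing_noniso[OF irr[OF i] irr[OF j] niso[OF i j False]] by simp
  qed
  have c0: "c i \<noteq> 0" if "i < k" for i using npos[OF that] card_carrier_neq_0 by (simp add: c_def N_def)
  \<comment> \<open>Orthogonality says that these \<open>k \<times> N\<close> and \<open>N \<times> k\<close> matrices have product \<open>1\<close>.\<close>
  define A where "A = Matrix.mat k N (\<lambda>(i, l). f i (e l))"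
  define B where "B = Matrix.mat N k (\<lambda>(l, j). f j (inv (e l)) / c j)"
  have "A * B = 1\<^sub>m k"
  proof (rule eq_matI)
    fix i j assume "i < dim_row (1\<^sub>m k :: complex mat)" "j < dim_col (1\<^sub>m k :: complex mat)"
    then have ij: "i < k" "j < k" by simp_all
    have "(A * B) $$ (i, j) = (\<Sum>l = 0..<N. f i (e l) * (f j (inv (e l)) / c j))"
      using ij by (simp add: A_def B_def scalar_prod_def)
    also have "\<dots> = (\<Sum>g\<in>carrier G. f i g * (f j (inv g) / c j))"
      unfolding N_def by (rule sum.reindex_bij_betw[OF e])
    also have "\<dots> = pairing (f i) (f j) / c j" by (simp add: pairing_def sum_divide_distrib)
    also have "\<dots> = 1\<^sub>m k $$ (i, j)" using pair[OF ij] c0[OF ij(2)] ij by simp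
    finally show "(A * B) $$ (i, j) = 1\<^sub>m k $$ (i, j)" .
  qed (auto simp: A_def B_def)
  then show ?thesis
    using left_invertible_tall[of B N k A] by (simp add: A_def B_def N_def)
qed

text \<open>One matrix coefficient of each of \<open>k\<close> pairwise non-isomorphic irreducible
  representations gives \<open>k\<close> linearly independent functions on \<open>G\<close>, so a
  largest such family exists.\<close>

lemma finitely_many_irreps:
  obtains R where "finite R" "\<And>m \<sigma>. complex_irrep G m \<sigma> \<Longrightarrow> \<exists>(n, \<rho>)\<in>R. complex_irrep G n \<rho> \<and> rep_iso G m \<sigma> n \<rho>"
proof -
  define P where "P k \<longleftrightarrow> (\<exists>n \<rho>. (\<forall>i<k. complex_irrep G (n i) (\<rho> i)) \<and>
    (\<forall>i<k. \<forall>j<k. i \<noteq> j \<longrightarrow> \<not> rep_iso G (n j) (\<rho> j) (n i) (\<rho> i)))" for k :: nat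
  have bound: "k \<le> card (carrier G)" if "P k" for k using that noniso_irreps_bound unfolding P_def by metis
  have "P 0" by (simp add: P_def)
  define k where "k = (GREATEST k. P k)"
  have Pk: "P k" unfolding k_def using GreatestI_nat[of P, OF \<open>P 0\<close>] bound by blast
  have not: "\<not> P (Suc k)"
    using Greatest_le_nat[of P "Suc k" "card (carrier G)"] bound unfolding k_def by (metis Suc_n_not_le_n)
  from Pk obtain n \<rho> where all: "(\<forall>i<k. complex_irrep G (n i) (\<rho> i)) \<and>
    (\<forall>i<k. \<forall>j<k. i \<noteq> j \<longrightarrow> \<not> rep_iso G (n j) (\<rho> j) (n i) (\<rho> i))"
    unfolding P_def by (elim exE)
  have irr: "complex_irrep G (n i) (\<rho> i)" if "i < k" for i
    by (rule all[THEN conjunct1, rule_format, OF that])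
  have niso: "\<not> rep_iso G (n j) (\<rho> j) (n i) (\<rho> i)" if "i < k" "j < k" "i \<noteq> j" for i j
    by (rule all[THEN conjunct2, rule_format, OF that])
  have complete: "\<exists>i<k. rep_iso G m \<sigma> (n i) (\<rho> i)" if \<sigma>: "complex_irrep G m \<sigma>" for m \<sigma>
  proof (rule ccontr)
    assume contra: "\<not> ?thesis"
    have contra': "\<not> rep_iso G (n i) (\<rho> i) m \<sigma>" if i: "i < k" for i
    proof
      assume iso: "rep_iso G (n i) (\<rho> i) m \<sigma>"
      have "matrix_rep G (n i) (\<rho> i)" "matrix_rep G m \<sigma>" using irr[OF i] \<sigma> by (simp_all add: complex_irrep_iff)
      from rep_iso_sym[OF this iso] i contra show False by simp
    qed
    let ?n = "\<lambda>i. if i < k then n i else m" and ?\<rho> = "\<lambda>i. if i < k then \<rho> i else \<sigma>"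
    have "\<forall>i<Suc k. complex_irrep G (?n i) (?\<rho> i)"
    proof (intro allI impI)
      fix i
      show "complex_irrep G (?n i) (?\<rho> i)"
        by (cases "i < k") (simp_all add: irr[of i] \<sigma>)
    qed
    moreover have "\<forall>i<Suc k. \<forall>j<Suc k. i \<noteq> j \<longrightarrow> \<not> rep_iso G (?n j) (?\<rho> j) (?n i) (?\<rho> i)"
    proof (intro allI impI)
      fix i j assume ij: "i < Suc k" "j < Suc k" "i \<noteq> j"
      then consider "i < k" "j < k" | "i < k" "\<not> j < k" | "\<not> i < k" "j < k" by linarith
      then show "\<not> rep_iso G (?n j) (?\<rho> j) (?n i) (?\<rho> i)"
      proof cases
        case 1 then show ?thesis using niso[of i j] ij(3) by simp
      next
        case 2 then show ?thesis using contra by simp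
      next
        case 3 then show ?thesis using contra'[of j] by simp
      qed
    qed
    ultimately have "P (Suc k)" unfolding P_def by (intro exI[of _ ?n] exI[of _ ?\<rho>]) blast
    then show False using not by simp
  qed
  have cover: "\<exists>(n', \<rho>')\<in>(\<lambda>i. (n i, \<rho> i)) ` {..<k}. complex_irrep G n' \<rho>' \<and> rep_iso G m \<sigma> n' \<rho>'"
    if \<sigma>: "complex_irrep G m \<sigma>" for m \<sigma>
  proof -
    obtain i where i: "i < k" "rep_iso G m \<sigma> (n i) (\<rho> i)" using complete[OF \<sigma>] by (elim exE conjE)
    show ?thesis by (rule bexI[of _ "(n i, \<rho> i)"]) (use i irr[OF i(1)] in simp_all)
  qed
  show thesis by (rule that[of "(\<lambda>i. (n i, \<rho> i)) ` {..<k}", OF _ cover]) simp_all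
qed

end

section \<open>Conjugate representations and types\<close>

context finite_group
begin

definition conj_rep :: "('a \<Rightarrow> complex mat) \<Rightarrow> 'a \<Rightarrow> complex mat" where
  "conj_rep \<rho> g = map_mat cnj (\<rho> g)"

lemma matrix_rep_conj:
  assumes rep: "matrix_rep G n \<rho>"
  shows "matrix_rep G n (conj_rep \<rho>)"
  unfolding matrix_rep_def conj_rep_def
proof (intro conjI ballI)
  fix g h assume "g \<in> carrier G" "h \<in> carrier G"
  then show "map_mat cnj (\<rho> (g \<otimes> h)) = map_mat cnj (\<rho> g) * map_mat cnj (\<rho> h)"
    using map_cnj_mult[OF rep_carrier[OF rep] rep_carrier[OF rep]] rep_mult[OF rep] by simp
qed (use rep_carrier[OF rep] rep_one[OF rep] in simp_all)

lemma complex_irrep_conj: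
  assumes irr: "complex_irrep G n \<rho>"
  shows "complex_irrep G n (conj_rep \<rho>)"
proof -
  have rep: "matrix_rep G n \<rho>" using irr by (simp add: complex_irrep_iff)
  have "W = {0\<^sub>v n} \<or> W = carrier_vec n" if W: "invariant_subspace G n (conj_rep \<rho>) W" for W
  proof -
    have Wc: "W \<subseteq> carrier_vec n" using W by (simp add: invariant_subspace_def)
    let ?W = "conjugate ` W"
    have "invariant_subspace G n \<rho> ?W"
      unfolding invariant_subspace_def
    proof (intro conjI ballI allI)
      show "?W \<subseteq> carrier_vec n" using Wc by auto
      have "0\<^sub>v n \<in> W" using W by (simp add: invariant_subspace_def)
      then show "0\<^sub>v n \<in> ?W" by (rule rev_image_eqI) simp
    next
      fix x y assume "x \<in> ?W" "y \<in> ?W"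
      then obtain u w where u: "u \<in> W" "w \<in> W" "x = conjugate u" "y = conjugate w" by blast
      then have "u + w \<in> W" using W by (simp add: invariant_subspace_def)
      moreover have "x + y = conjugate (u + w)"
        using u Wc by (simp add: conjugate_add_vec[of u n w] subset_iff)
      ultimately show "x + y \<in> ?W" by blast
    next
      fix c x assume "x \<in> ?W"
      then obtain u where u: "u \<in> W" "x = conjugate u" by blast
      then have "cnj c \<cdot>\<^sub>v u \<in> W" using W by (simp add: invariant_subspace_def)
      moreover have "c \<cdot>\<^sub>v x = conjugate (cnj c \<cdot>\<^sub>v u)" using u by (simp add: conjugate_smult)
      ultimately show "c \<cdot>\<^sub>v x \<in> ?W" by blast
    next
      fix g x assume g: "g \<in> carrier G" and "x \<in> ?W"
      then obtain u where u: "u \<in> W" "x = conjugate u" by blast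
      then have "conj_rep \<rho> g *\<^sub>v u \<in> W" using W g by (simp add: invariant_subspace_def)
      moreover have "\<rho> g *\<^sub>v x = conjugate (conj_rep \<rho> g *\<^sub>v u)"
        using conjugate_mult_mat_vec[of "conj_rep \<rho> g" n n u] u Wc g rep_carrier[OF matrix_rep_conj[OF rep] g]
        by (auto simp: conj_rep_def)
      ultimately show "\<rho> g *\<^sub>v x \<in> ?W" by blast
    qed
    then consider "?W = {0\<^sub>v n}" | "?W = carrier_vec n" using irr unfolding complex_irrep_iff by blast
    moreover have inv: "W = conjugate ` ?W" by (simp add: image_image)
    ultimately show ?thesis
    proof cases
      case 1
      then show ?thesis by (subst (1) inv) simp
    next
      case 2
      have "carrier_vec n \<subseteq> W"
      proof
        fix x :: "complex Matrix.vec" assume "x \<in> carrier_vec n"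
        then have "conjugate x \<in> ?W" using 2 by simp
        then show "x \<in> W" by (metis conjugate_id imageE)
      qed
      then show ?thesis using Wc by blast
    qed
  qed
  then show ?thesis using irr matrix_rep_conj[OF rep] by (simp add: complex_irrep_iff)
qed

lemma mcoeff_conj:
  assumes rep: "matrix_rep G n \<rho>" and "a \<in> carrier_vec n" "v \<in> carrier_vec n" "x \<in> carrier G"
  shows "mcoeff (conj_rep \<rho>) (conjugate a) (conjugate v) x = cnj (mcoeff \<rho> a v x)"
  using conjugate_mult_mat_vec[OF rep_carrier[OF rep assms(4)] assms(3)]
    conjugate_scalar_prod[OF assms(2) rep_vec[OF rep assms(4,3)]]
  by (simp add: mcoeff_def conj_rep_def)

lemma matrix_rep_dual:
  assumes rep: "matrix_rep G n \<rho>"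
  shows "matrix_rep G n (dual_rep G \<rho>)"
  unfolding matrix_rep_def dual_rep_def
proof (intro conjI ballI)
  fix g h assume g: "g \<in> carrier G" and h: "h \<in> carrier G"
  have "\<rho> (inv (g \<otimes> h)) = \<rho> (inv h) * \<rho> (inv g)" using g h by (simp add: inv_mult_group rep_mult[OF rep])
  then show "transpose_mat (\<rho> (inv (g \<otimes> h))) = transpose_mat (\<rho> (inv g)) * transpose_mat (\<rho> (inv h))"
    using transpose_mult[OF rep_carrier[OF rep inv_closed[OF h]] rep_carrier[OF rep inv_closed[OF g]]] by simp
qed (use rep_carrier[OF rep] rep_one[OF rep] in simp_all)

text \<open>A finite group preserves a Hermitian form on every representation, and such a form
  identifies the conjugate representation with the dual one.\<close>

lemma conj_iso_dual:
  assumes rep: "matrix_rep G n \<rho>"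
  shows "rep_iso G n (conj_rep \<rho>) n (dual_rep G \<rho>)"
proof -
  \<comment> \<open>The complex conjugate of the Gram matrix of an invariant Hermitian form.\<close>
  define N where "N = mat_sum n n (\<lambda>g. transpose_mat (\<rho> g) * conj_rep \<rho> g) (carrier G)"
  have Nc: "N \<in> carrier_mat n n" by (simp add: N_def)
  note crep = matrix_rep_conj[OF rep]
  have rT: "transpose_mat (\<rho> g) \<in> carrier_mat n n" if "g \<in> carrier G" for g using rep_carrier[OF rep that] by simp
  have summand: "transpose_mat (\<rho> g) * conj_rep \<rho> g \<in> carrier_mat n n" if "g \<in> carrier G" for g
    using rT[OF that] rep_carrier[OF crep that] by (rule mult_carrier_mat)
  have inter: "N * conj_rep \<rho> h = dual_rep G \<rho> h * N" if h: "h \<in> carrier G" for h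
  proof -
    have dh: "dual_rep G \<rho> h \<in> carrier_mat n n" by (rule rep_carrier[OF matrix_rep_dual[OF rep] h])
    have "dual_rep G \<rho> h * N = mat_sum n n (\<lambda>g. dual_rep G \<rho> h * (transpose_mat (\<rho> g) * conj_rep \<rho> g)) (carrier G)"
      unfolding N_def by (rule mult_mat_sum[OF dh summand])
    also have "\<dots> = mat_sum n n (\<lambda>g. dual_rep G \<rho> h * (transpose_mat (\<rho> (g \<otimes> h)) * conj_rep \<rho> (g \<otimes> h))) (carrier G)"
      unfolding mat_sum_def
      by (subst sum.reindex_bij_betw[OF bij_right_mult[OF h], symmetric]) (rule refl)
    also have "\<dots> = mat_sum n n (\<lambda>g. transpose_mat (\<rho> g) * conj_rep \<rho> g * conj_rep \<rho> h) (carrier G)"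
    proof (rule mat_sum_cong)
      fix g assume g: "g \<in> carrier G"
      have gh: "g \<otimes> h \<in> carrier G" using g h by simp
      have "\<rho> (g \<otimes> h) * \<rho> (inv h) = \<rho> ((g \<otimes> h) \<otimes> inv h)" using rep_mult[OF rep gh inv_closed[OF h]] by simp
      then have r: "\<rho> (g \<otimes> h) * \<rho> (inv h) = \<rho> g" using g h by (simp add: m_assoc)
      have "dual_rep G \<rho> h * transpose_mat (\<rho> (g \<otimes> h)) = transpose_mat (\<rho> g)"
        unfolding dual_rep_def r[symmetric]
        by (rule transpose_mult[OF rep_carrier[OF rep gh] rep_carrier[OF rep inv_closed[OF h]], symmetric])
      then have "dual_rep G \<rho> h * (transpose_mat (\<rho> (g \<otimes> h)) * conj_rep \<rho> (g \<otimes> h)) =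
          transpose_mat (\<rho> g) * (conj_rep \<rho> g * conj_rep \<rho> h)"
        using assoc_mult_mat[OF dh rT[OF gh] rep_carrier[OF crep gh]] rep_mult[OF crep g h] by simp
      also have "\<dots> = transpose_mat (\<rho> g) * conj_rep \<rho> g * conj_rep \<rho> h"
        by (rule assoc_mult_mat[OF rT[OF g] rep_carrier[OF crep g] rep_carrier[OF crep h], symmetric])
      finally show "dual_rep G \<rho> h * (transpose_mat (\<rho> (g \<otimes> h)) * conj_rep \<rho> (g \<otimes> h)) =
          transpose_mat (\<rho> g) * conj_rep \<rho> g * conj_rep \<rho> h" .
    qed
    also have "\<dots> = N * conj_rep \<rho> h"
      unfolding N_def by (rule mat_sum_mult[OF rep_carrier[OF crep h] summand, symmetric])
    finally show ?thesis by simp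
  qed
  have "inj_mat N"
    unfolding inj_mat_def
  proof (intro ballI impI)
    fix v assume "v \<in> carrier_vec (dim_col N)" and "N *\<^sub>v v = 0\<^sub>v (dim_row N)"
    then have v: "v \<in> carrier_vec n" and Nv: "N *\<^sub>v v = 0\<^sub>v n" using Nc by auto
    have cv: "conjugate v \<in> carrier_vec n" using v by simp
    have "0 = conjugate v \<bullet> (N *\<^sub>v v)" using Nv cv by simp
    also have "\<dots> = (\<Sum>g\<in>carrier G. conjugate v \<bullet> ((transpose_mat (\<rho> g) * conj_rep \<rho> g) *\<^sub>v v))"
      unfolding N_def using cv v summand by (rule scalar_prod_mat_sum)
    also have "\<dots> = (\<Sum>g\<in>carrier G. (conj_rep \<rho> g *\<^sub>v v) \<bullet> conjugate (conj_rep \<rho> g *\<^sub>v v))"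
    proof (rule sum.cong[OF refl])
      fix g assume g: "g \<in> carrier G"
      have w: "conj_rep \<rho> g *\<^sub>v v \<in> carrier_vec n" by (rule rep_vec[OF crep g v])
      have "conjugate (conj_rep \<rho> g *\<^sub>v v) = \<rho> g *\<^sub>v conjugate v"
        using conjugate_mult_mat_vec[OF rep_carrier[OF crep g] v] by (simp add: conj_rep_def)
      moreover have "conjugate v \<bullet> (transpose_mat (\<rho> g) *\<^sub>v (conj_rep \<rho> g *\<^sub>v v)) = (\<rho> g *\<^sub>v conjugate v) \<bullet> (conj_rep \<rho> g *\<^sub>v v)"
        using scalar_prod_mult_mat_vec[OF rT[OF g] w cv] by simp
      moreover have "\<dots> = (conj_rep \<rho> g *\<^sub>v v) \<bullet> (\<rho> g *\<^sub>v conjugate v)"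
        using rep_vec[OF rep g cv] w by (rule comm_scalar_prod)
      ultimately show "conjugate v \<bullet> ((transpose_mat (\<rho> g) * conj_rep \<rho> g) *\<^sub>v v) =
          (conj_rep \<rho> g *\<^sub>v v) \<bullet> conjugate (conj_rep \<rho> g *\<^sub>v v)"
        using assoc_mult_mat_vec[OF rT[OF g] rep_carrier[OF crep g] v] by simp
    qed
    finally have "(\<Sum>g\<in>carrier G. Re ((conj_rep \<rho> g *\<^sub>v v) \<bullet> conjugate (conj_rep \<rho> g *\<^sub>v v))) = 0"
      by (metis Re_sum zero_complex.sel(1))
    then have "Re ((conj_rep \<rho> \<one> *\<^sub>v v) \<bullet> conjugate (conj_rep \<rho> \<one> *\<^sub>v v)) = 0"
      using sum_nonneg_eq_0_iff[OF fin, of "\<lambda>g. Re ((conj_rep \<rho> g *\<^sub>v v) \<bullet> conjugate (conj_rep \<rho> g *\<^sub>v v))"]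
        Re_scalar_prod_conjugate_nonneg one_closed by blast
    then have "(\<Sum>i<n. (cmod (v $ i))\<^sup>2) = 0"
      using v rep_one[OF crep] Re_scalar_prod_conjugate[OF v] by simp
    then have "\<forall>i\<in>{..<n}. (cmod (v $ i))\<^sup>2 = 0" by (subst (asm) sum_nonneg_eq_0_iff) auto
    then show "v = 0\<^sub>v (dim_col N)" using v Nc by (intro eq_vecI) auto
  qed
  then have "N \<in> carrier (GL n)" by (rule square_inj_mat_GL[OF Nc])
  then show ?thesis unfolding rep_iso_def using inter by blast
qed

text \<open>An isomorphism \<open>K\<close> from the conjugate representation gives the antilinear
  equivariant map \<open>v \<mapsto> K (cnj v)\<close>. Its square is a real scalar, and after
  rescaling the scalar is 1 or -1.\<close>

lemma self_conjugate_type: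
  assumes irr: "complex_irrep G n \<rho>" and iso: "rep_iso G n (conj_rep \<rho>) n \<rho>"
  shows "real_type G n \<rho> \<or> quaternionic_type G n \<rho>"
proof -
  have rep: "matrix_rep G n \<rho>" and n: "n > 0" using irr by (simp_all add: complex_irrep_iff)
  note crep = matrix_rep_conj[OF rep]
  obtain K where K: "K \<in> carrier (GL n)" and eq: "\<And>g. g \<in> carrier G \<Longrightarrow> K * conj_rep \<rho> g = \<rho> g * K"
    using iso by (auto simp: rep_iso_def)
  obtain U where U: "U \<in> carrier_mat n n" "U * K = 1\<^sub>m n" and Kc: "K \<in> carrier_mat n n"
    using K by (auto simp: carrier_GL_iff)
  let ?C = "map_mat cnj K"
  have Cc: "?C \<in> carrier_mat n n" using Kc by simp
  have KC: "K * ?C \<in> carrier_mat n n" using Kc Cc by simp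
  have "intertwiner n \<rho> n \<rho> (K * ?C)"
    unfolding intertwiner_def
  proof (intro conjI ballI KC)
    fix g assume g: "g \<in> carrier G"
    have r: "\<rho> g \<in> carrier_mat n n" "conj_rep \<rho> g \<in> carrier_mat n n"
      using rep_carrier[OF rep g] rep_carrier[OF crep g] by auto
    have "?C * \<rho> g = map_mat cnj (K * conj_rep \<rho> g)"
      using map_cnj_mult[OF Kc r(2)] by (simp add: conj_rep_def)
    also have "\<dots> = conj_rep \<rho> g * ?C"
      unfolding eq[OF g] using map_cnj_mult[OF r(1) Kc] by (simp add: conj_rep_def)
    finally have c: "?C * \<rho> g = conj_rep \<rho> g * ?C" .
    have "K * ?C * \<rho> g = K * (conj_rep \<rho> g * ?C)" using assoc_mult_mat[OF Kc Cc r(1)] c by simp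
    also have "\<dots> = (\<rho> g * K) * ?C" using assoc_mult_mat[OF Kc r(2) Cc] eq[OF g] by simp
    also have "\<dots> = \<rho> g * (K * ?C)" using r(1) Kc Cc by (rule assoc_mult_mat)
    finally show "K * ?C * \<rho> g = \<rho> g * (K * ?C)" .
  qed
  then obtain c where c: "K * ?C = c \<cdot>\<^sub>m 1\<^sub>m n" using intertwiner_scalar[OF irr] by blast
  have "?C * K = map_mat cnj (K * ?C)" using map_cnj_mult[OF Kc Cc] by simp
  also have "\<dots> = cnj c \<cdot>\<^sub>m 1\<^sub>m n" unfolding c by (rule eq_matI) auto
  finally have CK: "?C * K = cnj c \<cdot>\<^sub>m 1\<^sub>m n" .
  have nz: "v = 0\<^sub>v n" if "v \<in> carrier_vec n" "K *\<^sub>v v = 0\<^sub>v n" for v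
    using left_inverse_inj_mat[OF Kc U] that Kc by (simp add: inj_mat_def)
  define e where "e = (unit_vec n 0 :: complex Matrix.vec)"
  have e: "e \<in> carrier_vec n" by (simp add: e_def)
  have e0: "e $ 0 = 1" using n by (simp add: e_def)
  then have "e \<noteq> 0\<^sub>v n" using n by auto
  then have Ke: "K *\<^sub>v e \<noteq> 0\<^sub>v n" using nz e by blast
  have Kev: "K *\<^sub>v e \<in> carrier_vec n" using Kc e by simp
  have KCv: "K *\<^sub>v (?C *\<^sub>v v) = c \<cdot>\<^sub>v v" if "v \<in> carrier_vec n" for v
    using assoc_mult_mat_vec[OF Kc Cc that] c smult_mat_mult_vec[OF one_carrier_mat that, of c] that by simp
  have CKv: "?C *\<^sub>v (K *\<^sub>v v) = cnj c \<cdot>\<^sub>v v" if "v \<in> carrier_vec n" for v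
    using assoc_mult_mat_vec[OF Cc Kc that] CK smult_mat_mult_vec[OF one_carrier_mat that, of "cnj c"] that by simp
  have "c \<cdot>\<^sub>v (K *\<^sub>v e) = cnj c \<cdot>\<^sub>v (K *\<^sub>v e)"
    using KCv[OF Kev] CKv[OF e] mult_mat_vec[OF Kc e, of "cnj c"] by simp
  moreover obtain i where i: "i < n" "(K *\<^sub>v e) $ i \<noteq> 0"
  proof -
    have "\<exists>i<n. (K *\<^sub>v e) $ i \<noteq> 0"
    proof (rule ccontr)
      assume "\<not> ?thesis"
      then have "K *\<^sub>v e = 0\<^sub>v n" using Kc by (intro eq_vecI) (auto simp del: index_mult_mat_vec)
      then show False using Ke by simp
    qed
    then show thesis using that by blast
  qed
  ultimately have "c * (K *\<^sub>v e) $ i = cnj c * (K *\<^sub>v e) $ i"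
    using Kc by (metis carrier_matD(1) dim_mult_mat_vec index_smult_vec(1))
  then have "c = cnj c" using i by simp
  then obtain r where r: "c = complex_of_real r" by (metis Reals_cnj_iff Reals_cases)
  have "c \<noteq> 0"
  proof
    assume "c = 0"
    then have z: "K *\<^sub>v (?C *\<^sub>v conjugate e) = 0\<^sub>v n" using KCv[of "conjugate e"] e by (auto intro!: eq_vecI)
    moreover have "?C *\<^sub>v conjugate e = conjugate (K *\<^sub>v e)" using conjugate_mult_mat_vec[OF Kc e] by simp
    ultimately have "conjugate (K *\<^sub>v e) = 0\<^sub>v n" using nz[of "conjugate (K *\<^sub>v e)"] Kev by simp
    then have "K *\<^sub>v e = 0\<^sub>v n" by (metis conjugate_id conjugate_zero_vec)
    then show False using Ke by simp
  qed
  then have r0: "r \<noteq> 0" using r by simp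
  \<comment> \<open>Rescaling makes the square of the structure map the sign of \<open>r\<close>.\<close>
  define s where "s = 1 / sqrt \<bar>r\<bar>"
  have s: "s * s * r = sgn r" using r0 by (simp add: s_def sgn_if field_simps)
  define J where "J v = complex_of_real s \<cdot>\<^sub>v (K *\<^sub>v conjugate v)" for v
  have J: "conj_linear_equivariant G n \<rho> J"
    unfolding conj_linear_equivariant_def
  proof (intro conjI ballI allI funcsetI)
    show "J v \<in> carrier_vec n" if "v \<in> carrier_vec n" for v using that Kc by (simp add: J_def)
    show "J (u + v) = J u + J v" if "u \<in> carrier_vec n" "v \<in> carrier_vec n" for u v
    proof -
      have "K *\<^sub>v conjugate (u + v) = K *\<^sub>v conjugate u + K *\<^sub>v conjugate v"
        unfolding conjugate_add_vec[OF that] using that by (intro mult_add_distrib_mat_vec[OF Kc]) auto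
      then show ?thesis unfolding J_def using Kc that by (simp add: smult_add_distrib_vec[of _ n])
    qed
    show "J (d \<cdot>\<^sub>v v) = cnj d \<cdot>\<^sub>v J v" if "v \<in> carrier_vec n" for d v
    proof -
      have "K *\<^sub>v conjugate (d \<cdot>\<^sub>v v) = cnj d \<cdot>\<^sub>v (K *\<^sub>v conjugate v)"
        unfolding conjugate_smult using that by (intro mult_mat_vec[OF Kc]) auto
      then show ?thesis by (simp add: J_def smult_smult_assoc mult.commute)
    qed
    show "J (\<rho> g *\<^sub>v v) = \<rho> g *\<^sub>v J v" if g: "g \<in> carrier G" and v: "v \<in> carrier_vec n" for g v
    proof -
      have cv: "conjugate v \<in> carrier_vec n" using v by simp
      have "K *\<^sub>v conjugate (\<rho> g *\<^sub>v v) = K *\<^sub>v (conj_rep \<rho> g *\<^sub>v conjugate v)"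
        using conjugate_mult_mat_vec[OF rep_carrier[OF rep g] v] by (simp add: conj_rep_def)
      also have "\<dots> = \<rho> g *\<^sub>v (K *\<^sub>v conjugate v)"
        using assoc_mult_mat_vec[OF Kc rep_carrier[OF crep g] cv] assoc_mult_mat_vec[OF rep_carrier[OF rep g] Kc cv] eq[OF g]
        by simp
      finally show ?thesis
        unfolding J_def using mult_mat_vec[OF rep_carrier[OF rep g], of "K *\<^sub>v conjugate v" "complex_of_real s"] Kc cv by simp
    qed
  qed
  have JJ: "J (J v) = complex_of_real (sgn r) \<cdot>\<^sub>v v" if v: "v \<in> carrier_vec n" for v
  proof -
    have Kv: "K *\<^sub>v conjugate v \<in> carrier_vec n" using Kc v by simp
    have "conjugate (J v) = complex_of_real s \<cdot>\<^sub>v (?C *\<^sub>v v)"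
      using conjugate_mult_mat_vec[OF Kc, of "conjugate v"] v by (simp add: J_def conjugate_smult)
    then have "J (J v) = complex_of_real s \<cdot>\<^sub>v (complex_of_real s \<cdot>\<^sub>v (K *\<^sub>v (?C *\<^sub>v v)))"
      using mult_mat_vec[OF Kc, of "?C *\<^sub>v v"] Cc v by (simp add: J_def[of "J v"])
    also have "\<dots> = complex_of_real (s * s * r) \<cdot>\<^sub>v v"
      using KCv[OF v] by (simp add: smult_smult_assoc r mult.assoc)
    finally show ?thesis by (simp add: s)
  qed
  show ?thesis
  proof (cases "r > 0")
    case True
    then have "real_type G n \<rho>" unfolding real_type_def using J JJ by (intro exI[of _ J]) simp
    then show ?thesis ..
  next
    case False
    then have "\<forall>v\<in>carrier_vec n. J (J v) = - v" using JJ r0 by (auto intro!: eq_vecI)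
    then have "quaternionic_type G n \<rho>" unfolding quaternionic_type_def using J by blast
    then show ?thesis ..
  qed
qed

text \<open>The map \<open>u \<mapsto> cnj (b \<bullet> J u)\<close> is a linear functional,
  represented by \<open>b'\<close>. So \<open>J\<close> acts on matrix coefficients as complex
  conjugation.\<close>

lemma mcoeff_structure_map:
  assumes rep: "matrix_rep G n \<rho>" and J: "conj_linear_equivariant G n \<rho> J" and b: "b \<in> carrier_vec n"
  obtains b' where "b' \<in> carrier_vec n"
    "\<And>v x. v \<in> carrier_vec n \<Longrightarrow> x \<in> carrier G \<Longrightarrow> mcoeff \<rho> b (J v) x = cnj (mcoeff \<rho> b' v x)"
proof -
  have Jc: "J v \<in> carrier_vec n" if "v \<in> carrier_vec n" for v
    using J that by (auto simp: conj_linear_equivariant_def)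
  define F where "F u = cnj (b \<bullet> J u)" for u
  define b' where "b' = Matrix.vec n (\<lambda>i. F (unit_vec n i))"
  have F: "F u = b' \<bullet> u" if u: "u \<in> carrier_vec n" for u
    unfolding b'_def
  proof (rule linear_functional_scalar_prod[OF _ _ u])
    fix u v :: "complex Matrix.vec" assume "u \<in> carrier_vec n" "v \<in> carrier_vec n"
    then show "F (u + v) = F u + F v"
      using J b Jc scalar_prod_add_distrib[of b n "J u" "J v"] by (simp add: F_def conj_linear_equivariant_def)
  next
    fix c and v :: "complex Matrix.vec" assume "v \<in> carrier_vec n"
    then show "F (c \<cdot>\<^sub>v v) = c * F v"
      using J b Jc[of v] by (simp add: F_def conj_linear_equivariant_def)
  qed
  have "mcoeff \<rho> b (J v) x = cnj (mcoeff \<rho> b' v x)" if "v \<in> carrier_vec n" "x \<in> carrier G" for v x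
  proof -
    have "\<rho> x *\<^sub>v J v = J (\<rho> x *\<^sub>v v)" using J that by (simp add: conj_linear_equivariant_def)
    then show ?thesis using arg_cong[OF F[OF rep_vec[OF rep that(2,1)]], of cnj] by (simp add: mcoeff_def F_def)
  qed
  moreover have "b' \<in> carrier_vec n" by (simp add: b'_def)
  ultimately show thesis using that by blast
qed

text \<open>From \<open>J v = \<alpha> v\<close> follows \<open>J (J v) =
  \<bar>\<alpha>\<bar>\<^sup>2 v\<close>.\<close>

lemma quaternionic_independent:
  assumes J: "conj_linear_equivariant G n \<rho> J" and JJ: "\<And>v. v \<in> carrier_vec n \<Longrightarrow> J (J v) = - v"
    and v: "v \<in> carrier_vec n" "v \<noteq> 0\<^sub>v n"
  shows "J v \<noteq> \<alpha> \<cdot>\<^sub>v v"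
proof
  assume eq: "J v = \<alpha> \<cdot>\<^sub>v v"
  have "- v = J (\<alpha> \<cdot>\<^sub>v v)" using JJ[OF v(1)] eq by simp
  also have "\<dots> = cnj \<alpha> \<cdot>\<^sub>v (\<alpha> \<cdot>\<^sub>v v)" using J v(1) eq by (simp add: conj_linear_equivariant_def)
  finally have e: "- v = cnj \<alpha> \<cdot>\<^sub>v (\<alpha> \<cdot>\<^sub>v v)" .
  have "v $ i = 0" if i: "i < n" for i
  proof -
    have "- (v $ i) = cnj \<alpha> * (\<alpha> * v $ i)" using arg_cong[OF e, of "\<lambda>v. v $ i"] i v(1) by simp
    then have "(1 + \<alpha> * cnj \<alpha>) * v $ i = 0" by (simp add: algebra_simps) (metis add.right_inverse mult.left_commute)
    moreover have "1 + \<alpha> * cnj \<alpha> \<noteq> 0"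
    proof
      assume "1 + \<alpha> * cnj \<alpha> = 0"
      then have "complex_of_real (1 + (cmod \<alpha>)\<^sup>2) = 0" by (simp add: complex_norm_square[symmetric])
      then have "1 + (cmod \<alpha>)\<^sup>2 = 0" by (simp only: of_real_eq_0_iff)
      then show False using zero_le_power2[of "cmod \<alpha>"] by linarith
    qed
    ultimately show ?thesis by simp
  qed
  then have "v = 0\<^sub>v n" using v(1) by (intro eq_vecI) auto
  then show False using v(2) by simp
qed

end

section \<open>Translation invariant function spaces\<close>

context finite_group
begin

text \<open>Complex spaces of functions on the group that are invariant under left translation.
  Functions that agree on the carrier are not distinguished.\<close>

definition invariant_fspace :: "('a \<Rightarrow> complex) set \<Rightarrow> bool" where
  "invariant_fspace X \<longleftrightarrow> (\<forall>f\<in>X. \<forall>h\<in>X. (\<lambda>x. f x + h x) \<in> X) \<and> (\<forall>c. \<forall>f\<in>X. (\<lambda>x. c * f x) \<in> X) \<and>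
     (\<forall>y\<in>carrier G. \<forall>f\<in>X. (\<lambda>x. f (y \<otimes> x)) \<in> X) \<and>
     (\<forall>f\<in>X. \<forall>h. (\<forall>x\<in>carrier G. f x = h x) \<longrightarrow> h \<in> X)"

lemma fspace_add: "invariant_fspace X \<Longrightarrow> f \<in> X \<Longrightarrow> h \<in> X \<Longrightarrow> (\<lambda>x. f x + h x) \<in> X"
  and fspace_mult: "invariant_fspace X \<Longrightarrow> f \<in> X \<Longrightarrow> (\<lambda>x. c * f x) \<in> X"
  and fspace_translate: "invariant_fspace X \<Longrightarrow> y \<in> carrier G \<Longrightarrow> f \<in> X \<Longrightarrow> (\<lambda>x. f (y \<otimes> x)) \<in> X"
  by (simp_all add: invariant_fspace_def)

lemma fspace_cong:
  assumes "invariant_fspace X" "f \<in> X" "\<And>x. x \<in> carrier G \<Longrightarrow> f x = h x"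
  shows "h \<in> X"
  using assms unfolding invariant_fspace_def by blast

lemma fspace_sum:
  assumes X: "invariant_fspace X" and ne: "X \<noteq> {}" and "finite A" "\<And>a. a \<in> A \<Longrightarrow> f a \<in> X"
  shows "(\<lambda>x. \<Sum>a\<in>A. f a x) \<in> X"
  using assms(3,4)
proof (induction rule: finite_induct)
  case empty
  obtain f where "f \<in> X" using ne by blast
  from fspace_mult[OF X this, of 0] show ?case by simp
next
  case (insert a A)
  then show ?case using fspace_add[OF X, of "f a" "\<lambda>x. \<Sum>a\<in>A. f a x"] by simp
qed

text \<open>The functions \<open>a \<bullet> \<rho>(x) v\<close> with \<open>v\<close> fixed form
  a translation invariant space; here \<open>v\<close> is nonzero and that space is contained in
  \<open>X\<close>.\<close>

definition generates_within :: "('a \<Rightarrow> complex) set \<Rightarrow> nat \<Rightarrow> ('a \<Rightarrow> complex mat) \<Rightarrow> complex Matrix.vec \<Rightarrow> bool" where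
  "generates_within X n \<rho> v \<longleftrightarrow> v \<in> carrier_vec n \<and> v \<noteq> 0\<^sub>v n \<and> (\<forall>a\<in>carrier_vec n. mcoeff \<rho> a v \<in> X)"

lemma generates_within_iso:
  assumes rep: "matrix_rep G n \<rho>" "matrix_rep G m \<sigma>" and iso: "rep_iso G n \<rho> m \<sigma>"
    and gen: "generates_within X n \<rho> v"
    and X: "invariant_fspace X"
  shows "\<exists>u. generates_within X m \<sigma> u"
proof -
  have nm: "n = m" using iso by (simp add: rep_iso_def)
  obtain T where T: "T \<in> carrier (GL n)" and eq: "\<And>g. g \<in> carrier G \<Longrightarrow> T * \<rho> g = \<sigma> g * T"
    using iso by (auto simp: rep_iso_def)
  obtain U where U: "U \<in> carrier_mat n n" "U * T = 1\<^sub>m n" and Tc: "T \<in> carrier_mat n n"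
    using T by (auto simp: carrier_GL_iff)
  have inter: "intertwiner n \<rho> m \<sigma> T" using Tc eq nm by (simp add: intertwiner_def)
  have v: "v \<in> carrier_vec n" "v \<noteq> 0\<^sub>v n" using gen by (simp_all add: generates_within_def)
  have "generates_within X m \<sigma> (T *\<^sub>v v)"
    unfolding generates_within_def
  proof (intro conjI ballI)
    show "T *\<^sub>v v \<in> carrier_vec m" using Tc v(1) nm by simp
    show "T *\<^sub>v v \<noteq> 0\<^sub>v m" using left_inverse_inj_mat[OF Tc U] v Tc nm by (auto simp: inj_mat_def)
    fix a :: "complex Matrix.vec" assume a: "a \<in> carrier_vec m"
    show "mcoeff \<sigma> a (T *\<^sub>v v) \<in> X"
    proof (rule fspace_cong[OF X])
      show "mcoeff \<rho> (transpose_mat T *\<^sub>v a) v \<in> X" using gen a Tc nm by (simp add: generates_within_def)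
    qed (rule mcoeff_iso[OF rep inter a v(1), symmetric])
  qed
  then show ?thesis by blast
qed

text \<open>Conjugating the coefficients of \<open>v\<close> gives those of the conjugate
  representation.\<close>

lemma generates_within_conj:
  assumes rep: "matrix_rep G n \<rho>" and gen: "generates_within X n \<rho> v" and X: "invariant_fspace X"
    and cnj: "\<And>f. f \<in> X \<Longrightarrow> (\<lambda>x. cnj (f x)) \<in> X"
  shows "generates_within X n (conj_rep \<rho>) (conjugate v)"
  unfolding generates_within_def
proof (intro conjI ballI)
  have v: "v \<in> carrier_vec n" "v \<noteq> 0\<^sub>v n" using gen by (simp_all add: generates_within_def)
  show "conjugate v \<in> carrier_vec n" using v(1) by simp
  show "conjugate v \<noteq> 0\<^sub>v n" using v(2) by (metis conjugate_id conjugate_zero_vec)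
  fix a :: "complex Matrix.vec" assume a: "a \<in> carrier_vec n"
  then have ca: "conjugate a \<in> carrier_vec n" by simp
  show "mcoeff (conj_rep \<rho>) a (conjugate v) \<in> X"
  proof (rule fspace_cong[OF X])
    show "(\<lambda>x. cnj (mcoeff \<rho> (conjugate a) v x)) \<in> X" using gen ca by (intro cnj) (simp add: generates_within_def)
  qed (use mcoeff_conj[OF rep ca v(1)] in simp)
qed

text \<open>The left translates of \<open>f\<close>, arranged as a vector, are transformed by the
  permutation matrices of the regular representation.\<close>

lemma regular_rep_generates_within:
  assumes X: "invariant_fspace X" and f: "f \<in> X" "x \<in> carrier G" "f x \<noteq> 0"
  shows "\<exists>n \<rho> v. matrix_rep G n \<rho> \<and> generates_within X n \<rho> v"
proof -
  obtain e where e: "bij_betw e {0..<card (carrier G)} (carrier G)" using ex_bij_betw_nat_finite[OF fin] by blast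
  define N where "N = card (carrier G)"
  define idx where "idx = the_inv_into {0..<N} e"
  have eG: "e i \<in> carrier G" if "i < N" for i using e that by (auto simp: bij_betw_def N_def)
  have idx: "idx g < N" "e (idx g) = g" if "g \<in> carrier G" for g
    using e that the_inv_into_into[of e "{0..<N}" g "{0..<N}"] f_the_inv_into_f[of e "{0..<N}" g]
    by (auto simp: bij_betw_def N_def idx_def)
  have idx_e: "idx (e i) = i" if "i < N" for i
    using e that the_inv_into_f_f[of e "{0..<N}" i] by (auto simp: bij_betw_def N_def idx_def)
  define \<rho> where "\<rho> y = Matrix.mat N N (\<lambda>(i, j). if j = idx (e i \<otimes> y) then 1 else (0::complex))" for y
  have \<rho>c: "\<rho> y \<in> carrier_mat N N" for y by (simp add: \<rho>_def)
  have act: "(\<rho> y *\<^sub>v u) $ i = u $ idx (e i \<otimes> y)" if "i < N" "y \<in> carrier G" "u \<in> carrier_vec N" for i y u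
  proof -
    have "(\<rho> y *\<^sub>v u) $ i = (\<Sum>j<N. (if j = idx (e i \<otimes> y) then 1 else 0) * u $ j)"
      using that by (simp add: \<rho>_def scalar_prod_def lessThan_atLeast0)
    also have "\<dots> = (\<Sum>j<N. if j = idx (e i \<otimes> y) then u $ j else 0)" by (rule sum.cong) auto
    also have "\<dots> = u $ idx (e i \<otimes> y)" using idx(1)[of "e i \<otimes> y"] eG[OF that(1)] that(2) by simp
    finally show ?thesis .
  qed
  have rep: "matrix_rep G N \<rho>"
    unfolding matrix_rep_def
  proof (intro conjI ballI \<rho>c)
    fix g h assume g: "g \<in> carrier G" and h: "h \<in> carrier G"
    show "\<rho> (g \<otimes> h) = \<rho> g * \<rho> h"
    proof (rule mat_eqI_mult_vec[OF \<rho>c mult_carrier_mat[OF \<rho>c \<rho>c]])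
      fix u :: "complex Matrix.vec" assume u: "u \<in> carrier_vec N"
      have hu: "\<rho> h *\<^sub>v u \<in> carrier_vec N" using \<rho>c u by (rule mult_mat_vec_carrier)
      have "\<rho> (g \<otimes> h) *\<^sub>v u = \<rho> g *\<^sub>v (\<rho> h *\<^sub>v u)"
      proof (rule eq_vecI)
        fix i assume "i < dim_vec (\<rho> g *\<^sub>v (\<rho> h *\<^sub>v u))"
        then have i: "i < N" using \<rho>c[of g] by simp
        have k: "e i \<otimes> g \<in> carrier G" using eG[OF i] g by simp
        have "(\<rho> g *\<^sub>v (\<rho> h *\<^sub>v u)) $ i = u $ idx (e i \<otimes> g \<otimes> h)"
          unfolding act[OF i g hu] act[OF idx(1)[OF k] h u] idx(2)[OF k] ..
        also have "e i \<otimes> g \<otimes> h = e i \<otimes> (g \<otimes> h)" using eG[OF i] g h by (rule m_assoc)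
        finally show "(\<rho> (g \<otimes> h) *\<^sub>v u) $ i = (\<rho> g *\<^sub>v (\<rho> h *\<^sub>v u)) $ i"
          using act[OF i m_closed[OF g h] u] by simp
      qed (simp add: \<rho>_def)
      then show "\<rho> (g \<otimes> h) *\<^sub>v u = (\<rho> g * \<rho> h) *\<^sub>v u" using assoc_mult_mat_vec[OF \<rho>c \<rho>c u] by simp
    qed
  next
    show "\<rho> \<one> = 1\<^sub>m N"
    proof (rule mat_eqI_mult_vec[OF \<rho>c one_carrier_mat])
      fix u :: "complex Matrix.vec" assume u: "u \<in> carrier_vec N"
      show "\<rho> \<one> *\<^sub>v u = 1\<^sub>m N *\<^sub>v u"
      proof (rule eq_vecI)
        fix i assume "i < dim_vec (1\<^sub>m N *\<^sub>v u)"
        then have i: "i < N" by simp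
        then show "(\<rho> \<one> *\<^sub>v u) $ i = (1\<^sub>m N *\<^sub>v u) $ i"
          unfolding act[OF i one_closed u] using eG[OF i] idx_e[OF i] u by simp
      qed (simp add: \<rho>_def)
    qed
  qed
  \<comment> \<open>The value at \<open>\<one>\<close> of the vector of all left translates of \<open>f\<close>.\<close>
  define v where "v = Matrix.vec N (\<lambda>i. f (e i))"
  have v: "v \<in> carrier_vec N" by (simp add: v_def)
  have "v $ idx x \<noteq> 0" using idx[OF f(2)] f(3) by (simp add: v_def)
  then have v0: "v \<noteq> 0\<^sub>v N" using idx(1)[OF f(2)] by auto
  have "mcoeff \<rho> a v \<in> X" if a: "a \<in> carrier_vec N" for a
  proof (rule fspace_cong[OF X])
    show "(\<lambda>x. \<Sum>i<N. a $ i * f (e i \<otimes> x)) \<in> X"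
      using f(1) by (intro fspace_sum[OF X] fspace_mult[OF X] fspace_translate[OF X] eG) auto
    fix x assume x: "x \<in> carrier G"
    have "mcoeff \<rho> a v x = (\<Sum>i<N. a $ i * (\<rho> x *\<^sub>v v) $ i)"
      unfolding mcoeff_def scalar_prod_def using \<rho>c[of x] by (simp add: lessThan_atLeast0 del: index_mult_mat_vec)
    also have "\<dots> = (\<Sum>i<N. a $ i * f (e i \<otimes> x))"
    proof (rule sum.cong[OF refl])
      fix i assume "i \<in> {..<N}"
      then have i: "i < N" by simp
      have k: "e i \<otimes> x \<in> carrier G" using eG[OF i] x by simp
      show "a $ i * (\<rho> x *\<^sub>v v) $ i = a $ i * f (e i \<otimes> x)"
        unfolding act[OF i x v] using idx[OF k] by (simp add: v_def)
    qed
    finally show "(\<Sum>i<N. a $ i * f (e i \<otimes> x)) = mcoeff \<rho> a v x" by simp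
  qed
  then show ?thesis using rep v v0 unfolding generates_within_def by blast
qed

text \<open>An equivariant image of \<open>v\<close> in a proper invariant subspace
  \<open>W\<close> replaces \<open>\<rho>\<close> by its restriction to \<open>W\<close>, which
  has smaller dimension.\<close>

lemma generates_within_reduce:
  assumes X: "invariant_fspace X" and rep: "matrix_rep G n \<rho>" and gen: "generates_within X n \<rho> v"
    and W: "invariant_subspace G n \<rho> W" "W \<noteq> carrier_vec n"
    and Q: "intertwiner n \<rho> n \<rho> Q" "Q *\<^sub>v v \<in> W" "Q *\<^sub>v v \<noteq> 0\<^sub>v n"
  shows "\<exists>k<n. \<exists>\<sigma> u. matrix_rep G k \<sigma> \<and> generates_within X k \<sigma> u"
proof -
  obtain k B where k: "k \<le> n" and B: "B \<in> carrier_mat n k" "inj_mat B" and img: "W = (\<lambda>u. B *\<^sub>v u) ` carrier_vec k"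
    using subspace_matrix_basis[of W n] W(1) unfolding invariant_subspace_def by metis
  obtain C where C: "C \<in> carrier_mat k n" "C * B = 1\<^sub>m k" using inj_mat_left_inverse[OF B] by blast
  have CB: "C *\<^sub>v (B *\<^sub>v u) = u" if "u \<in> carrier_vec k" for u
    using assoc_mult_mat_vec[OF C(1) B(1) that] C(2) that by simp
  have BC: "B *\<^sub>v (C *\<^sub>v w) = w" if "w \<in> W" for w using that CB unfolding img by force
  have "k \<noteq> n"
  proof
    assume kn: "k = n"
    have "B * C = 1\<^sub>m n" using mat_mult_left_right_inverse[of C n B] B(1) C kn by simp
    then have "u \<in> W" if "u \<in> carrier_vec n" for u
      using assoc_mult_mat_vec[OF B(1) C(1) that] that C(1) kn unfolding img by (intro image_eqI[of _ _ "C *\<^sub>v u"]) auto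
    then show False using W unfolding invariant_subspace_def by blast
  qed
  then have kn: "k < n" using k by simp
  have Wc: "w \<in> carrier_vec n" if "w \<in> W" for w using W(1) that by (auto simp: invariant_subspace_def)
  have Wg: "\<rho> g *\<^sub>v w \<in> W" if "w \<in> W" "g \<in> carrier G" for w g
    using W(1) that by (simp add: invariant_subspace_def)
  have BW: "B *\<^sub>v u \<in> W" if "u \<in> carrier_vec k" for u using that img by blast
  \<comment> \<open>The action on \<open>W\<close>, written in the basis formed by the columns of \<open>B\<close>.\<close>
  define \<sigma> where "\<sigma> g = C * (\<rho> g * B)" for g
  have \<sigma>c: "\<sigma> g \<in> carrier_mat k k" if "g \<in> carrier G" for g
    unfolding \<sigma>_def using C(1) mult_carrier_mat[OF rep_carrier[OF rep that] B(1)] by (rule mult_carrier_mat)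
  have \<sigma>v: "\<sigma> g *\<^sub>v u = C *\<^sub>v (\<rho> g *\<^sub>v (B *\<^sub>v u))" if "g \<in> carrier G" "u \<in> carrier_vec k" for g u
    unfolding \<sigma>_def
    using assoc_mult_mat_vec[OF C(1) mult_carrier_mat[OF rep_carrier[OF rep that(1)] B(1)] that(2)]
      assoc_mult_mat_vec[OF rep_carrier[OF rep that(1)] B(1) that(2)] by simp
  have "matrix_rep G k \<sigma>"
    unfolding matrix_rep_def
  proof (intro conjI ballI \<sigma>c)
    fix g h assume g: "g \<in> carrier G" and h: "h \<in> carrier G"
    show "\<sigma> (g \<otimes> h) = \<sigma> g * \<sigma> h"
    proof (rule mat_eqI_mult_vec[OF \<sigma>c[OF m_closed[OF g h]] mult_carrier_mat[OF \<sigma>c[OF g] \<sigma>c[OF h]]])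
      fix u :: "complex Matrix.vec" assume u: "u \<in> carrier_vec k"
      have hu: "\<sigma> h *\<^sub>v u \<in> carrier_vec k" using \<sigma>c[OF h] u by (rule mult_mat_vec_carrier)
      have "B *\<^sub>v (\<sigma> h *\<^sub>v u) = \<rho> h *\<^sub>v (B *\<^sub>v u)" unfolding \<sigma>v[OF h u] by (rule BC[OF Wg[OF BW[OF u] h]])
      then show "\<sigma> (g \<otimes> h) *\<^sub>v u = (\<sigma> g * \<sigma> h) *\<^sub>v u"
        unfolding assoc_mult_mat_vec[OF \<sigma>c[OF g] \<sigma>c[OF h] u] \<sigma>v[OF g hu] \<sigma>v[OF m_closed[OF g h] u]
        by (simp only: rep_mult_vec[OF rep g h Wc[OF BW[OF u]]])
    qed
  next
    show "\<sigma> \<one> = 1\<^sub>m k" unfolding \<sigma>_def rep_one[OF rep] using B(1) C(2) by simp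
  qed
  moreover have "generates_within X k \<sigma> (C *\<^sub>v (Q *\<^sub>v v))"
    unfolding generates_within_def
  proof (intro conjI ballI)
    have Qc: "Q \<in> carrier_mat n n" using Q(1) by (simp add: intertwiner_def)
    have v: "v \<in> carrier_vec n" using gen by (simp add: generates_within_def)
    show u: "C *\<^sub>v (Q *\<^sub>v v) \<in> carrier_vec k" using C(1) Qc v by simp
    have Bu: "B *\<^sub>v (C *\<^sub>v (Q *\<^sub>v v)) = Q *\<^sub>v v" by (rule BC[OF Q(2)])
    show "C *\<^sub>v (Q *\<^sub>v v) \<noteq> 0\<^sub>v k"
    proof
      assume "C *\<^sub>v (Q *\<^sub>v v) = 0\<^sub>v k"
      then have "Q *\<^sub>v v = B *\<^sub>v 0\<^sub>v k" using Bu by simp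
      also have "\<dots> = 0\<^sub>v n" using B(1) by (auto intro!: eq_vecI)
      finally show False using Q(3) by simp
    qed
    fix a :: "complex Matrix.vec" assume a: "a \<in> carrier_vec k"
    define b where "b = transpose_mat Q *\<^sub>v (transpose_mat C *\<^sub>v a)"
    have Ca: "transpose_mat C *\<^sub>v a \<in> carrier_vec n" using C(1) a by simp
    have b: "b \<in> carrier_vec n" unfolding b_def using Qc Ca by simp
    show "mcoeff \<sigma> a (C *\<^sub>v (Q *\<^sub>v v)) \<in> X"
    proof (rule fspace_cong[OF X])
      show "mcoeff \<rho> b v \<in> X" using gen b by (simp add: generates_within_def)
      fix x assume x: "x \<in> carrier G"
      have xv: "\<rho> x *\<^sub>v v \<in> carrier_vec n" by (rule rep_vec[OF rep x v])
      have Qxv: "Q *\<^sub>v (\<rho> x *\<^sub>v v) \<in> carrier_vec n" using Qc xv by (rule mult_mat_vec_carrier)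
      have "mcoeff \<sigma> a (C *\<^sub>v (Q *\<^sub>v v)) x = a \<bullet> (C *\<^sub>v (Q *\<^sub>v (\<rho> x *\<^sub>v v)))"
        unfolding mcoeff_def \<sigma>v[OF x u] Bu intertwiner_mult_vec[OF Q(1) rep rep x v] ..
      also have "\<dots> = mcoeff \<rho> b v x"
        unfolding mcoeff_def b_def scalar_prod_mult_mat_vec[OF C(1) Qxv a] scalar_prod_mult_mat_vec[OF Qc xv Ca] ..
      finally show "mcoeff \<rho> b v x = mcoeff \<sigma> a (C *\<^sub>v (Q *\<^sub>v v)) x" by simp
    qed
  qed
  ultimately show ?thesis using kn by blast
qed

text \<open>Maschke's theorem, with the projection to \<open>W\<close> scaled by the order of the
  group.\<close>

lemma invariant_projection:
  assumes rep: "matrix_rep G n \<rho>" and W: "invariant_subspace G n \<rho> W"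
  obtains T where "intertwiner n \<rho> n \<rho> T" "\<And>u. u \<in> carrier_vec n \<Longrightarrow> T *\<^sub>v u \<in> W"
    "\<And>w. w \<in> W \<Longrightarrow> T *\<^sub>v w = of_nat (card (carrier G)) \<cdot>\<^sub>v w"
proof -
  obtain k B where k: "k \<le> n" and B: "B \<in> carrier_mat n k" "inj_mat B" and img: "W = (\<lambda>u. B *\<^sub>v u) ` carrier_vec k"
    using subspace_matrix_basis[of W n] W(1) unfolding invariant_subspace_def by metis
  obtain C where C: "C \<in> carrier_mat k n" "C * B = 1\<^sub>m k" using inj_mat_left_inverse[OF B] by blast
  have Wc: "w \<in> carrier_vec n" if "w \<in> W" for w using W(1) that by (auto simp: invariant_subspace_def)
  have Wg: "\<rho> g *\<^sub>v w \<in> W" if "w \<in> W" "g \<in> carrier G" for w g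
    using W(1) that by (simp add: invariant_subspace_def)
  let ?P = "B * C"
  have P: "?P \<in> carrier_mat n n" using B(1) C(1) by simp
  have Pu: "?P *\<^sub>v u \<in> W" if "u \<in> carrier_vec n" for u
    using assoc_mult_mat_vec[OF B(1) C(1) that] mult_mat_vec_carrier[OF C(1) that] img by auto
  have PW: "?P *\<^sub>v w = w" if w: "w \<in> W" for w
  proof -
    obtain u where u: "u \<in> carrier_vec k" "w = B *\<^sub>v u" using w img by blast
    have "C *\<^sub>v (B *\<^sub>v u) = u" using assoc_mult_mat_vec[OF C(1) B(1) u(1)] C(2) u(1) by simp
    then show ?thesis using assoc_mult_mat_vec[OF B(1) C(1) Wc[OF w]] u by simp
  qed
  \<comment> \<open>The average over \<open>G\<close> of a projection to \<open>W\<close>, without the factor \<open>1 / card (carrier G)\<close>.\<close>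
  define T where "T = averaged n \<rho> n \<rho> ?P"
  have Tc: "T \<in> carrier_mat n n" by (simp add: T_def averaged_def)
  have summand: "\<rho> g * ?P * \<rho> (inv g) \<in> carrier_mat n n" if "g \<in> carrier G" for g
    by (rule mult_carrier_mat[OF mult_carrier_mat[OF rep_carrier[OF rep that] P] rep_carrier[OF rep inv_closed[OF that]]])
  have summand_vec: "(\<rho> g * ?P * \<rho> (inv g)) *\<^sub>v u = \<rho> g *\<^sub>v (?P *\<^sub>v (\<rho> (inv g) *\<^sub>v u))"
    if g: "g \<in> carrier G" and u: "u \<in> carrier_vec n" for g u
    using assoc_mult_mat_vec[OF mult_carrier_mat[OF rep_carrier[OF rep g] P] rep_carrier[OF rep inv_closed[OF g]] u]
      assoc_mult_mat_vec[OF rep_carrier[OF rep g] P rep_vec[OF rep inv_closed[OF g] u]] by simp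
  have "?P * T = T"
  proof -
    have "?P * T = mat_sum n n (\<lambda>g. ?P * (\<rho> g * ?P * \<rho> (inv g))) (carrier G)"
      unfolding T_def averaged_def by (rule mult_mat_sum[OF P summand])
    also have "\<dots> = T"
      unfolding T_def averaged_def
    proof (rule mat_sum_cong)
      fix g assume g: "g \<in> carrier G"
      show "?P * (\<rho> g * ?P * \<rho> (inv g)) = \<rho> g * ?P * \<rho> (inv g)"
      proof (rule mat_eqI_mult_vec[OF mult_carrier_mat[OF P summand[OF g]] summand[OF g]])
        fix u :: "complex Matrix.vec" assume u: "u \<in> carrier_vec n"
        show "(?P * (\<rho> g * ?P * \<rho> (inv g))) *\<^sub>v u = (\<rho> g * ?P * \<rho> (inv g)) *\<^sub>v u"
          unfolding assoc_mult_mat_vec[OF P summand[OF g] u] summand_vec[OF g u]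
          by (rule PW[OF Wg[OF Pu[OF rep_vec[OF rep inv_closed[OF g] u]] g]])
      qed
    qed
    finally show ?thesis .
  qed
  then have "T *\<^sub>v u \<in> W" if "u \<in> carrier_vec n" for u
    using assoc_mult_mat_vec[OF P Tc that] Pu[OF mult_mat_vec_carrier[OF Tc that]] by simp
  moreover have "T *\<^sub>v w = of_nat (card (carrier G)) \<cdot>\<^sub>v w" if w: "w \<in> W" for w
  proof (rule scalar_prod_left_cancel)
    fix a :: "complex Matrix.vec" assume a: "a \<in> carrier_vec n"
    have "a \<bullet> (T *\<^sub>v w) = (\<Sum>g\<in>carrier G. a \<bullet> ((\<rho> g * ?P * \<rho> (inv g)) *\<^sub>v w))"
      unfolding T_def averaged_def by (rule scalar_prod_mat_sum[OF a Wc[OF w] summand])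
    also have "\<dots> = (\<Sum>g\<in>carrier G. a \<bullet> w)"
    proof (rule sum.cong[OF refl])
      fix g assume g: "g \<in> carrier G"
      have "\<rho> g *\<^sub>v (\<rho> (inv g) *\<^sub>v w) = w"
        using rep_mult_vec[OF rep g inv_closed[OF g] Wc[OF w]] g Wc[OF w] by (simp add: rep_one[OF rep])
      then show "a \<bullet> ((\<rho> g * ?P * \<rho> (inv g)) *\<^sub>v w) = a \<bullet> w"
        unfolding summand_vec[OF g Wc[OF w]] PW[OF Wg[OF w inv_closed[OF g]]] by simp
    qed
    also have "\<dots> = a \<bullet> (of_nat (card (carrier G)) \<cdot>\<^sub>v w)"
      using scalar_prod_smult_distrib[OF a Wc[OF w], of "of_nat (card (carrier G))"] by simp
    finally show "a \<bullet> (T *\<^sub>v w) = a \<bullet> (of_nat (card (carrier G)) \<cdot>\<^sub>v w)" .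
  qed (use Tc Wc[OF w] in auto)
  moreover have "intertwiner n \<rho> n \<rho> T" unfolding T_def by (rule averaged_intertwiner[OF rep rep P])
  ultimately show thesis using that by blast
qed

text \<open>Choose a representation of minimal dimension among those with coefficients in
  \<open>X\<close>. If it had a proper invariant subspace, then either the projection to that
  subspace or the kernel of the projection would contain a nonzero equivariant image of
  \<open>v\<close>, contrary to minimality.\<close>

theorem invariant_fspace_contains_irrep:
  assumes X: "invariant_fspace X" and f: "f \<in> X" "x \<in> carrier G" "f x \<noteq> 0"
  shows "\<exists>n \<rho> v. complex_irrep G n \<rho> \<and> generates_within X n \<rho> v"
proof -
  define P where "P n \<longleftrightarrow> (\<exists>\<rho> v. matrix_rep G n \<rho> \<and> generates_within X n \<rho> v)" for n
  have ex: "\<exists>n. P n" using regular_rep_generates_within[OF X f] unfolding P_def .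
  define n where "n = (LEAST n. P n)"
  have "P n" unfolding n_def using ex by (rule LeastI_ex)
  then obtain \<rho> v where rep: "matrix_rep G n \<rho>" and gen: "generates_within X n \<rho> v" unfolding P_def by blast
  have minimal: "\<not> (\<exists>k<n. \<exists>\<sigma> u. matrix_rep G k \<sigma> \<and> generates_within X k \<sigma> u)"
    using not_less_Least[of _ P] unfolding n_def P_def by blast
  have v: "v \<in> carrier_vec n" "v \<noteq> 0\<^sub>v n" using gen by (simp_all add: generates_within_def)
  have "n > 0"
  proof (rule ccontr)
    assume "\<not> n > 0"
    then have "v = 0\<^sub>v n" using v(1) by (intro eq_vecI) auto
    then show False using v(2) by simp
  qed
  moreover have "W = {0\<^sub>v n} \<or> W = carrier_vec n" if W: "invariant_subspace G n \<rho> W" for W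
  proof (rule ccontr)
    assume contra: "\<not> ?thesis"
    then obtain w where w: "w \<in> W" "w \<noteq> 0\<^sub>v n" using W unfolding invariant_subspace_def by blast
    have wc: "w \<in> carrier_vec n" using w(1) W unfolding invariant_subspace_def by blast
    obtain T where T: "intertwiner n \<rho> n \<rho> T" and TW: "\<And>u. u \<in> carrier_vec n \<Longrightarrow> T *\<^sub>v u \<in> W"
      and Tw: "\<And>w. w \<in> W \<Longrightarrow> T *\<^sub>v w = of_nat (card (carrier G)) \<cdot>\<^sub>v w"
      using invariant_projection[OF rep W] by metis
    have Tc: "T \<in> carrier_mat n n" using T by (simp add: intertwiner_def)
    show False
    proof (cases "T *\<^sub>v v = 0\<^sub>v n")
      case False
      then show False
        using generates_within_reduce[OF X rep gen W _ T TW[OF v(1)]] contra minimal by blast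
    next
      case True
      let ?K = "{u \<in> carrier_vec n. T *\<^sub>v u = 0\<^sub>v n}"
      have K: "invariant_subspace G n \<rho> ?K" by (rule intertwiner_kernel_invariant[OF T rep rep])
      have "w \<notin> ?K"
      proof
        assume "w \<in> ?K"
        then have z: "complex_of_nat (card (carrier G)) \<cdot>\<^sub>v w = 0\<^sub>v n" using Tw[OF w(1)] by simp
        have "(of_nat (card (carrier G)) :: complex) \<noteq> 0" using fin one_closed by (auto simp: card_eq_0_iff)
        then have "w $ i = 0" if "i < n" for i
          using that wc arg_cong[OF z, of "\<lambda>u. u $ i"] by simp
        then have "w = 0\<^sub>v n" using wc by (intro eq_vecI) auto
        then show False using w(2) by simp
      qed
      then have "?K \<noteq> carrier_vec n" using wc by blast
      moreover have "intertwiner n \<rho> n \<rho> (1\<^sub>m n)"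
        using left_mult_one_mat[OF rep_carrier[OF rep]] right_mult_one_mat[OF rep_carrier[OF rep]]
        by (simp add: intertwiner_def)
      moreover have "1\<^sub>m n *\<^sub>v v = v" using v(1) by simp
      ultimately show False
        using generates_within_reduce[OF X rep gen K, of "1\<^sub>m n"] True v minimal by simp
    qed
  qed
  ultimately have "complex_irrep G n \<rho>" using rep unfolding complex_irrep_iff by blast
  then show ?thesis using gen by blast
qed

definition cinner :: "('a \<Rightarrow> complex) \<Rightarrow> ('a \<Rightarrow> complex) \<Rightarrow> complex" where
  "cinner f h = (\<Sum>x\<in>carrier G. f x * cnj (h x))"

lemma cinner_eq_0:
  assumes "cinner f f = 0" "x \<in> carrier G"
  shows "f x = 0"
proof -
  have "cinner f f = complex_of_real (\<Sum>x\<in>carrier G. (cmod (f x))\<^sup>2)"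
    by (simp only: cinner_def of_real_sum complex_norm_square)
  then have "(\<Sum>x\<in>carrier G. (cmod (f x))\<^sup>2) = 0" using assms(1) by (metis of_real_eq_0_iff)
  then have "\<forall>x\<in>carrier G. (cmod (f x))\<^sup>2 = 0" by (subst (asm) sum_nonneg_eq_0_iff[OF fin]) auto
  then show ?thesis using assms(2) by simp
qed

lemma cinner_shift:
  assumes t: "t \<in> carrier G"
  shows "(\<Sum>x\<in>carrier G. f (x \<otimes> t) * cnj (h x)) = (\<Sum>x\<in>carrier G. f x * cnj (h (x \<otimes> inv t)))"
proof -
  have "(\<Sum>x\<in>carrier G. f x * cnj (h (x \<otimes> inv t))) = (\<Sum>x\<in>carrier G. f (x \<otimes> t) * cnj (h (x \<otimes> t \<otimes> inv t)))"
    by (rule sum.reindex_bij_betw[OF bij_right_mult[OF t], symmetric])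
  also have "\<dots> = (\<Sum>x\<in>carrier G. f (x \<otimes> t) * cnj (h x))"
    using t by (intro sum.cong refl) (simp add: m_assoc)
  finally show ?thesis by simp
qed

lemma orthogonal_component:
  assumes X: "invariant_fspace X" "X \<noteq> {}" and f: "f \<notin> X"
  obtains h u where "u \<in> X" "\<And>x. h x = f x - u x" "\<exists>x\<in>carrier G. h x \<noteq> 0" "\<And>u'. u' \<in> X \<Longrightarrow> cinner h u' = 0"
proof -
  obtain e where e: "bij_betw e {0..<card (carrier G)} (carrier G)" using ex_bij_betw_nat_finite[OF fin] by blast
  define N where "N = card (carrier G)"
  define \<phi> where "\<phi> f = Matrix.vec N (\<lambda>i. f (e i))" for f :: "'a \<Rightarrow> complex"
  have \<phi>c: "\<phi> f \<in> carrier_vec N" for f by (simp add: \<phi>_def)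
  have inner: "cinner f h = \<phi> f \<bullet> conjugate (\<phi> h)" for f h
  proof -
    have "cinner f h = (\<Sum>i\<in>{0..<N}. f (e i) * cnj (h (e i)))"
      unfolding cinner_def N_def by (rule sum.reindex_bij_betw[OF e, symmetric])
    then show ?thesis by (simp add: \<phi>_def scalar_prod_def)
  qed
  have "\<phi> ` X \<subseteq> carrier_vec N" using \<phi>c by blast
  moreover have "0\<^sub>v N \<in> \<phi> ` X"
  proof -
    obtain f where "f \<in> X" using X(2) by blast
    then have "(\<lambda>x. 0 * f x) \<in> X" by (rule fspace_mult[OF X(1)])
    moreover have "\<phi> (\<lambda>x. 0 * f x) = 0\<^sub>v N" by (rule eq_vecI) (simp_all add: \<phi>_def)
    ultimately show ?thesis by force
  qed
  moreover have "u + v \<in> \<phi> ` X" if "u \<in> \<phi> ` X" "v \<in> \<phi> ` X" for u v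
  proof -
    obtain f h where fh: "f \<in> X" "h \<in> X" "u = \<phi> f" "v = \<phi> h" using \<open>u \<in> \<phi> ` X\<close> \<open>v \<in> \<phi> ` X\<close> by blast
    have "u + v = \<phi> (\<lambda>x. f x + h x)" unfolding fh by (rule eq_vecI) (simp_all add: \<phi>_def)
    then show ?thesis using fspace_add[OF X(1) fh(1,2)] by blast
  qed
  moreover have "c \<cdot>\<^sub>v u \<in> \<phi> ` X" if "u \<in> \<phi> ` X" for c u
  proof -
    obtain f where f: "f \<in> X" "u = \<phi> f" using \<open>u \<in> \<phi> ` X\<close> by blast
    have "c \<cdot>\<^sub>v u = \<phi> (\<lambda>x. c * f x)" unfolding f by (rule eq_vecI) (simp_all add: \<phi>_def)
    then show ?thesis using fspace_mult[OF X(1) f(1)] by blast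
  qed
  ultimately obtain k B where B: "B \<in> carrier_mat N k" "inj_mat B" and img: "\<phi> ` X = (\<lambda>u. B *\<^sub>v u) ` carrier_vec k"
    using subspace_matrix_basis[of "\<phi> ` X" N] by metis
  obtain C where C: "C \<in> carrier_mat k N" and adj: "adj B * (B * C) = adj B" using inj_mat_left_inverse[OF B] by blast
  have Cf: "C *\<^sub>v \<phi> f \<in> carrier_vec k" using C \<phi>c by (rule mult_mat_vec_carrier)
  then obtain u where u: "u \<in> X" "\<phi> u = B *\<^sub>v (C *\<^sub>v \<phi> f)" using img by (metis (no_types, lifting) image_iff)
  \<comment> \<open>\<open>B * C\<close> is the orthogonal projection onto the range of \<open>B\<close>.\<close>
  define h where "h x = f x - u x" for x
  have "\<phi> h = \<phi> f - \<phi> u" by (rule eq_vecI) (simp_all add: \<phi>_def h_def)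
  have aB: "adj B \<in> carrier_mat k N" using B(1) by simp
  have BCc: "B * C \<in> carrier_mat N N" using B(1) C by simp
  have "adj B *\<^sub>v \<phi> u = (adj B * (B * C)) *\<^sub>v \<phi> f"
    unfolding u(2) using assoc_mult_mat_vec[OF aB BCc \<phi>c] assoc_mult_mat_vec[OF B(1) C \<phi>c] by simp
  then have "adj B *\<^sub>v \<phi> h = 0\<^sub>v k"
    unfolding \<open>\<phi> h = \<phi> f - \<phi> u\<close> mult_minus_distrib_mat_vec[OF aB \<phi>c \<phi>c] adj
    using mult_mat_vec_carrier[OF aB \<phi>c] by simp
  then have orth: "cinner h u' = 0" if "u' \<in> X" for u'
  proof -
    have "\<phi> u' \<in> (\<lambda>u. B *\<^sub>v u) ` carrier_vec k" unfolding img[symmetric] using that by (rule imageI)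
    then obtain y where y: "y \<in> carrier_vec k" "\<phi> u' = B *\<^sub>v y" by (elim imageE)
    show ?thesis
      unfolding inner y(2) adj_scalar_prod[OF B(1) y(1) \<phi>c] \<open>adj B *\<^sub>v \<phi> h = 0\<^sub>v k\<close>
      using y(1) by simp
  qed
  have "\<exists>x\<in>carrier G. h x \<noteq> 0"
  proof (rule ccontr)
    assume "\<not> ?thesis"
    then have "f \<in> X" by (intro fspace_cong[OF X(1) u(1)]) (simp add: h_def)
    then show False using f by simp
  qed
  then show thesis using that u(1) h_def orth by blast
qed

end

section \<open>The operator on functions and on representations\<close>

lemma finsum_module_mat:
  fixes f :: "'b \<Rightarrow> complex mat"
  assumes "finite A" "\<And>a. a \<in> A \<Longrightarrow> f a \<in> carrier_mat n m"
  shows "finsum (module_mat TYPE(complex) n m) f A = mat_sum n m f A"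
proof -
  interpret M: abelian_group "module_mat TYPE(complex) n m" by (rule abelian_group_mat)
  show ?thesis
    using assms
  proof (induction rule: finite_induct)
    case empty
    show ?case unfolding M.finsum_empty by (rule eq_matI) (auto simp: mat_sum_def module_mat_simps)
  next
    case (insert a A)
    have "finsum (module_mat TYPE(complex) n m) f (insert a A) =
        f a \<oplus>\<^bsub>module_mat TYPE(complex) n m\<^esub> finsum (module_mat TYPE(complex) n m) f A"
      using insert.hyps insert.prems by (intro M.finsum_insert) (auto simp: module_mat_simps)
    also have "\<dots> = f a + mat_sum n m f A" using insert.IH insert.prems by (simp add: module_mat_simps)
    also have "\<dots> = mat_sum n m f (insert a A)"
      using insert.hyps insert.prems[of a] by (intro eq_matI) (auto simp: mat_sum_def)
    finally show ?case .
  qed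
qed

locale cayley_graph = finite_group +
  fixes S
  assumes S_subset: "S \<subseteq> carrier G" and S_inv: "\<And>s. s \<in> S \<Longrightarrow> inv s \<in> S"

context cayley_graph
begin

lemma finite_S: "finite S" using S_subset fin by (rule finite_subset)

lemma S_carrier: "s \<in> S \<Longrightarrow> s \<in> carrier G" using S_subset by blast

lemma coeff_at_inv: "s \<in> S \<Longrightarrow> coeff_at G w (inv s) = coeff_at G w s"
  using S_carrier[of s] by (simp add: coeff_at_def insert_commute)

definition step_square :: "nat \<Rightarrow> ('a \<Rightarrow> complex mat) \<Rightarrow> 'a \<Rightarrow> complex mat" where
  "step_square n \<rho> s = (\<rho> s - 1\<^sub>m n) * (\<rho> s - 1\<^sub>m n)"

lemma step_square_carrier:
  assumes "matrix_rep G n \<rho>" "s \<in> S"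
  shows "step_square n \<rho> s \<in> carrier_mat n n"
proof -
  have "\<rho> s - 1\<^sub>m n \<in> carrier_mat n n" by (rule minus_carrier_mat) simp
  from mult_carrier_mat[OF this this] show ?thesis unfolding step_square_def .
qed

text \<open>The sum in the module of matrices, entry by entry.\<close>

lemma D_op_eq:
  assumes rep: "matrix_rep G n \<rho>"
  shows "D_op G S n \<rho> w = mat_sum n n (\<lambda>s. complex_of_real (coeff_at G w s) \<cdot>\<^sub>m step_square n \<rho> s) S"
proof -
  have eq: "(\<rho> s - \<rho> \<one>) ^\<^sub>m 2 = step_square n \<rho> s" if "s \<in> S" for s
    using rep_carrier[OF rep S_carrier[OF that]]
    by (simp add: step_square_def numeral_2_eq_2 rep_one[OF rep])
  have "D_op G S n \<rho> w = mat_sum n n (\<lambda>s. complex_of_real (coeff_at G w s) \<cdot>\<^sub>m ((\<rho> s - \<rho> \<one>) ^\<^sub>m 2)) S"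
    unfolding D_op_def
  proof (rule finsum_module_mat[OF finite_S])
    show "complex_of_real (coeff_at G w s) \<cdot>\<^sub>m ((\<rho> s - \<rho> \<one>) ^\<^sub>m 2) \<in> carrier_mat n n" if "s \<in> S" for s
      unfolding eq[OF that] using step_square_carrier[OF rep that] by simp
  qed
  also have "\<dots> = mat_sum n n (\<lambda>s. complex_of_real (coeff_at G w s) \<cdot>\<^sub>m step_square n \<rho> s) S"
    by (rule mat_sum_cong) (simp only: eq)
  finally show ?thesis .
qed

lemma D_op_carrier: "matrix_rep G n \<rho> \<Longrightarrow> D_op G S n \<rho> w \<in> carrier_mat n n"
  by (simp add: D_op_eq)

lemma D_op_vec: "matrix_rep G n \<rho> \<Longrightarrow> v \<in> carrier_vec n \<Longrightarrow> D_op G S n \<rho> w *\<^sub>v v \<in> carrier_vec n"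
  by (rule mult_mat_vec_carrier[OF D_op_carrier])

lemma scalar_prod_D_op:
  assumes rep: "matrix_rep G n \<rho>" and b: "b \<in> carrier_vec n" and v: "v \<in> carrier_vec n"
  shows "b \<bullet> (D_op G S n \<rho> w *\<^sub>v v) = (\<Sum>s\<in>S. complex_of_real (coeff_at G w s) *
    (b \<bullet> (\<rho> (s \<otimes> s) *\<^sub>v v) - 2 * (b \<bullet> (\<rho> s *\<^sub>v v)) + b \<bullet> v))"
  unfolding D_op_eq[OF rep]
proof (subst scalar_prod_mat_sum[OF b v])
  show "(\<Sum>s\<in>S. b \<bullet> ((complex_of_real (coeff_at G w s) \<cdot>\<^sub>m step_square n \<rho> s) *\<^sub>v v)) =
    (\<Sum>s\<in>S. complex_of_real (coeff_at G w s) * (b \<bullet> (\<rho> (s \<otimes> s) *\<^sub>v v) - 2 * (b \<bullet> (\<rho> s *\<^sub>v v)) + b \<bullet> v))"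
  proof (rule sum.cong[OF refl])
    fix s assume s: "s \<in> S"
    let ?A = "\<rho> s - 1\<^sub>m n"
    have r: "\<rho> s \<in> carrier_mat n n" using rep_carrier[OF rep S_carrier[OF s]] .
    have A: "?A \<in> carrier_mat n n" using r by (intro minus_carrier_mat) simp
    have Au: "?A *\<^sub>v u = \<rho> s *\<^sub>v u - u" if "u \<in> carrier_vec n" for u
      using minus_mult_distrib_mat_vec[OF r one_carrier_mat that] that by simp
    have rv: "\<rho> s *\<^sub>v v \<in> carrier_vec n" using r v by simp
    have rrv: "\<rho> s *\<^sub>v (\<rho> s *\<^sub>v v) \<in> carrier_vec n" using r rv by simp
    have "step_square n \<rho> s *\<^sub>v v = ?A *\<^sub>v (\<rho> s *\<^sub>v v - v)"
      unfolding step_square_def using assoc_mult_mat_vec[OF A A v] Au[OF v] by simp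
    also have "\<dots> = \<rho> s *\<^sub>v (\<rho> s *\<^sub>v v - v) - (\<rho> s *\<^sub>v v - v)" using rv v by (intro Au) simp
    also have "\<rho> s *\<^sub>v (\<rho> s *\<^sub>v v - v) = \<rho> s *\<^sub>v (\<rho> s *\<^sub>v v) - \<rho> s *\<^sub>v v"
      by (rule mult_minus_distrib_mat_vec[OF r rv v])
    finally have "b \<bullet> (step_square n \<rho> s *\<^sub>v v) =
        (b \<bullet> (\<rho> s *\<^sub>v (\<rho> s *\<^sub>v v)) - b \<bullet> (\<rho> s *\<^sub>v v)) - (b \<bullet> (\<rho> s *\<^sub>v v) - b \<bullet> v)"
      using b v rv rrv by (simp add: scalar_prod_minus_distrib[of _ n])
    moreover have "\<rho> (s \<otimes> s) *\<^sub>v v = \<rho> s *\<^sub>v (\<rho> s *\<^sub>v v)"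
      by (rule rep_mult_vec[OF rep S_carrier[OF s] S_carrier[OF s] v])
    moreover have "b \<bullet> ((complex_of_real (coeff_at G w s) \<cdot>\<^sub>m step_square n \<rho> s) *\<^sub>v v) =
        complex_of_real (coeff_at G w s) * (b \<bullet> (step_square n \<rho> s *\<^sub>v v))"
      unfolding smult_mat_mult_vec[OF step_square_carrier[OF rep s] v]
      using b mult_mat_vec_carrier[OF step_square_carrier[OF rep s] v] by (rule scalar_prod_smult_distrib)
    ultimately show "b \<bullet> ((complex_of_real (coeff_at G w s) \<cdot>\<^sub>m step_square n \<rho> s) *\<^sub>v v) =
        complex_of_real (coeff_at G w s) * (b \<bullet> (\<rho> (s \<otimes> s) *\<^sub>v v) - 2 * (b \<bullet> (\<rho> s *\<^sub>v v)) + b \<bullet> v)"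
      by simp
  qed
qed (use step_square_carrier[OF rep] in simp)

text \<open>The operator on complex functions, of which \<open>L_op\<close> is the restriction to
  real functions.\<close>

definition complex_L :: "('a set \<Rightarrow> real) \<Rightarrow> ('a \<Rightarrow> complex) \<Rightarrow> 'a \<Rightarrow> complex" where
  "complex_L w f x = (\<Sum>s\<in>S. complex_of_real (coeff_at G w s) * (f (x \<otimes> (s \<otimes> s)) - 2 * f (x \<otimes> s) + f x))"

text \<open>The right translations in the operator act on the vector \<open>v\<close> of a matrix
  coefficient, and there they add up to \<open>D_op\<close>.\<close>

lemma complex_L_mcoeff:
  assumes rep: "matrix_rep G n \<rho>" and a: "a \<in> carrier_vec n" and v: "v \<in> carrier_vec n" and x: "x \<in> carrier G"
  shows "complex_L w (mcoeff \<rho> a v) x = mcoeff \<rho> a (D_op G S n \<rho> w *\<^sub>v v) x"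
proof -
  let ?b = "transpose_mat (\<rho> x) *\<^sub>v a"
  have b: "?b \<in> carrier_vec n" using rep_carrier[OF rep x] a by simp
  have m: "mcoeff \<rho> a u x = ?b \<bullet> u" if "u \<in> carrier_vec n" for u
    unfolding mcoeff_def by (rule scalar_prod_mult_mat_vec[OF rep_carrier[OF rep x] that a])
  have xy: "mcoeff \<rho> a v (x \<otimes> y) = ?b \<bullet> (\<rho> y *\<^sub>v v)" if "y \<in> carrier G" for y
    using mcoeff_translate[OF rep a v x that] by (simp add: mcoeff_def)
  have "complex_L w (mcoeff \<rho> a v) x = ?b \<bullet> (D_op G S n \<rho> w *\<^sub>v v)"
    unfolding complex_L_def scalar_prod_D_op[OF rep b v]
    using S_carrier by (intro sum.cong refl) (simp add: xy m[OF v])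
  then show ?thesis using m[OF D_op_vec[OF rep v]] by simp
qed

lemma complex_L_mcoeff_eigen:
  assumes rep: "matrix_rep G n \<rho>" and a: "a \<in> carrier_vec n" and v: "v \<in> carrier_vec n" and x: "x \<in> carrier G"
    and eig: "D_op G S n \<rho> w *\<^sub>v v = \<mu> \<cdot>\<^sub>v v"
  shows "complex_L w (mcoeff \<rho> a v) x = \<mu> * mcoeff \<rho> a v x"
  unfolding complex_L_mcoeff[OF rep a v x] eig by (rule mcoeff_smult[OF rep a v x])

lemma complex_L_cnj: "complex_L w (\<lambda>x. cnj (f x)) x = cnj (complex_L w f x)"
  by (simp add: complex_L_def)

lemma complex_L_add: "complex_L w (\<lambda>x. f x + h x) x = complex_L w f x + complex_L w h x"
  by (simp add: complex_L_def algebra_simps sum.distrib sum_subtractf)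

lemma complex_L_mult: "complex_L w (\<lambda>x. c * f x) x = c * complex_L w f x"
  by (simp add: complex_L_def algebra_simps sum.distrib sum_subtractf sum_distrib_left)

lemma complex_L_translate:
  assumes y: "y \<in> carrier G" and x: "x \<in> carrier G"
  shows "complex_L w (\<lambda>z. f (y \<otimes> z)) x = complex_L w f (y \<otimes> x)"
  unfolding complex_L_def using x y S_carrier by (intro sum.cong refl) (simp add: m_assoc)

lemma complex_L_cong: "(\<And>x. x \<in> carrier G \<Longrightarrow> f x = h x) \<Longrightarrow> x \<in> carrier G \<Longrightarrow> complex_L w f x = complex_L w h x"
  unfolding complex_L_def using S_carrier by (intro sum.cong refl) simp

text \<open>The adjoint of right translation by \<open>s\<close> is right translation by the
  inverse of \<open>s\<close>, which has the same weight.\<close>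

lemma complex_L_selfadjoint: "cinner (complex_L w f) h = cinner f (complex_L w h)"
proof -
  have "cinner (complex_L w f) h = (\<Sum>s\<in>S. complex_of_real (coeff_at G w s) * ((\<Sum>x\<in>carrier G. f (x \<otimes> (s \<otimes> s)) * cnj (h x))
      - 2 * (\<Sum>x\<in>carrier G. f (x \<otimes> s) * cnj (h x)) + (\<Sum>x\<in>carrier G. f x * cnj (h x))))"
    unfolding cinner_def complex_L_def sum_distrib_right
    by (subst sum.swap) (simp add: algebra_simps sum.distrib sum_subtractf sum_distrib_left)
  also have "\<dots> = (\<Sum>s\<in>S. complex_of_real (coeff_at G w (inv s)) * ((\<Sum>x\<in>carrier G. f x * cnj (h (x \<otimes> (inv s \<otimes> inv s))))
      - 2 * (\<Sum>x\<in>carrier G. f x * cnj (h (x \<otimes> inv s))) + (\<Sum>x\<in>carrier G. f x * cnj (h x))))"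
  proof (rule sum.cong[OF refl])
    fix s assume s: "s \<in> S"
    have "(\<Sum>x\<in>carrier G. f (x \<otimes> (s \<otimes> s)) * cnj (h x)) = (\<Sum>x\<in>carrier G. f x * cnj (h (x \<otimes> inv (s \<otimes> s))))"
      using S_carrier[OF s] by (intro cinner_shift) simp
    also have "inv (s \<otimes> s) = inv s \<otimes> inv s" using S_carrier[OF s] by (simp add: inv_mult_group)
    finally show "complex_of_real (coeff_at G w s) * ((\<Sum>x\<in>carrier G. f (x \<otimes> (s \<otimes> s)) * cnj (h x))
        - 2 * (\<Sum>x\<in>carrier G. f (x \<otimes> s) * cnj (h x)) + (\<Sum>x\<in>carrier G. f x * cnj (h x))) =
      complex_of_real (coeff_at G w (inv s)) * ((\<Sum>x\<in>carrier G. f x * cnj (h (x \<otimes> (inv s \<otimes> inv s))))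
        - 2 * (\<Sum>x\<in>carrier G. f x * cnj (h (x \<otimes> inv s))) + (\<Sum>x\<in>carrier G. f x * cnj (h x)))"
      by (simp only: cinner_shift[OF S_carrier[OF s]] coeff_at_inv[OF s])
  qed
  also have "\<dots> = (\<Sum>s\<in>S. complex_of_real (coeff_at G w s) * ((\<Sum>x\<in>carrier G. f x * cnj (h (x \<otimes> (s \<otimes> s))))
      - 2 * (\<Sum>x\<in>carrier G. f x * cnj (h (x \<otimes> s))) + (\<Sum>x\<in>carrier G. f x * cnj (h x))))"
  proof (rule sum.reindex_bij_betw)
    show "bij_betw (\<lambda>s. inv s) S S"
      by (rule bij_betw_byWitness[where f' = "\<lambda>s. inv s"]) (use S_inv S_carrier in auto)
  qed
  also have "\<dots> = (\<Sum>s\<in>S. \<Sum>x\<in>carrier G. f x *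
      cnj (complex_of_real (coeff_at G w s) * (h (x \<otimes> (s \<otimes> s)) - 2 * h (x \<otimes> s) + h x)))"
    by (simp add: algebra_simps sum.distrib sum_subtractf sum_distrib_left)
  also have "\<dots> = (\<Sum>x\<in>carrier G. \<Sum>s\<in>S. f x *
      cnj (complex_of_real (coeff_at G w s) * (h (x \<otimes> (s \<otimes> s)) - 2 * h (x \<otimes> s) + h x)))"
    by (rule sum.swap)
  also have "\<dots> = cinner f (complex_L w h)"
    unfolding cinner_def complex_L_def cnj_sum sum_distrib_left ..
  finally show ?thesis .
qed

text \<open>A matrix coefficient of the eigenvector is an eigenfunction of a self-adjoint
  operator.\<close>

lemma D_op_eigenvalue_real:
  assumes rep: "matrix_rep G n \<rho>" and v: "v \<in> carrier_vec n" "v \<noteq> 0\<^sub>v n"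
    and eig: "D_op G S n \<rho> w *\<^sub>v v = \<mu> \<cdot>\<^sub>v v"
  shows "cnj \<mu> = \<mu>"
proof -
  let ?f = "mcoeff \<rho> (conjugate v) v"
  have cv: "conjugate v \<in> carrier_vec n" using v by simp
  have "cinner (complex_L w ?f) ?f = \<mu> * cinner ?f ?f"
    unfolding cinner_def sum_distrib_left
    by (intro sum.cong refl) (simp add: complex_L_mcoeff_eigen[OF rep cv v(1) _ eig] mult.assoc)
  moreover have "cinner ?f (complex_L w ?f) = cnj \<mu> * cinner ?f ?f"
    unfolding cinner_def sum_distrib_left
    by (intro sum.cong refl) (simp add: complex_L_mcoeff_eigen[OF rep cv v(1) _ eig] ac_simps)
  moreover have "cinner ?f ?f \<noteq> 0"
  proof
    assume "cinner ?f ?f = 0"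
    from cinner_eq_0[OF this one_closed] have "conjugate v \<bullet> v = 0" by (simp add: mcoeff_one[OF rep v(1)])
    then show False using scalar_prod_conjugate_eq_0[OF v(1)] v(2) by simp
  qed
  ultimately show ?thesis using complex_L_selfadjoint[of w ?f ?f] by simp
qed

text \<open>Semisimplicity passes from the self-adjoint operator on functions to
  \<open>D_op\<close>, since the coefficient map \<open>v \<mapsto> mcoeff \<rho> a v\<close>
  intertwines the two. The functional \<open>a = cnj z\<close> makes the coefficient of
  \<open>z\<close> nonzero at \<open>\<one>\<close>.\<close>

lemma D_op_semisimple:
  assumes rep: "matrix_rep G n \<rho>"
  shows "semisimple_mat (D_op G S n \<rho> w)"
  unfolding semisimple_mat_def
proof (intro allI ballI impI)
  let ?D = "D_op G S n \<rho> w"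
  fix \<mu> v
  define z where "z = ?D *\<^sub>v v - \<mu> \<cdot>\<^sub>v v"
  assume "v \<in> carrier_vec (dim_row ?D)"
    and "?D *\<^sub>v (?D *\<^sub>v v - \<mu> \<cdot>\<^sub>v v) = \<mu> \<cdot>\<^sub>v (?D *\<^sub>v v - \<mu> \<cdot>\<^sub>v v)"
  then have v: "v \<in> carrier_vec n" and Dz: "?D *\<^sub>v z = \<mu> \<cdot>\<^sub>v z"
    using D_op_carrier[OF rep, of w] by (simp_all add: z_def)
  have Dv: "?D *\<^sub>v v \<in> carrier_vec n" by (rule D_op_vec[OF rep v])
  have z: "z \<in> carrier_vec n" using Dv v by (simp add: z_def)
  have "z = 0\<^sub>v n"
  proof (rule ccontr)
    assume nz: "z \<noteq> 0\<^sub>v n"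
    have real: "cnj \<mu> = \<mu>" by (rule D_op_eigenvalue_real[OF rep z nz Dz])
    have cz: "conjugate z \<in> carrier_vec n" using z by simp
    let ?f = "mcoeff \<rho> (conjugate z) v" and ?h = "mcoeff \<rho> (conjugate z) z"
    have h: "?h x = complex_L w ?f x - \<mu> * ?f x" if "x \<in> carrier G" for x
      using mcoeff_diff[OF rep cz Dv _ that, of "\<mu> \<cdot>\<^sub>v v"] mcoeff_smult[OF rep cz v that] complex_L_mcoeff[OF rep cz v that] v
      by (simp add: z_def)
    have "cinner ?h ?h = cinner (complex_L w ?f) ?h - \<mu> * cinner ?f ?h"
      unfolding cinner_def sum_distrib_left sum_subtractf[symmetric]
      by (intro sum.cong refl) (simp add: h left_diff_distrib mult.assoc)
    also have "cinner (complex_L w ?f) ?h = cinner ?f (complex_L w ?h)" by (rule complex_L_selfadjoint)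
    also have "\<dots> = \<mu> * cinner ?f ?h"
      unfolding cinner_def sum_distrib_left
      by (intro sum.cong refl) (simp add: complex_L_mcoeff_eigen[OF rep cz z _ Dz] real ac_simps)
    finally have "cinner ?h ?h = 0" by simp
    from cinner_eq_0[OF this one_closed] have "conjugate z \<bullet> z = 0" by (simp add: mcoeff_one[OF rep z])
    then show False using scalar_prod_conjugate_eq_0[OF z] nz by simp
  qed
  then show "?D *\<^sub>v v - \<mu> \<cdot>\<^sub>v v = 0\<^sub>v (dim_row ?D)"
    using D_op_carrier[OF rep, of w] by (simp add: z_def)
qed

text \<open>The weights are real, so the operator on functions commutes with complex conjugation,
  which \<open>J\<close> corresponds to.\<close>

lemma D_op_structure_map:
  assumes rep: "matrix_rep G n \<rho>" and J: "conj_linear_equivariant G n \<rho> J" and v: "v \<in> carrier_vec n"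
    and eig: "D_op G S n \<rho> w *\<^sub>v v = complex_of_real \<mu> \<cdot>\<^sub>v v"
  shows "D_op G S n \<rho> w *\<^sub>v J v = complex_of_real \<mu> \<cdot>\<^sub>v J v"
proof (rule scalar_prod_left_cancel)
  have Jv: "J v \<in> carrier_vec n" using J v by (auto simp: conj_linear_equivariant_def)
  show "D_op G S n \<rho> w *\<^sub>v J v \<in> carrier_vec n" by (rule D_op_vec[OF rep Jv])
  show "complex_of_real \<mu> \<cdot>\<^sub>v J v \<in> carrier_vec n" using Jv by simp
  fix a :: "complex Matrix.vec" assume a: "a \<in> carrier_vec n"
  obtain a' where a': "a' \<in> carrier_vec n"
    and eq: "\<And>v x. v \<in> carrier_vec n \<Longrightarrow> x \<in> carrier G \<Longrightarrow> mcoeff \<rho> a (J v) x = cnj (mcoeff \<rho> a' v x)"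
    using mcoeff_structure_map[OF rep J a] by metis
  have "a \<bullet> (D_op G S n \<rho> w *\<^sub>v J v) = complex_L w (mcoeff \<rho> a (J v)) \<one>"
    using complex_L_mcoeff[OF rep a Jv one_closed, of w] mcoeff_one[OF rep D_op_vec[OF rep Jv]] by simp
  also have "\<dots> = complex_L w (\<lambda>x. cnj (mcoeff \<rho> a' v x)) \<one>" using eq[OF v] by (rule complex_L_cong) simp_all
  also have "\<dots> = cnj (complex_L w (mcoeff \<rho> a' v) \<one>)" by (rule complex_L_cnj)
  also have "\<dots> = complex_of_real \<mu> * mcoeff \<rho> a (J v) \<one>"
    using complex_L_mcoeff_eigen[OF rep a' v one_closed eig] eq[OF v one_closed] by simp
  also have "\<dots> = a \<bullet> (complex_of_real \<mu> \<cdot>\<^sub>v J v)" using mcoeff_one[OF rep Jv] a Jv by simp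
  finally show "a \<bullet> (D_op G S n \<rho> w *\<^sub>v J v) = a \<bullet> (complex_of_real \<mu> \<cdot>\<^sub>v J v)" .
qed

lemma P_poly_degree:
  assumes "matrix_rep G n \<rho>"
  shows "degree (P_poly G S n \<rho> w) = n" "P_poly G S n \<rho> w \<noteq> 0"
  using degree_monic_char_poly[OF D_op_carrier[OF assms, of w]] unfolding P_poly_def by auto

lemma P_poly_root_iff:
  assumes rep: "matrix_rep G n \<rho>"
  shows "poly (P_poly G S n \<rho> w) x = 0 \<longleftrightarrow> (\<exists>v\<in>carrier_vec n. v \<noteq> 0\<^sub>v n \<and> D_op G S n \<rho> w *\<^sub>v v = x \<cdot>\<^sub>v v)"
  using eigenvalue_root_char_poly[OF D_op_carrier[OF rep, of w], of x] D_op_carrier[OF rep, of w]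
  unfolding P_poly_def eigenvalue_def eigenvector_def by auto

lemma P_poly_root_eigenvector:
  assumes rep: "matrix_rep G n \<rho>" and "poly (P_poly G S n \<rho> w) x = 0"
  obtains \<mu> v where "x = complex_of_real \<mu>" "v \<in> carrier_vec n" "v \<noteq> 0\<^sub>v n"
    "D_op G S n \<rho> w *\<^sub>v v = complex_of_real \<mu> \<cdot>\<^sub>v v"
proof -
  obtain v where v: "v \<in> carrier_vec n" "v \<noteq> 0\<^sub>v n" "D_op G S n \<rho> w *\<^sub>v v = x \<cdot>\<^sub>v v"
    using assms(2) unfolding P_poly_root_iff[OF rep] by blast
  have "x \<in> \<real>" using D_op_eigenvalue_real[OF rep v] by (simp add: Reals_cnj_iff)
  then obtain \<mu> where "x = complex_of_real \<mu>" by (elim Reals_cases)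
  then show thesis using that v by blast
qed

lemma P_poly_iso:
  assumes rep: "matrix_rep G n \<rho>" "matrix_rep G m \<sigma>" and iso: "rep_iso G n \<rho> m \<sigma>"
  shows "P_poly G S n \<rho> w = P_poly G S m \<sigma> w"
proof -
  have nm: "m = n" using iso by (simp add: rep_iso_def)
  obtain T where T: "T \<in> carrier (GL n)" and eq: "\<And>g. g \<in> carrier G \<Longrightarrow> T * \<rho> g = \<sigma> g * T"
    using iso by (auto simp: rep_iso_def)
  obtain U where U: "U \<in> carrier_mat n n" "U * T = 1\<^sub>m n" "T * U = 1\<^sub>m n" and Tc: "T \<in> carrier_mat n n"
    using T by (auto simp: carrier_GL_iff)
  have rep2: "matrix_rep G n \<sigma>" using rep(2) nm by simp
  have inter: "intertwiner n \<rho> n \<sigma> T" using Tc eq by (simp add: intertwiner_def)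
  let ?D = "D_op G S n \<rho> w" and ?D' = "D_op G S n \<sigma> w"
  have Dc: "?D \<in> carrier_mat n n" "?D' \<in> carrier_mat n n" using D_op_carrier rep(1) rep2 by blast+
  have "T * ?D = ?D' * T"
  proof (rule mat_eqI_mult_vec[OF mult_carrier_mat[OF Tc Dc(1)] mult_carrier_mat[OF Dc(2) Tc]])
    fix v :: "complex Matrix.vec" assume v: "v \<in> carrier_vec n"
    have Tv: "T *\<^sub>v v \<in> carrier_vec n" using Tc v by simp
    have "T *\<^sub>v (?D *\<^sub>v v) = ?D' *\<^sub>v (T *\<^sub>v v)"
    proof (rule scalar_prod_left_cancel)
      show "T *\<^sub>v (?D *\<^sub>v v) \<in> carrier_vec n" using Tc D_op_vec[OF rep(1) v] by simp
      show "?D' *\<^sub>v (T *\<^sub>v v) \<in> carrier_vec n" by (rule D_op_vec[OF rep2 Tv])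
      fix a :: "complex Matrix.vec" assume a: "a \<in> carrier_vec n"
      have Ta: "transpose_mat T *\<^sub>v a \<in> carrier_vec n" using Tc a by simp
      have move: "(transpose_mat T *\<^sub>v a) \<bullet> u = a \<bullet> (T *\<^sub>v u)" if "u \<in> carrier_vec n" for u
        by (rule scalar_prod_mult_mat_vec[OF Tc that a, symmetric])
      have act: "(transpose_mat T *\<^sub>v a) \<bullet> (\<rho> g *\<^sub>v v) = a \<bullet> (\<sigma> g *\<^sub>v (T *\<^sub>v v))" if g: "g \<in> carrier G" for g
        unfolding move[OF rep_vec[OF rep(1) g v]] intertwiner_mult_vec[OF inter rep(1) rep2 g v] ..
      show "a \<bullet> (T *\<^sub>v (?D *\<^sub>v v)) = a \<bullet> (?D' *\<^sub>v (T *\<^sub>v v))"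
        unfolding move[OF D_op_vec[OF rep(1) v], symmetric] scalar_prod_D_op[OF rep(1) Ta v] scalar_prod_D_op[OF rep2 a Tv]
        using S_carrier by (intro sum.cong refl) (simp add: act move[OF v])
    qed
    then show "(T * ?D) *\<^sub>v v = (?D' * T) *\<^sub>v v"
      using assoc_mult_mat_vec[OF Tc Dc(1) v] assoc_mult_mat_vec[OF Dc(2) Tc v] by simp
  qed
  then have "?D = U * ?D' * T"
    using assoc_mult_mat[OF U(1) Dc(2) Tc] assoc_mult_mat[OF U(1) Tc Dc(1)] U(2) Dc(1) by simp
  then have "similar_mat ?D ?D'"
    unfolding similar_mat_def similar_mat_wit_def using U Tc Dc by (intro exI[of _ U] exI[of _ T]) (simp add: Let_def)
  then show ?thesis unfolding P_poly_def nm by (rule char_poly_similar)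
qed

lemma polyfun_coeffs_P_poly:
  assumes rep: "matrix_rep G n \<rho>"
  shows "polyfun_coeffs (inverse_pairs G S) (\<lambda>w. P_poly G S n \<rho> w)"
  unfolding P_poly_def
proof (rule polyfun_coeffs_char_poly[OF D_op_carrier[OF rep]])
  fix i j assume ij: "i < n" "j < n"
  have "(\<lambda>w. D_op G S n \<rho> w $$ (i, j)) =
      (\<lambda>w. \<Sum>s\<in>S. complex_of_real (w {s, inv s}) * step_square n \<rho> s $$ (i, j))"
  proof
    fix w
    have "D_op G S n \<rho> w $$ (i, j) = (\<Sum>s\<in>S. (complex_of_real (coeff_at G w s) \<cdot>\<^sub>m step_square n \<rho> s) $$ (i, j))"
      unfolding D_op_eq[OF rep] using ij by (simp add: mat_sum_def)
    also have "\<dots> = (\<Sum>s\<in>S. complex_of_real (w {s, inv s}) * step_square n \<rho> s $$ (i, j))"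
    proof (rule sum.cong[OF refl])
      fix s assume s: "s \<in> S"
      show "(complex_of_real (coeff_at G w s) \<cdot>\<^sub>m step_square n \<rho> s) $$ (i, j) =
          complex_of_real (w {s, inv s}) * step_square n \<rho> s $$ (i, j)"
        using carrier_matD[OF step_square_carrier[OF rep s]] ij by (simp add: coeff_at_def)
    qed
    finally show "D_op G S n \<rho> w $$ (i, j) = (\<Sum>s\<in>S. complex_of_real (w {s, inv s}) * step_square n \<rho> s $$ (i, j))" .
  qed
  moreover have "polyfun (inverse_pairs G S) (\<lambda>w. \<Sum>s\<in>S. complex_of_real (w {s, inv s}) * step_square n \<rho> s $$ (i, j))"
    by (intro polyfun_sum polyfun.mult polyfun.const polyfun.coord) (simp add: inverse_pairs_def)
  ultimately show "polyfun (inverse_pairs G S) (\<lambda>w. D_op G S n \<rho> w $$ (i, j))" by (simp only:)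
qed

end

section \<open>Real eigenspaces and their complexifications\<close>

context cayley_graph
begin

lemma subrep_real_functions_iff:
  "subrep class_ring (real_functions G) G (left_regular G) U \<longleftrightarrow>
     U \<subseteq> carrier G \<rightarrow>\<^sub>E UNIV \<and> (\<lambda>x\<in>carrier G. 0) \<in> U \<and>
     (\<forall>f\<in>U. \<forall>h\<in>U. (\<lambda>x\<in>carrier G. f x + h x) \<in> U) \<and> (\<forall>c. \<forall>f\<in>U. (\<lambda>x\<in>carrier G. c * f x) \<in> U) \<and>
     (\<forall>g\<in>carrier G. \<forall>f\<in>U. left_regular G g f \<in> U)"
  unfolding subrep_def subspace_iff[OF vectorspace_real_functions] by (simp add: real_functions_def)

lemma zero_real_functions: "\<zero>\<^bsub>real_functions G\<^esub> = (\<lambda>x\<in>carrier G. 0)"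
  by (simp add: real_functions_def)

text \<open>The real and imaginary parts have to be cut down to the carrier, because
  \<open>real_functions\<close> consists of extensional functions.\<close>

definition complexification :: "('a \<Rightarrow> real) set \<Rightarrow> ('a \<Rightarrow> complex) set" where
  "complexification U = {f. (\<lambda>x\<in>carrier G. Re (f x)) \<in> U \<and> (\<lambda>x\<in>carrier G. Im (f x)) \<in> U}"

lemma invariant_fspace_complexification:
  assumes U: "subrep class_ring (real_functions G) G (left_regular G) U"
  shows "invariant_fspace (complexification U)"
proof -
  have add: "(\<lambda>x\<in>carrier G. f x + h x) \<in> U" if "f \<in> U" "h \<in> U" for f h
    using U that unfolding subrep_real_functions_iff by blast
  have mult: "(\<lambda>x\<in>carrier G. c * f x) \<in> U" if "f \<in> U" for c f
    using U that unfolding subrep_real_functions_iff by blast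
  have trans: "left_regular G g f \<in> U" if "f \<in> U" "g \<in> carrier G" for g f
    using U that unfolding subrep_real_functions_iff by blast
  show ?thesis
    unfolding invariant_fspace_def
  proof (intro conjI ballI allI impI)
    fix f h assume fh: "f \<in> complexification U" "h \<in> complexification U"
    have "(\<lambda>x\<in>carrier G. Re (f x + h x)) = (\<lambda>x\<in>carrier G. (\<lambda>x\<in>carrier G. Re (f x)) x + (\<lambda>x\<in>carrier G. Re (h x)) x)"
      "(\<lambda>x\<in>carrier G. Im (f x + h x)) = (\<lambda>x\<in>carrier G. (\<lambda>x\<in>carrier G. Im (f x)) x + (\<lambda>x\<in>carrier G. Im (h x)) x)"
      by (auto simp: restrict_def)
    moreover have "(\<lambda>x\<in>carrier G. Re (f x)) \<in> U" "(\<lambda>x\<in>carrier G. Re (h x)) \<in> U"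
      "(\<lambda>x\<in>carrier G. Im (f x)) \<in> U" "(\<lambda>x\<in>carrier G. Im (h x)) \<in> U"
      using fh by (simp_all add: complexification_def)
    note add[OF this(1,2)] add[OF this(3,4)]
    ultimately show "(\<lambda>x. f x + h x) \<in> complexification U" unfolding complexification_def mem_Collect_eq by (simp only:)
  next
    fix c f assume f: "f \<in> complexification U"
    have R: "(\<lambda>x\<in>carrier G. Re (f x)) \<in> U" and I: "(\<lambda>x\<in>carrier G. Im (f x)) \<in> U"
      using f by (simp_all add: complexification_def)
    have "(\<lambda>x\<in>carrier G. Re (c * f x)) = (\<lambda>x\<in>carrier G. (\<lambda>x\<in>carrier G. Re c * (\<lambda>x\<in>carrier G. Re (f x)) x) x +
        (\<lambda>x\<in>carrier G. (- Im c) * (\<lambda>x\<in>carrier G. Im (f x)) x) x)"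
      "(\<lambda>x\<in>carrier G. Im (c * f x)) = (\<lambda>x\<in>carrier G. (\<lambda>x\<in>carrier G. Re c * (\<lambda>x\<in>carrier G. Im (f x)) x) x +
        (\<lambda>x\<in>carrier G. Im c * (\<lambda>x\<in>carrier G. Re (f x)) x) x)"
      by (auto simp: restrict_def)
    moreover note add[OF mult[OF R, of "Re c"] mult[OF I, of "- Im c"]] add[OF mult[OF I, of "Re c"] mult[OF R, of "Im c"]]
    ultimately show "(\<lambda>x. c * f x) \<in> complexification U" unfolding complexification_def mem_Collect_eq by (simp only:)
  next
    fix y f assume y: "y \<in> carrier G" and f: "f \<in> complexification U"
    have "(\<lambda>x\<in>carrier G. Re (f (y \<otimes> x))) = left_regular G (inv y) (\<lambda>x\<in>carrier G. Re (f x))"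
      "(\<lambda>x\<in>carrier G. Im (f (y \<otimes> x))) = left_regular G (inv y) (\<lambda>x\<in>carrier G. Im (f x))"
      using y by (auto simp: left_regular_def restrict_def)
    moreover have "left_regular G (inv y) (\<lambda>x\<in>carrier G. Re (f x)) \<in> U"
      "left_regular G (inv y) (\<lambda>x\<in>carrier G. Im (f x)) \<in> U"
      using f y by (intro trans; simp add: complexification_def)+
    ultimately show "(\<lambda>x. f (y \<otimes> x)) \<in> complexification U" unfolding complexification_def mem_Collect_eq by (simp only:)
  next
    fix f h :: "'a \<Rightarrow> complex" assume f: "f \<in> complexification U" and eq: "\<forall>x\<in>carrier G. f x = h x"
    have "(\<lambda>x\<in>carrier G. Re (h x)) = (\<lambda>x\<in>carrier G. Re (f x))" "(\<lambda>x\<in>carrier G. Im (h x)) = (\<lambda>x\<in>carrier G. Im (f x))"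
      using eq by (auto simp: restrict_def)
    then show "h \<in> complexification U" using f unfolding complexification_def mem_Collect_eq by (simp only:)
  qed
qed

lemma complexification_cnj:
  assumes U: "subrep class_ring (real_functions G) G (left_regular G) U" and f: "f \<in> complexification U"
  shows "(\<lambda>x. cnj (f x)) \<in> complexification U"
proof -
  have "(\<lambda>x\<in>carrier G. - 1 * (\<lambda>x\<in>carrier G. Im (f x)) x) \<in> U"
    using U f unfolding subrep_real_functions_iff complexification_def by blast
  moreover have "(\<lambda>x\<in>carrier G. - 1 * (\<lambda>x\<in>carrier G. Im (f x)) x) = (\<lambda>x\<in>carrier G. Im (cnj (f x)))"
    by (auto simp: restrict_def)
  ultimately show ?thesis using f by (simp add: complexification_def)
qed

lemma complexification_of_real:
  assumes "U \<subseteq> carrier G \<rightarrow>\<^sub>E UNIV" "(\<lambda>x\<in>carrier G. 0) \<in> U" "f \<in> U"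
  shows "(\<lambda>x. complex_of_real (f x)) \<in> complexification U"
proof -
  have "(\<lambda>x\<in>carrier G. f x) = f" using assms(1,3) by (auto simp: PiE_def extensional_restrict)
  then show ?thesis using assms(2,3) by (simp add: complexification_def)
qed

lemma mem_L_eigenspace_iff:
  "f \<in> L_eigenspace G S w \<mu> \<longleftrightarrow> f \<in> carrier G \<rightarrow>\<^sub>E UNIV \<and>
     (\<forall>x\<in>carrier G. complex_L w (\<lambda>x. complex_of_real (f x)) x = complex_of_real (\<mu> * f x))"
proof -
  have complex_L: "complex_L w (\<lambda>x. complex_of_real (f x)) x =
      complex_of_real (\<Sum>s\<in>S. coeff_at G w s * (f (x \<otimes> (s \<otimes> s)) - 2 * f (x \<otimes> s) + f x))" for x
    by (simp add: complex_L_def)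
  have "L_op G S w f = (\<lambda>x\<in>carrier G. \<mu> * f x) \<longleftrightarrow> (\<forall>x\<in>carrier G. complex_L w (\<lambda>x. complex_of_real (f x)) x = complex_of_real (\<mu> * f x))"
    unfolding complex_L of_real_eq_iff L_op_def by (auto simp: restrict_def fun_eq_iff)
  then show ?thesis by (simp add: L_eigenspace_def real_functions_def)
qed

lemma subrep_L_eigenspace: "subrep class_ring (real_functions G) G (left_regular G) (L_eigenspace G S w \<mu>)"
  unfolding subrep_real_functions_iff
proof (intro conjI ballI allI)
  show "L_eigenspace G S w \<mu> \<subseteq> carrier G \<rightarrow>\<^sub>E UNIV" by (auto simp: mem_L_eigenspace_iff)
  have z: "complex_L w (\<lambda>x. complex_of_real ((\<lambda>x\<in>carrier G. 0) x)) x = 0" if "x \<in> carrier G" for x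
    using that by (subst complex_L_cong[of _ "\<lambda>_. 0"]) (auto simp: complex_L_def)
  then show "(\<lambda>x\<in>carrier G. 0) \<in> L_eigenspace G S w \<mu>" by (simp add: mem_L_eigenspace_iff)
next
  fix f h assume "f \<in> L_eigenspace G S w \<mu>" "h \<in> L_eigenspace G S w \<mu>"
  moreover have "complex_L w (\<lambda>x. complex_of_real ((\<lambda>x\<in>carrier G. f x + h x) x)) x =
      complex_L w (\<lambda>x. complex_of_real (f x)) x + complex_L w (\<lambda>x. complex_of_real (h x)) x" if "x \<in> carrier G" for x
    unfolding complex_L_add[symmetric] using that by (intro complex_L_cong) auto
  ultimately show "(\<lambda>x\<in>carrier G. f x + h x) \<in> L_eigenspace G S w \<mu>"
    by (simp add: mem_L_eigenspace_iff distrib_left)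
next
  fix c f assume "f \<in> L_eigenspace G S w \<mu>"
  moreover have "complex_L w (\<lambda>x. complex_of_real ((\<lambda>x\<in>carrier G. c * f x) x)) x =
      complex_of_real c * complex_L w (\<lambda>x. complex_of_real (f x)) x" if "x \<in> carrier G" for x
    unfolding complex_L_mult[symmetric] using that by (intro complex_L_cong) auto
  ultimately show "(\<lambda>x\<in>carrier G. c * f x) \<in> L_eigenspace G S w \<mu>"
    by (simp add: mem_L_eigenspace_iff)
next
  fix g f assume g: "g \<in> carrier G" and "f \<in> L_eigenspace G S w \<mu>"
  moreover have "complex_L w (\<lambda>x. complex_of_real (left_regular G g f x)) x =
      complex_L w (\<lambda>x. complex_of_real (f x)) (inv g \<otimes> x)" if "x \<in> carrier G" for x
    unfolding complex_L_translate[OF inv_closed[OF g] that, symmetric] using that by (intro complex_L_cong) (auto simp: left_regular_def)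
  ultimately show "left_regular G g f \<in> L_eigenspace G S w \<mu>"
    by (simp add: mem_L_eigenspace_iff left_regular_def)
qed

lemma mem_complexification_L_eigenspace:
  "f \<in> complexification (L_eigenspace G S w \<mu>) \<longleftrightarrow> (\<forall>x\<in>carrier G. complex_L w f x = complex_of_real \<mu> * f x)"
proof -
  have R: "complex_L w (\<lambda>x. complex_of_real ((\<lambda>x\<in>carrier G. Re (f x)) x)) x = complex_of_real (Re (complex_L w f x))"
    and I: "complex_L w (\<lambda>x. complex_of_real ((\<lambda>x\<in>carrier G. Im (f x)) x)) x = complex_of_real (Im (complex_L w f x))"
    if "x \<in> carrier G" for x
    using that S_carrier unfolding complex_L_def by (simp_all add: Re_sum Im_sum)
  have "(\<forall>x\<in>carrier G. complex_L w (\<lambda>x. complex_of_real ((\<lambda>x\<in>carrier G. Re (f x)) x)) x = complex_of_real (\<mu> * (\<lambda>x\<in>carrier G. Re (f x)) x))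
      \<longleftrightarrow> (\<forall>x\<in>carrier G. Re (complex_L w f x) = \<mu> * Re (f x))"
    by (intro ball_cong refl) (simp only: R of_real_eq_iff restrict_apply')
  moreover have "(\<forall>x\<in>carrier G. complex_L w (\<lambda>x. complex_of_real ((\<lambda>x\<in>carrier G. Im (f x)) x)) x = complex_of_real (\<mu> * (\<lambda>x\<in>carrier G. Im (f x)) x))
      \<longleftrightarrow> (\<forall>x\<in>carrier G. Im (complex_L w f x) = \<mu> * Im (f x))"
    by (intro ball_cong refl) (simp only: I of_real_eq_iff restrict_apply')
  ultimately show ?thesis
    unfolding complexification_def mem_Collect_eq mem_L_eigenspace_iff
    by (simp only: complex_eq_iff) auto
qed

lemma mcoeff_in_eigenspace:
  assumes "matrix_rep G n \<rho>" "a \<in> carrier_vec n" "v \<in> carrier_vec n"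
    and "D_op G S n \<rho> w *\<^sub>v v = complex_of_real \<mu> \<cdot>\<^sub>v v"
  shows "mcoeff \<rho> a v \<in> complexification (L_eigenspace G S w \<mu>)"
  unfolding mem_complexification_L_eigenspace using complex_L_mcoeff_eigen[OF assms(1-3) _ assms(4)] by blast

lemma L_eigenspace_nonzero:
  assumes rep: "matrix_rep G n \<rho>" and v: "v \<in> carrier_vec n" "v \<noteq> 0\<^sub>v n"
    and eig: "D_op G S n \<rho> w *\<^sub>v v = complex_of_real \<mu> \<cdot>\<^sub>v v"
  shows "L_eigenspace G S w \<mu> \<noteq> {\<zero>\<^bsub>real_functions G\<^esub>}"
proof
  assume z: "L_eigenspace G S w \<mu> = {\<zero>\<^bsub>real_functions G\<^esub>}"
  have "mcoeff \<rho> (conjugate v) v \<in> complexification (L_eigenspace G S w \<mu>)"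
    using v(1) by (intro mcoeff_in_eigenspace[OF rep _ v(1) eig]) simp
  then have "(\<lambda>x\<in>carrier G. Re (mcoeff \<rho> (conjugate v) v x)) = (\<lambda>x\<in>carrier G. 0)"
    unfolding complexification_def z zero_real_functions by blast
  from fun_cong[OF this, of \<one>] show False using Re_mcoeff_conjugate_one[OF rep v] by simp
qed

lemma generates_within_eigenvector:
  assumes rep: "matrix_rep G n \<rho>" and gen: "generates_within X n \<rho> v"
    and X: "X \<subseteq> complexification (L_eigenspace G S w \<mu>)"
  shows "D_op G S n \<rho> w *\<^sub>v v = complex_of_real \<mu> \<cdot>\<^sub>v v"
proof (rule scalar_prod_left_cancel)
  have v: "v \<in> carrier_vec n" using gen by (simp add: generates_within_def)
  show "D_op G S n \<rho> w *\<^sub>v v \<in> carrier_vec n" by (rule D_op_vec[OF rep v])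
  show "complex_of_real \<mu> \<cdot>\<^sub>v v \<in> carrier_vec n" using v by simp
  fix a :: "complex Matrix.vec" assume a: "a \<in> carrier_vec n"
  then have "mcoeff \<rho> a v \<in> complexification (L_eigenspace G S w \<mu>)"
    using gen X unfolding generates_within_def by blast
  then have "complex_L w (mcoeff \<rho> a v) \<one> = complex_of_real \<mu> * mcoeff \<rho> a v \<one>"
    unfolding mem_complexification_L_eigenspace using one_closed by blast
  then show "a \<bullet> (D_op G S n \<rho> w *\<^sub>v v) = a \<bullet> (complex_of_real \<mu> \<cdot>\<^sub>v v)"
    unfolding complex_L_mcoeff[OF rep a v one_closed] mcoeff_one[OF rep D_op_vec[OF rep v]] mcoeff_one[OF rep v]
    using a v by simp
qed

text \<open>The real parts of the coefficients \<open>mcoeff \<rho> a v\<close> form a nonzero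
  subrepresentation of the eigenspace, hence all of it.\<close>

lemma irreducible_eigenspace_functions:
  assumes irrE: "irreducible_subrep class_ring (real_functions G) G (left_regular G) (L_eigenspace G S w \<mu>)"
    and rep: "matrix_rep G n \<rho>" and v: "v \<in> carrier_vec n" "v \<noteq> 0\<^sub>v n"
    and eig: "D_op G S n \<rho> w *\<^sub>v v = complex_of_real \<mu> \<cdot>\<^sub>v v"
    and f: "f \<in> complexification (L_eigenspace G S w \<mu>)"
  obtains a b where "a \<in> carrier_vec n" "b \<in> carrier_vec n"
    "\<And>x. x \<in> carrier G \<Longrightarrow> f x = mcoeff \<rho> a v x + cnj (mcoeff \<rho> b v x)"
proof -
  define m where "m a = (\<lambda>x\<in>carrier G. Re (mcoeff \<rho> a v x))" for a
  define U where "U = m ` carrier_vec n"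
  have UE: "U \<subseteq> L_eigenspace G S w \<mu>"
    unfolding U_def m_def using mcoeff_in_eigenspace[OF rep _ v(1) eig] by (auto simp: complexification_def)
  have "subrep class_ring (real_functions G) G (left_regular G) U"
    unfolding subrep_real_functions_iff
  proof (intro conjI ballI allI)
    show "U \<subseteq> carrier G \<rightarrow>\<^sub>E UNIV" by (auto simp: U_def m_def)
    have "m (0\<^sub>v n) = (\<lambda>x\<in>carrier G. 0)"
      using rep_vec[OF rep _ v(1)] by (auto simp: m_def mcoeff_def restrict_def)
    then show "(\<lambda>x\<in>carrier G. 0) \<in> U" unfolding U_def by (metis imageI zero_carrier_vec)
  next
    fix f h assume "f \<in> U" "h \<in> U"
    then obtain a b where ab: "a \<in> carrier_vec n" "b \<in> carrier_vec n" "f = m a" "h = m b" by (auto simp: U_def)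
    have "(\<lambda>x\<in>carrier G. f x + h x) = m (a + b)"
      unfolding ab(3,4) m_def using mcoeff_add_left[OF rep ab(1,2) v(1)] by (intro restrict_ext) simp
    then show "(\<lambda>x\<in>carrier G. f x + h x) \<in> U" using ab(1,2) by (simp add: U_def)
  next
    fix c f assume "f \<in> U"
    then obtain a where a: "a \<in> carrier_vec n" "f = m a" by (auto simp: U_def)
    have "(\<lambda>x\<in>carrier G. c * f x) = m (complex_of_real c \<cdot>\<^sub>v a)"
      unfolding a(2) m_def using mcoeff_smult_left[OF rep a(1) v(1)] by (intro restrict_ext) simp
    then show "(\<lambda>x\<in>carrier G. c * f x) \<in> U" using a(1) by (simp add: U_def)
  next
    fix g f assume g: "g \<in> carrier G" and "f \<in> U"
    then obtain a where a: "a \<in> carrier_vec n" "f = m a" by (auto simp: U_def)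
    have "left_regular G g f = m (transpose_mat (\<rho> (inv g)) *\<^sub>v a)"
      unfolding a(2) m_def left_regular_def using mcoeff_translate[OF rep a(1) v(1) inv_closed[OF g]] g
      by (intro restrict_ext) simp
    moreover have "transpose_mat (\<rho> (inv g)) *\<^sub>v a \<in> carrier_vec n"
      using rep_carrier[OF rep inv_closed[OF g]] a(1) by simp
    ultimately show "left_regular G g f \<in> U" by (simp add: U_def)
  qed
  moreover have "U \<noteq> {\<zero>\<^bsub>real_functions G\<^esub>}"
  proof
    assume z: "U = {\<zero>\<^bsub>real_functions G\<^esub>}"
    have "m (conjugate v) \<in> U" using v(1) by (simp add: U_def)
    then have "m (conjugate v) \<one> = (\<lambda>x\<in>carrier G. 0) \<one>" unfolding z zero_real_functions by simp
    then show False using Re_mcoeff_conjugate_one[OF rep v] by (simp add: m_def)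
  qed
  ultimately have UE: "U = L_eigenspace G S w \<mu>" using irrE UE unfolding irreducible_subrep_def by blast
  obtain a where a: "a \<in> carrier_vec n" "(\<lambda>x\<in>carrier G. Re (f x)) = m a"
    using f unfolding complexification_def UE[symmetric] U_def by blast
  obtain b where b: "b \<in> carrier_vec n" "(\<lambda>x\<in>carrier G. Im (f x)) = m b"
    using f unfolding complexification_def UE[symmetric] U_def by blast
  \<comment> \<open>If \<open>p\<close> and \<open>q\<close> are the coefficient functions of \<open>a\<close> and \<open>b\<close>, then
    \<open>Re p + \<i> Re q = (p + \<i> q) / 2 + cnj ((p - \<i> q) / 2)\<close>.\<close>
  let ?a = "(1/2) \<cdot>\<^sub>v a + (\<i>/2) \<cdot>\<^sub>v b" and ?b = "(1/2) \<cdot>\<^sub>v a + (- \<i>/2) \<cdot>\<^sub>v b"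
  have "f x = mcoeff \<rho> ?a v x + cnj (mcoeff \<rho> ?b v x)" if x: "x \<in> carrier G" for x
  proof -
    have R: "Re (f x) = Re (mcoeff \<rho> a v x)" using fun_cong[OF a(2), of x] x by (simp add: m_def)
    have I: "Im (f x) = Re (mcoeff \<rho> b v x)" using fun_cong[OF b(2), of x] x by (simp add: m_def)
    have "mcoeff \<rho> ?a v x = (1/2) * mcoeff \<rho> a v x + (\<i>/2) * mcoeff \<rho> b v x"
      "mcoeff \<rho> ?b v x = (1/2) * mcoeff \<rho> a v x + (- \<i>/2) * mcoeff \<rho> b v x"
      using a(1) b(1) mcoeff_add_left[OF rep _ _ v(1) x] mcoeff_smult_left[OF rep _ v(1) x] by simp_all
    then show ?thesis by (simp add: complex_eq_iff R I)
  qed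
  moreover have "?a \<in> carrier_vec n" "?b \<in> carrier_vec n" using a(1) b(1) by simp_all
  ultimately show thesis using that by blast
qed

end

section \<open>Simple weights and resultants\<close>

context cayley_graph
begin

lemma real_G_simpleD:
  assumes simple: "real_G_simple G S w" and rep: "matrix_rep G n \<rho>" and v: "v \<in> carrier_vec n" "v \<noteq> 0\<^sub>v n"
    and eig: "D_op G S n \<rho> w *\<^sub>v v = complex_of_real \<mu> \<cdot>\<^sub>v v"
  shows "irreducible_subrep class_ring (real_functions G) G (left_regular G) (L_eigenspace G S w \<mu>)"
  using simple L_eigenspace_nonzero[OF rep v eig] unfolding real_G_simple_def by blast

text \<open>A coefficient of \<open>\<sigma>\<close> in the eigenspace is a sum of coefficients of
  \<open>\<rho>\<close> and of its conjugate. If \<open>\<sigma>\<close> were isomorphic to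
  neither, this coefficient would be orthogonal to all coefficients of \<open>\<sigma>\<close>,
  itself included.\<close>

lemma common_eigenvalue_iso:
  assumes simple: "real_G_simple G S w" and irr: "complex_irrep G n \<rho>" "complex_irrep G m \<sigma>"
    and root: "poly (P_poly G S n \<rho> w) x = 0" "poly (P_poly G S m \<sigma> w) x = 0"
  shows "rep_iso G m \<sigma> n \<rho> \<or> rep_iso G m \<sigma> n (conj_rep \<rho>)"
proof (rule ccontr)
  assume niso: "\<not> ?thesis"
  have rep: "matrix_rep G n \<rho>" "matrix_rep G m \<sigma>" using irr by (simp_all add: complex_irrep_iff)
  obtain \<mu> v where x: "x = complex_of_real \<mu>" and v: "v \<in> carrier_vec n" "v \<noteq> 0\<^sub>v n"
    "D_op G S n \<rho> w *\<^sub>v v = complex_of_real \<mu> \<cdot>\<^sub>v v"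
    using P_poly_root_eigenvector[OF rep(1) root(1)] by metis
  obtain u where u: "u \<in> carrier_vec m" "u \<noteq> 0\<^sub>v m" "D_op G S m \<sigma> w *\<^sub>v u = complex_of_real \<mu> \<cdot>\<^sub>v u"
    using root(2) unfolding P_poly_root_iff[OF rep(2)] x by blast
  have cu: "conjugate u \<in> carrier_vec m" using u(1) by simp
  obtain a b where a: "a \<in> carrier_vec n" and b: "b \<in> carrier_vec n"
    and eq: "\<And>x. x \<in> carrier G \<Longrightarrow> mcoeff \<sigma> (conjugate u) u x = mcoeff \<rho> a v x + cnj (mcoeff \<rho> b v x)"
    using irreducible_eigenspace_functions[OF real_G_simpleD[OF simple rep(1) v] rep(1) v
        mcoeff_in_eigenspace[OF rep(2) cu u(1,3)]] by metis
  have "pairing (mcoeff \<sigma> (conjugate u) u) (mcoeff \<sigma> (conjugate u) u) =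
      pairing (mcoeff \<rho> a v) (mcoeff \<sigma> (conjugate u) u) +
      pairing (mcoeff (conj_rep \<rho>) (conjugate b) (conjugate v)) (mcoeff \<sigma> (conjugate u) u)"
    unfolding pairing_add[symmetric] by (rule pairing_cong) (simp add: eq mcoeff_conj[OF rep(1) b v(1)])
  also have "pairing (mcoeff \<rho> a v) (mcoeff \<sigma> (conjugate u) u) = 0"
    using niso by (intro pairing_noniso[OF irr _ a v(1) cu u(1)]) simp
  also have "pairing (mcoeff (conj_rep \<rho>) (conjugate b) (conjugate v)) (mcoeff \<sigma> (conjugate u) u) = 0"
    using niso b v(1) by (intro pairing_noniso[OF complex_irrep_conj[OF irr(1)] irr(2) _ _ _ cu u(1)]) simp_all
  finally have "complex_of_nat (card (carrier G)) * (conjugate u \<bullet> u) * (conjugate u \<bullet> u) = 0"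
    using pairing_same[OF irr(2) cu u(1) cu u(1)] by simp
  then have "conjugate u \<bullet> u = 0" using card_carrier_neq_0 by simp
  then show False using scalar_prod_conjugate_eq_0[OF u(1)] u(2) by simp
qed

text \<open>A coefficient of \<open>u\<close> in the irreducible eigenspace is a coefficient of
  \<open>v\<close> plus a conjugated one. Pairing it with the coefficients of
  \<open>\<rho>\<close> turns this into a linear relation between vectors. The last hypothesis
  describes the pairing with the conjugated part, which depends on the type of
  \<open>\<rho>\<close>.\<close>

lemma eigenvector_in_span:
  assumes simple: "real_G_simple G S w" and irr: "complex_irrep G n \<rho>"
    and v: "v \<in> carrier_vec n" "v \<noteq> 0\<^sub>v n" "D_op G S n \<rho> w *\<^sub>v v = complex_of_real \<mu> \<cdot>\<^sub>v v"
    and u: "u \<in> carrier_vec n" "D_op G S n \<rho> w *\<^sub>v u = complex_of_real \<mu> \<cdot>\<^sub>v u"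
    and z: "z \<in> carrier_vec n"
    and cnj: "\<And>b. b \<in> carrier_vec n \<Longrightarrow> \<exists>\<gamma>. \<forall>c'\<in>carrier_vec n.
      pairing (\<lambda>x. cnj (mcoeff \<rho> b v x)) (mcoeff \<rho> c' (unit_vec n 0)) = \<gamma> * (c' \<bullet> z)"
  shows "\<exists>\<alpha> \<beta>. u = \<alpha> \<cdot>\<^sub>v v + \<beta> \<cdot>\<^sub>v z"
proof -
  have rep: "matrix_rep G n \<rho>" and n: "n > 0" using irr by (simp_all add: complex_irrep_iff)
  \<comment> \<open>Any vectors with \<open>c \<bullet> v' = 1\<close> would do for the two free arguments of the pairing.\<close>
  define e where "e = (unit_vec n 0 :: complex Matrix.vec)"
  have e: "e \<in> carrier_vec n" "e \<bullet> e = 1" using n by (simp_all add: e_def)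
  obtain a b where a: "a \<in> carrier_vec n" and b: "b \<in> carrier_vec n"
    and eq: "\<And>x. x \<in> carrier G \<Longrightarrow> mcoeff \<rho> e u x = mcoeff \<rho> a v x + cnj (mcoeff \<rho> b v x)"
    using irreducible_eigenspace_functions[OF real_G_simpleD[OF simple rep v] rep v
        mcoeff_in_eigenspace[OF rep e(1) u]] by metis
  obtain \<gamma> where \<gamma>: "\<And>c'. c' \<in> carrier_vec n \<Longrightarrow> pairing (\<lambda>x. cnj (mcoeff \<rho> b v x)) (mcoeff \<rho> c' e) = \<gamma> * (c' \<bullet> z)"
    using cnj[OF b] unfolding e_def by blast
  let ?N = "complex_of_nat (card (carrier G))"
  define \<beta> where "\<beta> = of_nat n * \<gamma> / ?N"
  have "u = (a \<bullet> e) \<cdot>\<^sub>v v + \<beta> \<cdot>\<^sub>v z"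
  proof (rule scalar_prod_left_cancel)
    fix c' :: "complex Matrix.vec" assume c': "c' \<in> carrier_vec n"
    have "pairing (mcoeff \<rho> e u) (mcoeff \<rho> c' e) =
        pairing (mcoeff \<rho> a v) (mcoeff \<rho> c' e) + pairing (\<lambda>x. cnj (mcoeff \<rho> b v x)) (mcoeff \<rho> c' e)"
      unfolding pairing_add[symmetric] by (rule pairing_cong) (rule eq)
    then have "of_nat n * pairing (mcoeff \<rho> e u) (mcoeff \<rho> c' e) =
        of_nat n * pairing (mcoeff \<rho> a v) (mcoeff \<rho> c' e) + of_nat n * (\<gamma> * (c' \<bullet> z))"
      by (simp add: \<gamma>[OF c'] distrib_left)
    then have "?N * (c' \<bullet> u) = ?N * (c' \<bullet> v) * (a \<bullet> e) + of_nat n * (\<gamma> * (c' \<bullet> z))"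
      unfolding pairing_same[OF irr e(1) u(1) c' e(1)] pairing_same[OF irr a v(1) c' e(1)] using e(2) by simp
    then have "c' \<bullet> u = (a \<bullet> e) * (c' \<bullet> v) + \<beta> * (c' \<bullet> z)"
      using card_carrier_neq_0 by (simp add: \<beta>_def field_simps)
    then show "c' \<bullet> u = c' \<bullet> ((a \<bullet> e) \<cdot>\<^sub>v v + \<beta> \<cdot>\<^sub>v z)"
      using c' v(1) z by (simp add: scalar_prod_add_distrib[of _ n])
  qed (use u(1) v(1) z in auto)
  then show ?thesis by blast
qed

text \<open>The conjugated coefficients pair to 0, since \<open>\<rho>\<close> is not isomorphic
  to its conjugate.\<close>

lemma eigenvector_unique_complex_type:
  assumes simple: "real_G_simple G S w" and irr: "complex_irrep G n \<rho>" and type: "complex_type G n \<rho>"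
    and v: "v \<in> carrier_vec n" "v \<noteq> 0\<^sub>v n" "D_op G S n \<rho> w *\<^sub>v v = complex_of_real \<mu> \<cdot>\<^sub>v v"
    and u: "u \<in> carrier_vec n" "D_op G S n \<rho> w *\<^sub>v u = complex_of_real \<mu> \<cdot>\<^sub>v u"
  shows "\<exists>\<alpha>. u = \<alpha> \<cdot>\<^sub>v v"
proof -
  have rep: "matrix_rep G n \<rho>" using irr by (simp add: complex_irrep_iff)
  have niso: "\<not> rep_iso G n \<rho> n (conj_rep \<rho>)"
    using self_conjugate_type[OF irr] rep_iso_sym[OF rep matrix_rep_conj[OF rep]] type unfolding complex_type_def by blast
  have "\<exists>\<alpha> \<beta>. u = \<alpha> \<cdot>\<^sub>v v + \<beta> \<cdot>\<^sub>v v"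
  proof (rule eigenvector_in_span[OF simple irr v u v(1)])
    fix b :: "complex Matrix.vec" assume b: "b \<in> carrier_vec n"
    have "pairing (\<lambda>x. cnj (mcoeff \<rho> b v x)) (mcoeff \<rho> c' (unit_vec n 0)) = 0" if c': "c' \<in> carrier_vec n" for c'
    proof -
      have "pairing (\<lambda>x. cnj (mcoeff \<rho> b v x)) (mcoeff \<rho> c' (unit_vec n 0)) =
          pairing (mcoeff (conj_rep \<rho>) (conjugate b) (conjugate v)) (mcoeff \<rho> c' (unit_vec n 0))"
        by (rule pairing_cong) (simp add: mcoeff_conj[OF rep b v(1)])
      also have "\<dots> = 0"
        using niso b v(1) c' by (intro pairing_noniso[OF complex_irrep_conj[OF irr] irr]) simp_all
      finally show ?thesis .
    qed
    then show "\<exists>\<gamma>. \<forall>c'\<in>carrier_vec n. pairing (\<lambda>x. cnj (mcoeff \<rho> b v x)) (mcoeff \<rho> c' (unit_vec n 0)) = \<gamma> * (c' \<bullet> v)"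
      by (intro exI[of _ 0]) simp
  qed
  then show ?thesis using add_smult_distrib_vec[symmetric, of _ v] by metis
qed

text \<open>The conjugate of a coefficient of \<open>v\<close> is a coefficient of \<open>J
  v\<close>. Taking \<open>\<epsilon>\<close> to be 1 or -1 covers the real and the quaternionic
  type.\<close>

lemma eigenvector_span_structure_map:
  assumes simple: "real_G_simple G S w" and irr: "complex_irrep G n \<rho>"
    and J: "conj_linear_equivariant G n \<rho> J" and JJ: "\<And>v. v \<in> carrier_vec n \<Longrightarrow> v = \<epsilon> \<cdot>\<^sub>v J (J v)"
    and v: "v \<in> carrier_vec n" "v \<noteq> 0\<^sub>v n" "D_op G S n \<rho> w *\<^sub>v v = complex_of_real \<mu> \<cdot>\<^sub>v v"
    and u: "u \<in> carrier_vec n" "D_op G S n \<rho> w *\<^sub>v u = complex_of_real \<mu> \<cdot>\<^sub>v u"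
  shows "\<exists>\<alpha> \<beta>. u = \<alpha> \<cdot>\<^sub>v v + \<beta> \<cdot>\<^sub>v J v"
proof -
  have rep: "matrix_rep G n \<rho>" and n: "n > 0" using irr by (simp_all add: complex_irrep_iff)
  have Jc: "J v \<in> carrier_vec n" if "v \<in> carrier_vec n" for v
    using J that by (auto simp: conj_linear_equivariant_def)
  show ?thesis
  proof (rule eigenvector_in_span[OF simple irr v u Jc[OF v(1)]])
    fix b :: "complex Matrix.vec" assume b: "b \<in> carrier_vec n"
    obtain b' where b': "b' \<in> carrier_vec n"
      and eq: "\<And>v x. v \<in> carrier_vec n \<Longrightarrow> x \<in> carrier G \<Longrightarrow> mcoeff \<rho> b (J v) x = cnj (mcoeff \<rho> b' v x)"
      using mcoeff_structure_map[OF rep J b] by metis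
    have c: "cnj (mcoeff \<rho> b v x) = cnj \<epsilon> * mcoeff \<rho> b' (J v) x" if x: "x \<in> carrier G" for x
    proof -
      have "mcoeff \<rho> b v x = mcoeff \<rho> b (\<epsilon> \<cdot>\<^sub>v J (J v)) x" using JJ[OF v(1)] by simp
      also have "\<dots> = \<epsilon> * cnj (mcoeff \<rho> b' (J v) x)"
        using mcoeff_smult[OF rep b Jc[OF Jc[OF v(1)]] x] eq[OF Jc[OF v(1)] x] by simp
      finally show ?thesis by simp
    qed
    define \<gamma> where "\<gamma> = cnj \<epsilon> * (complex_of_nat (card (carrier G)) * (b' \<bullet> unit_vec n 0) / of_nat n)"
    have "pairing (\<lambda>x. cnj (mcoeff \<rho> b v x)) (mcoeff \<rho> c' (unit_vec n 0)) = \<gamma> * (c' \<bullet> J v)"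
      if c': "c' \<in> carrier_vec n" for c'
    proof -
      have "pairing (\<lambda>x. cnj (mcoeff \<rho> b v x)) (mcoeff \<rho> c' (unit_vec n 0)) =
          cnj \<epsilon> * pairing (mcoeff \<rho> b' (J v)) (mcoeff \<rho> c' (unit_vec n 0))"
        unfolding pairing_mult[symmetric] by (rule pairing_cong) (rule c)
      moreover have "pairing (mcoeff \<rho> b' (J v)) (mcoeff \<rho> c' (unit_vec n 0)) =
          complex_of_nat (card (carrier G)) * (c' \<bullet> J v) * (b' \<bullet> unit_vec n 0) / of_nat n"
        using pairing_same[OF irr b' Jc[OF v(1)] c' unit_vec_carrier, of 0] n by (simp add: field_simps)
      ultimately show ?thesis by (simp add: \<gamma>_def ac_simps)
    qed
    then show "\<exists>\<gamma>. \<forall>c'\<in>carrier_vec n. pairing (\<lambda>x. cnj (mcoeff \<rho> b v x)) (mcoeff \<rho> c' (unit_vec n 0)) = \<gamma> * (c' \<bullet> J v)"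
      by blast
  qed
qed

definition generic_weight :: "('a set \<Rightarrow> real) \<Rightarrow> bool" where
  "generic_weight w \<longleftrightarrow>
    (\<forall>n \<rho> m \<sigma>. complex_irrep G n \<rho> \<and> complex_irrep G m \<sigma> \<and> \<not> rep_iso G m \<sigma> n \<rho> \<and> \<not> rep_iso G m \<sigma> n (dual_rep G \<rho>)
      \<longrightarrow> a_fun G S n \<rho> m \<sigma> w \<noteq> 0) \<and>
    (\<forall>n \<rho>. complex_irrep G n \<rho> \<and> (real_type G n \<rho> \<or> complex_type G n \<rho>) \<longrightarrow> b_fun G S n \<rho> w \<noteq> 0) \<and>
    (\<forall>n \<rho>. complex_irrep G n \<rho> \<and> quaternionic_type G n \<rho> \<longrightarrow> c_fun G S n \<rho> w \<noteq> 0)"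

lemma b_fun_eq_0_iff:
  assumes irr: "complex_irrep G n \<rho>"
  shows "b_fun G S n \<rho> w = 0 \<longleftrightarrow> (\<exists>x. 2 \<le> Polynomial.order x (P_poly G S n \<rho> w))"
proof -
  have rep: "matrix_rep G n \<rho>" and n: "n > 0" using irr by (simp_all add: complex_irrep_iff)
  have "pderiv (P_poly G S n \<rho> w) \<noteq> 0" using P_poly_degree[OF rep] n by (simp add: pderiv_eq_0_iff)
  then show ?thesis
    unfolding b_fun_def using resultant_eq_0_iff_common_root[OF P_poly_degree(2)[OF rep]]
      double_root_iff_order[of "P_poly G S n \<rho> w"] P_poly_degree(1)[OF rep] n by simp
qed

lemma quaternionic_order_ge_2:
  assumes irr: "complex_irrep G n \<rho>"
    and J: "conj_linear_equivariant G n \<rho> J" and JJ: "\<And>v. v \<in> carrier_vec n \<Longrightarrow> J (J v) = - v"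
    and root: "poly (P_poly G S n \<rho> w) x = 0"
  shows "2 \<le> Polynomial.order x (P_poly G S n \<rho> w)"
proof -
  have rep: "matrix_rep G n \<rho>" using irr by (simp add: complex_irrep_iff)
  obtain \<mu> v where x: "x = complex_of_real \<mu>" and v: "v \<in> carrier_vec n" "v \<noteq> 0\<^sub>v n"
    "D_op G S n \<rho> w *\<^sub>v v = complex_of_real \<mu> \<cdot>\<^sub>v v"
    using P_poly_root_eigenvector[OF rep root] by metis
  have "J v \<in> carrier_vec n" using J v(1) by (auto simp: conj_linear_equivariant_def)
  then show ?thesis
    unfolding P_poly_def x
    by (rule order_ge_2I(1)[OF D_op_carrier[OF rep] D_op_semisimple[OF rep] v(1) _ v(2)
        quaternionic_independent[OF J JJ v(1,2)] v(3) D_op_structure_map[OF rep J v(1,3)]])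
qed

text \<open>In the quaternionic type all roots have multiplicity at least 2, and a root of
  multiplicity exactly 2 is not a root of the second derivative.\<close>

lemma c_fun_eq_0_iff:
  assumes irr: "complex_irrep G n \<rho>" and type: "quaternionic_type G n \<rho>"
  shows "c_fun G S n \<rho> w = 0 \<longleftrightarrow> (\<exists>x. 3 \<le> Polynomial.order x (P_poly G S n \<rho> w))"
proof -
  have rep: "matrix_rep G n \<rho>" and n: "n > 0" using irr by (simp_all add: complex_irrep_iff)
  let ?P = "P_poly G S n \<rho> w"
  obtain J where J: "conj_linear_equivariant G n \<rho> J" and JJ: "\<And>v. v \<in> carrier_vec n \<Longrightarrow> J (J v) = - v"
    using type unfolding quaternionic_type_def by blast
  note two = quaternionic_order_ge_2[OF irr J JJ, of w]
  have "\<exists>x. poly ?P x = 0"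
    using fundamental_theorem_of_algebra[of ?P] P_poly_degree[OF rep, of w] n by (auto simp: constant_degree)
  then obtain x0 where "poly ?P x0 = 0" by blast
  then have "pderiv (pderiv ?P) \<noteq> 0" using triple_root_iff_order(2)[OF two P_poly_degree(2)[OF rep]] by blast
  then have "c_fun G S n \<rho> w = 0 \<longleftrightarrow> (\<exists>x. poly ?P x = 0 \<and> poly (pderiv (pderiv ?P)) x = 0)"
    unfolding c_fun_def by (rule resultant_eq_0_iff_common_root[OF P_poly_degree(2)[OF rep]])
  also have "\<dots> \<longleftrightarrow> (\<exists>x. 3 \<le> Polynomial.order x ?P)"
  proof (intro iffI; elim exE)
    fix x assume "poly ?P x = 0 \<and> poly (pderiv (pderiv ?P)) x = 0"
    then show "\<exists>x. 3 \<le> Polynomial.order x ?P"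
      using triple_root_iff_order(1)[OF two P_poly_degree(2)[OF rep], of x] by blast
  next
    fix x assume o: "3 \<le> Polynomial.order x ?P"
    then have "poly ?P x = 0" by (auto simp: order_root)
    then show "\<exists>x. poly ?P x = 0 \<and> poly (pderiv (pderiv ?P)) x = 0"
      using triple_root_iff_order(1)[OF two P_poly_degree(2)[OF rep], of x] o by blast
  qed
  finally show ?thesis .
qed

text \<open>A multiple root gives an eigenvector outside the span that
  \<open>eigenvector_unique_complex_type\<close> or \<open>eigenvector_span_structure_map\<close>
  allows. In the real type the starting vector is taken to be fixed by \<open>J\<close>, so that
  the span is a line; in the quaternionic type the span has dimension 2, and only triple roots are
  excluded.\<close>

theorem real_G_simple_imp_generic:
  assumes simple: "real_G_simple G S w"
  shows "generic_weight w"
  unfolding generic_weight_def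
proof (intro conjI allI impI; elim conjE)
  fix n \<rho> m \<sigma> assume irr: "complex_irrep G n \<rho>" "complex_irrep G m \<sigma>"
    and niso: "\<not> rep_iso G m \<sigma> n \<rho>" "\<not> rep_iso G m \<sigma> n (dual_rep G \<rho>)"
  have rep: "matrix_rep G n \<rho>" "matrix_rep G m \<sigma>" using irr by (simp_all add: complex_irrep_iff)
  have "\<not> rep_iso G m \<sigma> n (conj_rep \<rho>)"
    using rep_iso_trans[OF rep(2) matrix_rep_conj[OF rep(1)] matrix_rep_dual[OF rep(1)] _ conj_iso_dual[OF rep(1)]] niso(2) by blast
  then have "\<not> (\<exists>x. poly (P_poly G S n \<rho> w) x = 0 \<and> poly (P_poly G S m \<sigma> w) x = 0)"
    using common_eigenvalue_iso[OF simple irr] niso(1) by blast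
  then show "a_fun G S n \<rho> m \<sigma> w \<noteq> 0"
    unfolding a_fun_def resultant_eq_0_iff_common_root[OF P_poly_degree(2)[OF rep(1)] P_poly_degree(2)[OF rep(2)]] .
next
  fix n \<rho> assume irr: "complex_irrep G n \<rho>" and type: "real_type G n \<rho> \<or> complex_type G n \<rho>"
  have rep: "matrix_rep G n \<rho>" using irr by (simp add: complex_irrep_iff)
  note D = D_op_carrier[OF rep, of w] D_op_semisimple[OF rep, of w]
  show "b_fun G S n \<rho> w \<noteq> 0"
  proof
    assume "b_fun G S n \<rho> w = 0"
    then obtain x where x: "2 \<le> Polynomial.order x (P_poly G S n \<rho> w)" unfolding b_fun_eq_0_iff[OF irr] by blast
    then have "poly (P_poly G S n \<rho> w) x = 0" by (auto simp: order_root)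
    then obtain \<mu> v where \<mu>: "x = complex_of_real \<mu>" and v: "v \<in> carrier_vec n" "v \<noteq> 0\<^sub>v n"
      "D_op G S n \<rho> w *\<^sub>v v = complex_of_real \<mu> \<cdot>\<^sub>v v"
      using P_poly_root_eigenvector[OF rep] by metis
    have ex: "\<exists>u\<in>carrier_vec n. D_op G S n \<rho> w *\<^sub>v u = complex_of_real \<mu> \<cdot>\<^sub>v u \<and> (\<forall>\<alpha>. u \<noteq> \<alpha> \<cdot>\<^sub>v v')"
      if "v' \<in> carrier_vec n" for v'
      using order_ge_2D[OF D _ that] x unfolding \<mu> P_poly_def by blast
    show False
      using type
    proof
      assume "complex_type G n \<rho>"
      then show False using ex[OF v(1)] eigenvector_unique_complex_type[OF simple irr _ v] by blast
    next
      assume "real_type G n \<rho>"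
      then obtain J where J: "conj_linear_equivariant G n \<rho> J" and JJ: "\<And>v. v \<in> carrier_vec n \<Longrightarrow> J (J v) = v"
        unfolding real_type_def by blast
      have Jv: "J v \<in> carrier_vec n" using J v(1) by (auto simp: conj_linear_equivariant_def)
      \<comment> \<open>One of \<open>v + J v\<close> and \<open>\<i> v\<close> is a nonzero eigenvector fixed by \<open>J\<close>.\<close>
      obtain v' where v': "v' \<in> carrier_vec n" "v' \<noteq> 0\<^sub>v n" "D_op G S n \<rho> w *\<^sub>v v' = complex_of_real \<mu> \<cdot>\<^sub>v v'" "J v' = v'"
      proof (cases "v + J v = 0\<^sub>v n")
        case False
        have "J (v + J v) = v + J v"
          using J v(1) Jv JJ[OF v(1)] comm_add_vec[OF v(1) Jv] by (simp add: conj_linear_equivariant_def)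
        moreover have "D_op G S n \<rho> w *\<^sub>v (v + J v) = complex_of_real \<mu> \<cdot>\<^sub>v (v + J v)"
          using mult_add_distrib_mat_vec[OF D(1) v(1) Jv] v(3) D_op_structure_map[OF rep J v(1,3)]
            smult_add_distrib_vec[OF v(1) Jv] by simp
        ultimately show thesis using that[of "v + J v"] False v(1) Jv by simp
      next
        case True
        have Jneg: "J v = - v"
        proof (rule eq_vecI)
          fix i assume "i < dim_vec (- v)"
          then have i: "i < n" using v(1) by simp
          have "v $ i + J v $ i = 0" using arg_cong[OF True, of "\<lambda>u. u $ i"] i v(1) Jv by simp
          then show "J v $ i = (- v) $ i" using i v(1) by (simp add: eq_neg_iff_add_eq_0 add.commute)
        qed (use v(1) Jv in auto)
        have "J (\<i> \<cdot>\<^sub>v v) = \<i> \<cdot>\<^sub>v v"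
        proof -
          have "J (\<i> \<cdot>\<^sub>v v) = cnj \<i> \<cdot>\<^sub>v J v" using J v(1) unfolding conj_linear_equivariant_def by blast
          then show ?thesis unfolding Jneg by (auto intro!: eq_vecI)
        qed
        moreover have "D_op G S n \<rho> w *\<^sub>v (\<i> \<cdot>\<^sub>v v) = complex_of_real \<mu> \<cdot>\<^sub>v (\<i> \<cdot>\<^sub>v v)"
          using mult_mat_vec[OF D(1) v(1), of \<i>] v(3) by (simp add: smult_smult_assoc mult.commute)
        moreover have "\<i> \<cdot>\<^sub>v v \<noteq> 0\<^sub>v n"
        proof
          assume z: "\<i> \<cdot>\<^sub>v v = 0\<^sub>v n"
          have "v $ i = 0" if "i < n" for i using arg_cong[OF z, of "\<lambda>u. u $ i"] that v(1) by simp
          then have "v = 0\<^sub>v n" using v(1) by (intro eq_vecI) auto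
          then show False using v(2) by simp
        qed
        ultimately show thesis using that[of "\<i> \<cdot>\<^sub>v v"] v(1) by simp
      qed
      obtain u where u: "u \<in> carrier_vec n" "D_op G S n \<rho> w *\<^sub>v u = complex_of_real \<mu> \<cdot>\<^sub>v u" "\<And>\<alpha>. u \<noteq> \<alpha> \<cdot>\<^sub>v v'"
        using ex[OF v'(1)] by blast
      have "v = 1 \<cdot>\<^sub>v J (J v)" if "v \<in> carrier_vec n" for v using JJ[OF that] by simp
      from eigenvector_span_structure_map[OF simple irr J this v'(1-3) u(1,2)]
      obtain \<alpha> \<beta> where "u = \<alpha> \<cdot>\<^sub>v v' + \<beta> \<cdot>\<^sub>v v'" unfolding v'(4) by blast
      then have "u = (\<alpha> + \<beta>) \<cdot>\<^sub>v v'" by (simp add: add_smult_distrib_vec)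
      then show False using u(3) by blast
    qed
  qed
next
  fix n \<rho> assume irr: "complex_irrep G n \<rho>" and type: "quaternionic_type G n \<rho>"
  have rep: "matrix_rep G n \<rho>" using irr by (simp add: complex_irrep_iff)
  note D = D_op_carrier[OF rep, of w] D_op_semisimple[OF rep, of w]
  obtain J where J: "conj_linear_equivariant G n \<rho> J" and JJ: "\<And>v. v \<in> carrier_vec n \<Longrightarrow> J (J v) = - v"
    using type unfolding quaternionic_type_def by blast
  show "c_fun G S n \<rho> w \<noteq> 0"
  proof
    assume "c_fun G S n \<rho> w = 0"
    then obtain x where x: "3 \<le> Polynomial.order x (P_poly G S n \<rho> w)" unfolding c_fun_eq_0_iff[OF irr type] by blast
    then have "poly (P_poly G S n \<rho> w) x = 0" by (auto simp: order_root)
    then obtain \<mu> v where \<mu>: "x = complex_of_real \<mu>" and v: "v \<in> carrier_vec n" "v \<noteq> 0\<^sub>v n"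
      "D_op G S n \<rho> w *\<^sub>v v = complex_of_real \<mu> \<cdot>\<^sub>v v"
      using P_poly_root_eigenvector[OF rep] by metis
    have Jv: "J v \<in> carrier_vec n" using J v(1) by (auto simp: conj_linear_equivariant_def)
    obtain u where u: "u \<in> carrier_vec n" "D_op G S n \<rho> w *\<^sub>v u = complex_of_real \<mu> \<cdot>\<^sub>v u"
      "\<And>\<alpha> \<beta>. u \<noteq> \<alpha> \<cdot>\<^sub>v v + \<beta> \<cdot>\<^sub>v J v"
      using order_ge_3D[OF D _ v(1) Jv] x unfolding \<mu> P_poly_def by blast
    have "v = - 1 \<cdot>\<^sub>v J (J v)" if "v \<in> carrier_vec n" for v using JJ[OF that] that by (auto intro!: eq_vecI)
    from eigenvector_span_structure_map[OF simple irr J this v u(1,2)] show False using u(3) by blast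
  qed
qed

text \<open>A proper nonzero subrepresentation and its orthogonal complement each contain the
  coefficients of an irreducible representation for an eigenvector with eigenvalue
  \<open>\<mu>\<close>. The resultants of pairs allow only one representation
  \<open>\<tau>\<close> up to conjugation, and then \<open>\<tau>\<close> has two independent
  eigenvectors \<open>v'\<close> and \<open>u'\<close>. In the quaternionic type
  \<open>v'\<close>, \<open>J v'\<close> and \<open>u'\<close> are independent. So the
  characteristic polynomial has a root of a multiplicity that the other resultants
  exclude.\<close>

theorem generic_imp_real_G_simple:
  assumes gen: "generic_weight w"
  shows "real_G_simple G S w"
  unfolding real_G_simple_def
proof (intro allI impI)
  fix \<mu> assume nz: "L_eigenspace G S w \<mu> \<noteq> {\<zero>\<^bsub>real_functions G\<^esub>}"
  let ?E = "L_eigenspace G S w \<mu>"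
  have "U = {\<zero>\<^bsub>real_functions G\<^esub>} \<or> U = ?E"
    if U: "subrep class_ring (real_functions G) G (left_regular G) U" and UE: "U \<subseteq> ?E" for U
  proof (rule ccontr)
    assume contra: "\<not> ?thesis"
    define X where "X = complexification U"
    have X: "invariant_fspace X" unfolding X_def by (rule invariant_fspace_complexification[OF U])
    have EC: "invariant_fspace (complexification ?E)" by (rule invariant_fspace_complexification[OF subrep_L_eigenspace])
    have XE: "X \<subseteq> complexification ?E" using UE by (auto simp: X_def complexification_def)
    have Uc: "U \<subseteq> carrier G \<rightarrow>\<^sub>E UNIV" "(\<lambda>x\<in>carrier G. 0) \<in> U" using U unfolding subrep_real_functions_iff by blast+
    have Ec: "?E \<subseteq> carrier G \<rightarrow>\<^sub>E UNIV" "(\<lambda>x\<in>carrier G. 0) \<in> ?E"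
      using subrep_L_eigenspace[of w \<mu>] unfolding subrep_real_functions_iff by blast+
    have Xne: "X \<noteq> {}" using complexification_of_real[OF Uc Uc(2)] unfolding X_def by blast
    obtain f0 x0 where f0: "f0 \<in> X" "x0 \<in> carrier G" "f0 x0 \<noteq> 0"
    proof -
      have "(\<lambda>x\<in>carrier G. 0) \<in> U" by (rule Uc(2))
      then obtain f where f: "f \<in> U" "f \<noteq> (\<lambda>x\<in>carrier G. 0)"
        using contra unfolding zero_real_functions by blast
      have "\<exists>x\<in>carrier G. f x \<noteq> 0"
      proof (rule ccontr)
        assume "\<not> ?thesis"
        then have "f = (\<lambda>x\<in>carrier G. 0)" using f(1) Uc(1) by (intro extensionalityI[of f "carrier G"]) (auto simp: PiE_def)
        then show False using f(2) by simp
      qed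
      then show thesis using that complexification_of_real[OF Uc f(1)] unfolding X_def by force
    qed
    obtain f where f: "f \<in> ?E" "f \<notin> U" using contra UE by blast
    define F where "F x = complex_of_real (f x)" for x
    have FE: "F \<in> complexification ?E" unfolding F_def by (rule complexification_of_real[OF Ec f(1)])
    have "(\<lambda>x\<in>carrier G. Re (F x)) = f" using f(1) Ec(1) by (auto simp: F_def PiE_def extensional_restrict)
    then have "F \<notin> X" using f(2) unfolding X_def complexification_def by auto
    from orthogonal_component[OF X Xne this]
    obtain h u where u: "u \<in> X" and h: "\<And>x. h x = F x - u x" "\<exists>x\<in>carrier G. h x \<noteq> 0"
      and orth: "\<And>u'. u' \<in> X \<Longrightarrow> cinner h u' = 0" by metis
    \<comment> \<open>The orthogonal complement of \<open>X\<close> in the complexified eigenspace.\<close>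
    define Y where "Y = {h \<in> complexification ?E. \<forall>u\<in>X. cinner h u = 0}"
    have "(\<lambda>x. F x + (- 1) * u x) \<in> complexification ?E"
      using u XE FE by (intro fspace_add[OF EC] fspace_mult[OF EC]) auto
    then have "h \<in> complexification ?E" by (rule fspace_cong[OF EC]) (simp add: h(1))
    then have hY: "h \<in> Y" using orth by (simp add: Y_def)
    have Y: "invariant_fspace Y"
      unfolding invariant_fspace_def
    proof (intro conjI ballI allI impI)
      fix p q assume "p \<in> Y" "q \<in> Y"
      then show "(\<lambda>x. p x + q x) \<in> Y"
        using fspace_add[OF EC, of p q] by (simp add: Y_def cinner_def distrib_right sum.distrib)
    next
      fix c p assume "p \<in> Y"
      then show "(\<lambda>x. c * p x) \<in> Y"
        using fspace_mult[OF EC, of p c] by (simp add: Y_def cinner_def mult.assoc sum_distrib_left[symmetric])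
    next
      fix y p assume y: "y \<in> carrier G" and p: "p \<in> Y"
      have "cinner (\<lambda>x. p (y \<otimes> x)) u' = 0" if u': "u' \<in> X" for u'
      proof -
        have "cinner (\<lambda>x. p (y \<otimes> x)) u' = (\<Sum>x\<in>carrier G. p (y \<otimes> x) * cnj (u' (inv y \<otimes> (y \<otimes> x))))"
          unfolding cinner_def using y by (intro sum.cong refl) (simp add: m_assoc[symmetric])
        also have "\<dots> = cinner p (\<lambda>x. u' (inv y \<otimes> x))"
          unfolding cinner_def by (rule sum.reindex_bij_betw[OF bij_left_mult[OF y]])
        also have "\<dots> = 0" using p fspace_translate[OF X inv_closed[OF y] u'] by (simp add: Y_def)
        finally show ?thesis .
      qed
      then show "(\<lambda>x. p (y \<otimes> x)) \<in> Y" using p fspace_translate[OF EC y] by (simp add: Y_def)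
    next
      fix p q :: "'a \<Rightarrow> complex" assume p: "p \<in> Y" and eq: "\<forall>x\<in>carrier G. p x = q x"
      have "cinner q u' = cinner p u'" for u' using eq unfolding cinner_def by (intro sum.cong refl) simp
      then show "q \<in> Y" using p fspace_cong[OF EC, of p q] eq by (simp add: Y_def)
    qed
    have YE: "Y \<subseteq> complexification ?E" by (auto simp: Y_def)
    have XY: "p x = 0" if "p \<in> X" "p \<in> Y" "x \<in> carrier G" for p x
      using cinner_eq_0[of p x] that by (simp add: Y_def)
    obtain n \<rho> v where irr1: "complex_irrep G n \<rho>" and gv: "generates_within X n \<rho> v"
      using invariant_fspace_contains_irrep[OF X f0] by blast
    obtain m \<sigma> u where irr2: "complex_irrep G m \<sigma>" and gu: "generates_within Y m \<sigma> u"
      using invariant_fspace_contains_irrep[OF Y hY] h(2) by blast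
    have rep: "matrix_rep G n \<rho>" "matrix_rep G m \<sigma>" using irr1 irr2 by (simp_all add: complex_irrep_iff)
    have "poly (P_poly G S n \<rho> w) (complex_of_real \<mu>) = 0"
      using generates_within_eigenvector[OF rep(1) gv XE] gv unfolding P_poly_root_iff[OF rep(1)] generates_within_def by blast
    moreover have "poly (P_poly G S m \<sigma> w) (complex_of_real \<mu>) = 0"
      using generates_within_eigenvector[OF rep(2) gu YE] gu unfolding P_poly_root_iff[OF rep(2)] generates_within_def by blast
    ultimately have "a_fun G S n \<rho> m \<sigma> w = 0"
      unfolding a_fun_def by (rule resultant_eq_0_if_common_root[OF P_poly_degree(2)[OF rep(1)]])
    then have "rep_iso G m \<sigma> n \<rho> \<or> rep_iso G m \<sigma> n (dual_rep G \<rho>)"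
      using gen irr1 irr2 unfolding generic_weight_def by blast
    \<comment> \<open>\<open>X\<close> is closed under complex conjugation, so it also contains the coefficients of the conjugate
      representation.\<close>
    then obtain \<tau> v' where irr: "complex_irrep G n \<tau>" and gv': "generates_within X n \<tau> v'" and iso: "rep_iso G m \<sigma> n \<tau>"
    proof
      assume "rep_iso G m \<sigma> n \<rho>"
      then show thesis using that irr1 gv by blast
    next
      assume "rep_iso G m \<sigma> n (dual_rep G \<rho>)"
      moreover have "rep_iso G n (dual_rep G \<rho>) n (conj_rep \<rho>)"
        by (rule rep_iso_sym[OF matrix_rep_conj[OF rep(1)] matrix_rep_dual[OF rep(1)] conj_iso_dual[OF rep(1)]])
      ultimately have "rep_iso G m \<sigma> n (conj_rep \<rho>)"
        by (rule rep_iso_trans[OF rep(2) matrix_rep_dual[OF rep(1)] matrix_rep_conj[OF rep(1)]])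
      moreover have "generates_within X n (conj_rep \<rho>) (conjugate v)"
        by (rule generates_within_conj[OF rep(1) gv X]) (use complexification_cnj[OF U] in \<open>simp add: X_def\<close>)
      ultimately show thesis using that complex_irrep_conj[OF irr1] by blast
    qed
    have rep': "matrix_rep G n \<tau>" using irr by (simp add: complex_irrep_iff)
    obtain u' where gu': "generates_within Y n \<tau> u'" using generates_within_iso[OF rep(2) rep' iso gu Y] by blast
    have v': "v' \<in> carrier_vec n" "v' \<noteq> 0\<^sub>v n" and u': "u' \<in> carrier_vec n" "u' \<noteq> 0\<^sub>v n"
      using gv' gu' by (simp_all add: generates_within_def)
    have Dv: "D_op G S n \<tau> w *\<^sub>v v' = complex_of_real \<mu> \<cdot>\<^sub>v v'" by (rule generates_within_eigenvector[OF rep' gv' XE])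
    have Du: "D_op G S n \<tau> w *\<^sub>v u' = complex_of_real \<mu> \<cdot>\<^sub>v u'" by (rule generates_within_eigenvector[OF rep' gu' YE])
    have notX: "\<exists>a\<in>carrier_vec n. mcoeff \<tau> a u' \<notin> X"
    proof (intro bexI notI)
      show cu: "conjugate u' \<in> carrier_vec n" using u'(1) by simp
      assume mX: "mcoeff \<tau> (conjugate u') u' \<in> X"
      have mY: "mcoeff \<tau> (conjugate u') u' \<in> Y" using gu' cu by (simp add: generates_within_def)
      from XY[OF mX mY one_closed] have "conjugate u' \<bullet> u' = 0"
        unfolding mcoeff_one[OF rep' u'(1)] .
      then show False using scalar_prod_conjugate_eq_0[OF u'(1)] u'(2) by blast
    qed
    have inX: "mcoeff \<tau> a (\<alpha> \<cdot>\<^sub>v p + \<beta> \<cdot>\<^sub>v q) \<in> X"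
      if p: "p \<in> carrier_vec n" "mcoeff \<tau> a p \<in> X" and q: "q \<in> carrier_vec n" "mcoeff \<tau> a q \<in> X" and a: "a \<in> carrier_vec n"
      for \<alpha> \<beta> p q a
    proof (rule fspace_cong[OF X])
      show "(\<lambda>x. \<alpha> * mcoeff \<tau> a p x + \<beta> * mcoeff \<tau> a q x) \<in> X"
        using p q by (intro fspace_add[OF X] fspace_mult[OF X])
      fix x assume x: "x \<in> carrier G"
      have "mcoeff \<tau> a (\<alpha> \<cdot>\<^sub>v p + \<beta> \<cdot>\<^sub>v q) x = mcoeff \<tau> a (\<alpha> \<cdot>\<^sub>v p) x + mcoeff \<tau> a (\<beta> \<cdot>\<^sub>v q) x"
        unfolding mcoeff_def
        using mult_add_distrib_mat_vec[OF rep_carrier[OF rep' x], of "\<alpha> \<cdot>\<^sub>v p" "\<beta> \<cdot>\<^sub>v q"] p(1) q(1)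
          scalar_prod_add_distrib[OF a rep_vec[OF rep' x, of "\<alpha> \<cdot>\<^sub>v p"] rep_vec[OF rep' x, of "\<beta> \<cdot>\<^sub>v q"]] by simp
      then show "\<alpha> * mcoeff \<tau> a p x + \<beta> * mcoeff \<tau> a q x = mcoeff \<tau> a (\<alpha> \<cdot>\<^sub>v p + \<beta> \<cdot>\<^sub>v q) x"
        using mcoeff_smult[OF rep' a p(1) x] mcoeff_smult[OF rep' a q(1) x] by simp
    qed
    have notspan: "u' \<noteq> \<alpha> \<cdot>\<^sub>v v' + \<beta> \<cdot>\<^sub>v q"
      if q: "q \<in> carrier_vec n" "\<And>a. a \<in> carrier_vec n \<Longrightarrow> mcoeff \<tau> a q \<in> X" for \<alpha> \<beta> q
    proof
      assume "u' = \<alpha> \<cdot>\<^sub>v v' + \<beta> \<cdot>\<^sub>v q"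
      moreover have "mcoeff \<tau> a v' \<in> X" if "a \<in> carrier_vec n" for a using gv' that by (simp add: generates_within_def)
      ultimately show False using notX inX[OF v'(1) _ q(1)] q(2) by blast
    qed
    have "u' \<noteq> \<alpha> \<cdot>\<^sub>v v'" for \<alpha>
    proof -
      have "\<alpha> \<cdot>\<^sub>v v' = \<alpha> \<cdot>\<^sub>v v' + 0 \<cdot>\<^sub>v v'" using v'(1) by (intro eq_vecI) auto
      then show ?thesis using notspan[OF v'(1), of \<alpha> 0] gv' by (simp add: generates_within_def)
    qed
    note two = order_ge_2I(1)[OF D_op_carrier[OF rep'] D_op_semisimple[OF rep'] v'(1) u'(1) v'(2) this Dv Du]
    show False
    proof (cases "quaternionic_type G n \<tau>")
      case False
      then have "real_type G n \<tau> \<or> complex_type G n \<tau>" by (auto simp: complex_type_def)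
      then have "b_fun G S n \<tau> w \<noteq> 0" using gen irr unfolding generic_weight_def by blast
      then show False using two unfolding b_fun_eq_0_iff[OF irr] P_poly_def by blast
    next
      case True
      then obtain J where J: "conj_linear_equivariant G n \<tau> J" and JJ: "\<And>v. v \<in> carrier_vec n \<Longrightarrow> J (J v) = - v"
        unfolding quaternionic_type_def by blast
      have Jv: "J v' \<in> carrier_vec n" using J v'(1) by (auto simp: conj_linear_equivariant_def)
      have "mcoeff \<tau> a (J v') \<in> X" if a: "a \<in> carrier_vec n" for a
      proof -
        obtain a' where a': "a' \<in> carrier_vec n"
          and eq: "\<And>v x. v \<in> carrier_vec n \<Longrightarrow> x \<in> carrier G \<Longrightarrow> mcoeff \<tau> a (J v) x = cnj (mcoeff \<tau> a' v x)"
          using mcoeff_structure_map[OF rep' J a] by metis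
        have "mcoeff \<tau> a' v' \<in> X" using gv' a' by (simp add: generates_within_def)
        then have "(\<lambda>x. cnj (mcoeff \<tau> a' v' x)) \<in> X" unfolding X_def by (rule complexification_cnj[OF U])
        then show ?thesis by (rule fspace_cong[OF X]) (simp add: eq[OF v'(1)])
      qed
      from order_ge_2I(2)[OF D_op_carrier[OF rep'] D_op_semisimple[OF rep'] v'(1) Jv v'(2)
          quaternionic_independent[OF J JJ v'] Dv D_op_structure_map[OF rep' J v'(1) Dv] u'(1) Du notspan[OF Jv this]]
      have "c_fun G S n \<tau> w = 0" unfolding c_fun_eq_0_iff[OF irr True] P_poly_def by blast
      then show False using gen irr True unfolding generic_weight_def by blast
    qed
  qed
  then show "irreducible_subrep class_ring (real_functions G) G (left_regular G) ?E"
    unfolding irreducible_subrep_def using subrep_L_eigenspace nz by blast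
qed

end

section \<open>Existence and genericity of simple weights\<close>

context cayley_graph
begin

text \<open>The functions on the parameter space whose non-vanishing the theorem asks for.\<close>

definition resultant_functions :: "(('a set \<Rightarrow> real) \<Rightarrow> complex) set" where
  "resultant_functions =
    {a_fun G S n \<rho> m \<sigma> | n \<rho> m \<sigma>. complex_irrep G n \<rho> \<and> complex_irrep G m \<sigma> \<and> \<not> rep_iso G m \<sigma> n \<rho> \<and> \<not> rep_iso G m \<sigma> n (dual_rep G \<rho>)} \<union>
    {b_fun G S n \<rho> | n \<rho>. complex_irrep G n \<rho> \<and> (real_type G n \<rho> \<or> complex_type G n \<rho>)} \<union>
    {c_fun G S n \<rho> | n \<rho>. complex_irrep G n \<rho> \<and> quaternionic_type G n \<rho>}"

lemma generic_weight_iff: "generic_weight w \<longleftrightarrow> (\<forall>f\<in>resultant_functions. f w \<noteq> 0)"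
  unfolding generic_weight_def resultant_functions_def by blast

lemma polyfun_resultant_functions:
  assumes "f \<in> resultant_functions"
  shows "polyfun (inverse_pairs G S) f"
proof -
  have "polyfun (inverse_pairs G S) (\<lambda>w. a_fun G S n \<rho> m \<sigma> w)" if "complex_irrep G n \<rho>" "complex_irrep G m \<sigma>" for n \<rho> m \<sigma>
    unfolding a_fun_def using that
    by (intro polyfun_resultant[where m = n and n = m] polyfun_coeffs_P_poly P_poly_degree(1)) (simp_all add: complex_irrep_iff)
  moreover have "polyfun (inverse_pairs G S) (\<lambda>w. b_fun G S n \<rho> w)" if "complex_irrep G n \<rho>" for n \<rho>
    unfolding b_fun_def using that
    by (intro polyfun_resultant[where m = n and n = "n - 1"] polyfun_coeffs_pderiv polyfun_coeffs_P_poly)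
      (simp_all add: complex_irrep_iff degree_pderiv P_poly_degree(1))
  moreover have "polyfun (inverse_pairs G S) (\<lambda>w. c_fun G S n \<rho> w)" if "complex_irrep G n \<rho>" for n \<rho>
    unfolding c_fun_def using that
    by (intro polyfun_resultant[where m = n and n = "n - 1 - 1"] polyfun_coeffs_pderiv polyfun_coeffs_P_poly)
      (simp_all add: complex_irrep_iff degree_pderiv P_poly_degree(1))
  ultimately show ?thesis using assms unfolding resultant_functions_def by blast
qed

text \<open>Characteristic polynomials depend only on the isomorphism class, and there are
  finitely many classes.\<close>

lemma finite_resultant_functions: "finite resultant_functions"
proof -
  obtain R where R: "finite R"
    "\<And>m \<sigma>. complex_irrep G m \<sigma> \<Longrightarrow> \<exists>(n, \<rho>)\<in>R. complex_irrep G n \<rho> \<and> rep_iso G m \<sigma> n \<rho>"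
    using finitely_many_irreps by blast
  define PP where "PP = (\<lambda>(n, \<rho>). P_poly G S n \<rho>) ` R"
  have finP: "finite PP" using R(1) by (simp add: PP_def)
  have inP: "P_poly G S m \<sigma> \<in> PP" if irr: "complex_irrep G m \<sigma>" for m \<sigma>
  proof -
    obtain n \<rho> where n: "(n, \<rho>) \<in> R" "complex_irrep G n \<rho>" "rep_iso G m \<sigma> n \<rho>" using R(2)[OF irr] by blast
    have "P_poly G S m \<sigma> = P_poly G S n \<rho>"
      using P_poly_iso[OF _ _ n(3)] irr n(2) by (intro ext) (simp add: complex_irrep_iff)
    then show ?thesis using n(1) by (force simp: PP_def)
  qed
  let ?F = "(\<lambda>(p, q) w. resultant (p w) (q w)) ` (PP \<times> PP) \<union> (\<lambda>p w. resultant (p w) (pderiv (p w))) ` PP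
    \<union> (\<lambda>p w. resultant (p w) (pderiv (pderiv (p w)))) ` PP"
  have "resultant_functions \<subseteq> ?F"
  proof
    fix f assume "f \<in> resultant_functions"
    then consider n \<rho> m \<sigma> where "f = a_fun G S n \<rho> m \<sigma>" "complex_irrep G n \<rho>" "complex_irrep G m \<sigma>"
      | n \<rho> where "f = b_fun G S n \<rho>" "complex_irrep G n \<rho>"
      | n \<rho> where "f = c_fun G S n \<rho>" "complex_irrep G n \<rho>"
      unfolding resultant_functions_def by blast
    then show "f \<in> ?F"
    proof cases
      case (1 n \<rho> m \<sigma>)
      then have "f = (\<lambda>(p, q) w. resultant (p w) (q w)) (P_poly G S n \<rho>, P_poly G S m \<sigma>)"
        by (auto simp: a_fun_def fun_eq_iff)
      then show ?thesis using inP[OF 1(2)] inP[OF 1(3)] by blast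
    next
      case (2 n \<rho>)
      then have "f = (\<lambda>p w. resultant (p w) (pderiv (p w))) (P_poly G S n \<rho>)" by (auto simp: b_fun_def fun_eq_iff)
      then show ?thesis using inP[OF 2(2)] by blast
    next
      case (3 n \<rho>)
      then have "f = (\<lambda>p w. resultant (p w) (pderiv (pderiv (p w)))) (P_poly G S n \<rho>)" by (auto simp: c_fun_def fun_eq_iff)
      then show ?thesis using inP[OF 3(2)] by blast
    qed
  qed
  moreover have "finite ?F" using finP by simp
  ultimately show ?thesis by (rule finite_subset)
qed

lemma real_G_simple_iff_generic: "real_G_simple G S w \<longleftrightarrow> (\<forall>f\<in>resultant_functions. f w \<noteq> 0)"
  using real_G_simple_imp_generic generic_imp_real_G_simple unfolding generic_weight_iff by blast

lemma openin_weights: "openin (powertop_real (inverse_pairs G S)) (weights G S)"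
  unfolding weights_def param_space_def
  using finite_S by (intro openin_positive_orthant) (simp add: inverse_pairs_def)

theorem exists_simple_weight_iff:
  "(\<exists>w\<in>weights G S. real_G_simple G S w) \<longleftrightarrow>
    (\<forall>f\<in>resultant_functions. \<exists>\<alpha>\<in>topspace (param_space G S). f \<alpha> \<noteq> 0)"
proof
  assume "\<exists>w\<in>weights G S. real_G_simple G S w"
  then show "\<forall>f\<in>resultant_functions. \<exists>\<alpha>\<in>topspace (param_space G S). f \<alpha> \<noteq> 0"
    unfolding real_G_simple_iff_generic weights_def by blast
next
  assume nz: "\<forall>f\<in>resultant_functions. \<exists>\<alpha>\<in>topspace (param_space G S). f \<alpha> \<noteq> 0"
  have "(\<lambda>p\<in>inverse_pairs G S. 1) \<in> weights G S" by (simp add: weights_def param_space_def)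
  then have "\<exists>w\<in>weights G S. \<forall>f\<in>resultant_functions. f w \<noteq> 0"
    using nz by (intro polyfuns_nonzero_in_open[OF finite_resultant_functions polyfun_resultant_functions _ openin_weights])
      (auto simp: param_space_def PiE_def)
  then show "\<exists>w\<in>weights G S. real_G_simple G S w" unfolding real_G_simple_iff_generic .
qed

text \<open>The weights that are not simple form a finite union of zero sets of polynomial
  functions, each nowhere dense.\<close>

theorem residual_simple_weights:
  assumes nz: "\<forall>f\<in>resultant_functions. \<exists>\<alpha>\<in>topspace (param_space G S). f \<alpha> \<noteq> 0"
  shows "residual_in (weight_space G S) {w \<in> weights G S. real_G_simple G S w}"
proof -
  have top: "topspace (weight_space G S) = weights G S"
    unfolding weight_space_def by (auto simp: weights_def)
  let ?Z = "\<lambda>f. {w \<in> weights G S. f w = 0}"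
  have "nowhere_dense_in (weight_space G S) (?Z f)" if f: "f \<in> resultant_functions" for f
  proof -
    obtain \<alpha> where \<alpha>: "\<alpha> \<in> topspace (param_space G S)" "f \<alpha> \<noteq> 0" using nz f by blast
    have "\<alpha> \<in> extensional (inverse_pairs G S)" using \<alpha>(1) by (auto simp: param_space_def PiE_def)
    from nowhere_dense_polyfun_zeros[OF polyfun_resultant_functions[OF f] this \<alpha>(2) openin_weights]
    show ?thesis unfolding weight_space_def param_space_def .
  qed
  moreover have "weights G S - {w \<in> weights G S. real_G_simple G S w} = \<Union> (?Z ` resultant_functions)"
    unfolding real_G_simple_iff_generic by blast
  ultimately show ?thesis
    unfolding residual_in_def meager_in_def top
    using finite_resultant_functions by (intro conjI exI[of _ "?Z ` resultant_functions"]) (auto intro: countable_finite)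
qed

end

theorem theorem4p2:
  fixes G :: "('g, 'm) monoid_scheme" and S :: "'g set"
  assumes "group G"
    and "finite (carrier G)"
    and "S \<subseteq> carrier G - {\<one>\<^bsub>G\<^esub>}"
    and "\<And>s. s \<in> S \<Longrightarrow> inv\<^bsub>G\<^esub> s \<in> S"
    and "generate G S = carrier G"
  shows "((\<exists>w\<in>weights G S. real_G_simple G S w) \<longleftrightarrow>
      (\<forall>n\<^sub>1 \<rho>\<^sub>1 n\<^sub>2 \<rho>\<^sub>2. complex_irrep G n\<^sub>1 \<rho>\<^sub>1 \<and> complex_irrep G n\<^sub>2 \<rho>\<^sub>2 \<and>
          \<not> rep_iso G n\<^sub>2 \<rho>\<^sub>2 n\<^sub>1 \<rho>\<^sub>1 \<and> \<not> rep_iso G n\<^sub>2 \<rho>\<^sub>2 n\<^sub>1 (dual_rep G \<rho>\<^sub>1) \<longrightarrow>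
          (\<exists>\<alpha>\<in>topspace (param_space G S). a_fun G S n\<^sub>1 \<rho>\<^sub>1 n\<^sub>2 \<rho>\<^sub>2 \<alpha> \<noteq> 0)) \<and>
      (\<forall>n \<rho>. complex_irrep G n \<rho> \<and> (real_type G n \<rho> \<or> complex_type G n \<rho>) \<longrightarrow>
          (\<exists>\<alpha>\<in>topspace (param_space G S). b_fun G S n \<rho> \<alpha> \<noteq> 0)) \<and>
      (\<forall>n \<rho>. complex_irrep G n \<rho> \<and> quaternionic_type G n \<rho> \<longrightarrow>
          (\<exists>\<alpha>\<in>topspace (param_space G S). c_fun G S n \<rho> \<alpha> \<noteq> 0))) \<and>
    ((\<exists>w\<in>weights G S. real_G_simple G S w) \<longrightarrow>
      residual_in (weight_space G S) {w \<in> weights G S. real_G_simple G S w})"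
proof -
  interpret group G by (rule assms(1))
  interpret cayley_graph G S using assms(2-4) by unfold_locales auto
  have cond: "(\<forall>f\<in>resultant_functions. \<exists>\<alpha>\<in>topspace (param_space G S). f \<alpha> \<noteq> 0) \<longleftrightarrow>
      (\<forall>n\<^sub>1 \<rho>\<^sub>1 n\<^sub>2 \<rho>\<^sub>2. complex_irrep G n\<^sub>1 \<rho>\<^sub>1 \<and> complex_irrep G n\<^sub>2 \<rho>\<^sub>2 \<and>
          \<not> rep_iso G n\<^sub>2 \<rho>\<^sub>2 n\<^sub>1 \<rho>\<^sub>1 \<and> \<not> rep_iso G n\<^sub>2 \<rho>\<^sub>2 n\<^sub>1 (dual_rep G \<rho>\<^sub>1) \<longrightarrow>
          (\<exists>\<alpha>\<in>topspace (param_space G S). a_fun G S n\<^sub>1 \<rho>\<^sub>1 n\<^sub>2 \<rho>\<^sub>2 \<alpha> \<noteq> 0)) \<and>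
      (\<forall>n \<rho>. complex_irrep G n \<rho> \<and> (real_type G n \<rho> \<or> complex_type G n \<rho>) \<longrightarrow>
          (\<exists>\<alpha>\<in>topspace (param_space G S). b_fun G S n \<rho> \<alpha> \<noteq> 0)) \<and>
      (\<forall>n \<rho>. complex_irrep G n \<rho> \<and> quaternionic_type G n \<rho> \<longrightarrow>
          (\<exists>\<alpha>\<in>topspace (param_space G S). c_fun G S n \<rho> \<alpha> \<noteq> 0))"
    (is "_ \<longleftrightarrow> ?a \<and> ?b \<and> ?c")
  proof
    assume nz: "\<forall>f\<in>resultant_functions. \<exists>\<alpha>\<in>topspace (param_space G S). f \<alpha> \<noteq> 0"
    show "?a \<and> ?b \<and> ?c"
    proof (intro conjI allI impI; elim conjE)
      fix n\<^sub>1 \<rho>\<^sub>1 n\<^sub>2 \<rho>\<^sub>2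
      assume "complex_irrep G n\<^sub>1 \<rho>\<^sub>1" "complex_irrep G n\<^sub>2 \<rho>\<^sub>2"
        "\<not> rep_iso G n\<^sub>2 \<rho>\<^sub>2 n\<^sub>1 \<rho>\<^sub>1" "\<not> rep_iso G n\<^sub>2 \<rho>\<^sub>2 n\<^sub>1 (dual_rep G \<rho>\<^sub>1)"
      then have "a_fun G S n\<^sub>1 \<rho>\<^sub>1 n\<^sub>2 \<rho>\<^sub>2 \<in> resultant_functions" unfolding resultant_functions_def by blast
      then show "\<exists>\<alpha>\<in>topspace (param_space G S). a_fun G S n\<^sub>1 \<rho>\<^sub>1 n\<^sub>2 \<rho>\<^sub>2 \<alpha> \<noteq> 0" using nz by blast
    next
      fix n \<rho> assume "complex_irrep G n \<rho>" "real_type G n \<rho> \<or> complex_type G n \<rho>"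
      then have "b_fun G S n \<rho> \<in> resultant_functions" unfolding resultant_functions_def by blast
      then show "\<exists>\<alpha>\<in>topspace (param_space G S). b_fun G S n \<rho> \<alpha> \<noteq> 0" using nz by blast
    next
      fix n \<rho> assume "complex_irrep G n \<rho>" "quaternionic_type G n \<rho>"
      then have "c_fun G S n \<rho> \<in> resultant_functions" unfolding resultant_functions_def by blast
      then show "\<exists>\<alpha>\<in>topspace (param_space G S). c_fun G S n \<rho> \<alpha> \<noteq> 0" using nz by blast
    qed
  next
    assume "?a \<and> ?b \<and> ?c"
    then show "\<forall>f\<in>resultant_functions. \<exists>\<alpha>\<in>topspace (param_space G S). f \<alpha> \<noteq> 0"
      unfolding resultant_functions_def by blast
  qed
  show ?thesis
    unfolding cond[symmetric]
    using exists_simple_weight_iff residual_simple_weights by blast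
qed

end
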